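(* For every $\epsilon>0$ there is a constant $C_\epsilon>0$ such that for every odd prime $p$ at least one of the following holds: (i) $n_p \le C_\epsilon\, p^{1/(6\sqrt{e})+\epsilon}$; (ii) for every integer $c$ with $\gcd(c,p)=1$ and every positive integer $H \ge C_\epsilon\, p^{1/6+\epsilon}$, there exist $X,Y\in\{0,1,\dots,p-1\}$ such that $|H_c \cap B(X,Y;H)| \ge 2$.
   Context: For an odd prime $p$, $n_p$ denotes the least positive integer that is a quadratic nonresidue modulo $p$. For $c$ an integer with $\gcd(c,p)=1$, the modular hyperbola is $H_c := \{(x,y) : x,y \in \mathbb{Z}/p\mathbb{Z},\ xy \equiv c \pmod p\}$. For integers $X,Y$ and a positive integer $H$, the box is $B(X,Y;H) := \{(x,y) : x \equiv X + i \pmod p,\ y \equiv Y + j \pmod p \text{ for some } 1\le i,j\le H\}$, viewed as a set of pairs of residues modulo $p$. $|S|$ denotes the number of elements of a set $S$. *)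

theory Defs
  imports Complex_Main "HOL-Number_Theory.Number_Theory"
begin

text \<open>
  \<open>QuadRes\<close> counts multiples of the modulus as residues, so its negation
  already excludes them. For an odd prime a nonresidue exists, so the \<open>LEAST\<close> is well defined.
\<close>
definition least_nonresidue :: "nat \<Rightarrow> nat" where
  "least_nonresidue p = (LEAST n. n > 0 \<and> \<not> QuadRes (int p) (int n))"

text \<open>Residue classes modulo \<open>p\<close> are represented by the integers in \<open>{0..<int p}\<close>.\<close>
definition modular_hyperbola :: "nat \<Rightarrow> int \<Rightarrow> (int \<times> int) set" where
  "modular_hyperbola p c =
    {(x, y). x \<in> {0..<int p} \<and> y \<in> {0..<int p} \<and> [x * y = c] (mod int p)}"

definition modular_box :: "nat \<Rightarrow> int \<Rightarrow> int \<Rightarrow> nat \<Rightarrow> (int \<times> int) set" where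
  "modular_box p X Y H =
    {(x, y). x \<in> {0..<int p} \<and> y \<in> {0..<int p} \<and>
      (\<exists>i\<in>{1..int H}. \<exists>j\<in>{1..int H}. [x = X + i] (mod int p) \<and> [y = Y + j] (mod int p))}"

end

theory Submission
  imports Defs "HOL-Computational_Algebra.Polynomial_Factorial"
begin

text \<open>
  Two points \<open>(x, y)\<close> and \<open>(x + a, y + b)\<close> lie on the hyperbola \<open>x y = c\<close> iff \<open>x\<close> solves a
  quadratic equation of discriminant \<open>a b (a b - 4 c)\<close>. If no box of side \<open>H\<close> contains two
  points, then \<open>\<chi> (a b - 4 c) = - \<chi> (a b)\<close> for all \<open>1 \<le> a, b < H\<close>, where \<open>\<chi>\<close> is the Legendre
  symbol; that is, \<open>\<chi> (t + h) = - \<chi> (q) \<chi> (b + h q)\<close> for \<open>t = (b - 4 c / a) / q\<close> modulo \<open>p\<close>.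
  If moreover the least nonresidue is large, then by Vinogradov's trick and Mertens' theorem \<open>\<chi>\<close> has a
  positive mean on \<open>[1, H]\<close>, so \<open>\<chi>\<close> is biased on the short interval \<open>[t + 1, t + p ^ \<eta>]\<close> for
  many of the more than \<open>p ^ (1/2 + \<eta>)\<close> residues \<open>t\<close>. These are essentially distinct when \<open>a\<close>
  and \<open>q\<close> run over primes, because coincidences force \<open>a\<close> or \<open>q\<close> to divide one of few
  fixed nonzero integers below \<open>p\<close>. Weil's bound for \<open>\<Sum>x. \<chi> (f x)\<close>, \<open>f\<close> a product of linear
  factors, bounds the high moments of short character sums and rules out so many biased intervals.
  The needed half of Weil's bound is obtained by Stepanov's method, carried out with integer polynomials
  modulo \<open>p\<close> (there is no type of residues for a variable prime).
\<close>

section \<open>Multiplicities of roots modulo a prime\<close>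

text \<open>If \<chi> = 1 up to y, the mean of \<chi> on [1, B] is at least 1 - 2 ln (ln B / ln y)
  up to a small error. This is positive iff ln B / ln y < sqrt e, whence the factor 1 / sqrt e in
  the exponent. The exponent 1/6 is where two demands on a \<le> M, b \<le> B, q \<le> N meet, all
  three bounds being close to H. The number of residues t, about M B N, must exceed p ^ (1/2), the
  size of the normalised moment bound. And 2 * M ^ 3 * B * N ^ 2 must stay below p. The second
  demand comes from the main obstacle: k = 4 c is an arbitrary residue, so a single coincidence
  carries no divisibility information. But it determines k as a ratio of small integers modulo p,
  and eliminating k from two coincidences gives an equality of integers as long as M ^ 3 * B * N ^ 2
  is below p / 2. As M enters with its cube, it is taken a little below p ^ (1/6), and B and N a
  little above.\<close>

definition mod_dvd :: "nat \<Rightarrow> int poly \<Rightarrow> int poly \<Rightarrow> bool" where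
  "mod_dvd p A B \<longleftrightarrow> (\<exists>W. [:int p:] dvd B - A * W)"

lemma const_dvd_poly: "[:c:] dvd P \<Longrightarrow> c dvd poly P a" for c :: "'a::comm_ring_1"
  by (auto elim!: dvdE)

lemma int_prime_dvd_mult_iff: "prime p \<Longrightarrow> int p dvd a * b \<longleftrightarrow> int p dvd a \<or> int p dvd b"
  by (simp add: prime_dvd_mult_iff)

lemma prime_elem_const: "prime p \<Longrightarrow> prime_elem [:int p:]"
  by (simp add: prime_elem_const_poly_iff)

text \<open>Gauss's lemma: p stays prime in the ring of integer polynomials. Divisibility by
  \<open>[:int p:]\<close> is thus vanishing in a domain and replaces equality of polynomials over
  the field of p elements.\<close>

lemma const_dvd_mult_iff:
  "prime p \<Longrightarrow> [:int p:] dvd A * B \<longleftrightarrow> [:int p:] dvd A \<or> [:int p:] dvd B"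
  using prime_elem_const prime_elem_dvd_mult_iff by blast

lemma const_dvd_power: "prime p \<Longrightarrow> [:int p:] dvd A ^ n \<Longrightarrow> [:int p:] dvd A"
  using prime_elem_const prime_elem_dvd_power by blast

lemma not_const_dvd_linear: "prime p \<Longrightarrow> \<not> [:int p:] dvd [:b, 1:]"
  by (auto simp: const_poly_dvd_iff coeff_pCons split: nat.splits dest!: spec[of _ 1])

lemma const_dvd_linear_power_mult:
  "prime p \<Longrightarrow> [:int p:] dvd [:b, 1:] ^ n * A \<longleftrightarrow> [:int p:] dvd A"
  using const_dvd_mult_iff const_dvd_power not_const_dvd_linear by blast

lemma mod_dvd_synthetic_div:
  "int p dvd poly P a \<Longrightarrow> [:int p:] dvd P - [:-a, 1:] * synthetic_div P a"
proof -
  assume "int p dvd poly P a"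
  moreover have "P - [:-a, 1:] * synthetic_div P a = [:poly P a:]"
    using synthetic_div_correct'[of a P] by (metis add_diff_cancel_left')
  ultimately show ?thesis by simp
qed

lemma mod_dvd_1 [simp]: "mod_dvd p 1 P"
  unfolding mod_dvd_def by (intro exI[of _ P]) auto

text \<open>Once (X - b) ^ l is split off W, cancelling it leaves F V = (X - b) U modulo p;
  evaluation at b forces V(b) = 0, as F(b) is a unit.\<close>

lemma mod_dvd_power_cancel:
  assumes p: "prime p" and F: "\<not> int p dvd poly F b"
  shows "mod_dvd p ([:-b, 1:] ^ l) (F * W) \<Longrightarrow> mod_dvd p ([:-b, 1:] ^ l) W"
proof (induction l)
  case 0
  then show ?case by simp
next
  case (Suc l)
  then obtain U where U: "[:int p:] dvd F * W - [:-b, 1:] ^ Suc l * U"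
    unfolding mod_dvd_def by blast
  have "F * W - [:-b, 1:] ^ l * ([:-b, 1:] * U) = F * W - [:-b, 1:] ^ Suc l * U"
    by (simp add: algebra_simps)
  then have "mod_dvd p ([:-b, 1:] ^ l) (F * W)"
    unfolding mod_dvd_def using U by metis
  then obtain V where V: "[:int p:] dvd W - [:-b, 1:] ^ l * V"
    using Suc.IH unfolding mod_dvd_def by blast
  have "[:int p:] dvd (F * W - [:-b, 1:] ^ Suc l * U) - F * (W - [:-b, 1:] ^ l * V)"
    by (intro dvd_diff U dvd_mult V)
  also have "\<dots> = [:-b, 1:] ^ l * (F * V - [:-b, 1:] * U)" by (simp add: algebra_simps)
  finally have "[:int p:] dvd F * V - [:-b, 1:] * U"
    using p const_dvd_linear_power_mult by blast
  from const_dvd_poly[OF this, of b] have "int p dvd poly F b * poly V b" by simp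
  with F p have "int p dvd poly V b"
    using int_prime_dvd_mult_iff[OF p] by blast
  then have "[:int p:] dvd [:-b, 1:] ^ l * (V - [:-b, 1:] * synthetic_div V b)"
    using mod_dvd_synthetic_div by (intro dvd_mult)
  with V have "[:int p:] dvd (W - [:-b, 1:] ^ l * V) + [:-b, 1:] ^ l * (V - [:-b, 1:] * synthetic_div V b)"
    by (rule dvd_add)
  also have "\<dots> = W - [:-b, 1:] ^ Suc l * synthetic_div V b" by (simp add: algebra_simps)
  finally show ?case unfolding mod_dvd_def by blast
qed

section \<open>Detecting multiplicities by derivatives\<close>

lemma pderiv_linear_power_mult:
  "pderiv ([:-a, 1:] ^ Suc k * W) =
    [:-a, 1:] ^ k * (of_nat (Suc k) * W + [:-a, 1:] * pderiv W)" for a :: "'a::idom"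
proof -
  have "pderiv ([:-a, 1:] ^ Suc k) = of_nat (Suc k) * [:-a, 1:] ^ k"
    by (simp only: pderiv_power_Suc) (simp add: pderiv_pCons of_nat_poly del: of_nat_Suc)
  then show ?thesis
    unfolding pderiv_mult by (simp only: power_Suc distrib_left) (simp only: mult_ac add_ac)
qed

lemma poly_higher_pderiv_linear_power_mult:
  "poly ((pderiv ^^ k) ([:-a, 1:] ^ k * W)) a = fact k * poly W a" for a :: int
proof (induction k arbitrary: W)
  case 0
  then show ?case by simp
next
  case (Suc k)
  have "(pderiv ^^ Suc k) ([:-a, 1:] ^ Suc k * W) =
      (pderiv ^^ k) ([:-a, 1:] ^ k * (of_nat (Suc k) * W + [:-a, 1:] * pderiv W))"
    unfolding funpow_Suc_right o_def pderiv_linear_power_mult ..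
  also have "poly \<dots> a = fact k * poly (of_nat (Suc k) * W + [:-a, 1:] * pderiv W) a"
    by (rule Suc.IH)
  also have "\<dots> = fact (Suc k) * poly W a" by (simp add: algebra_simps)
  finally show ?case .
qed

lemma higher_pderiv_diff: "(pderiv ^^ n) (P - Q) = (pderiv ^^ n) P - (pderiv ^^ n) Q"
  for P :: "'a::idom poly"
  by (induction n) (simp_all add: pderiv_diff)

lemma const_dvd_higher_pderiv: "[:c:] dvd P \<Longrightarrow> [:c:] dvd (pderiv ^^ n) P" for c :: "'a::idom"
proof (induction n)
  case (Suc n)
  then obtain R where "(pderiv ^^ n) P = smult c R" by (auto elim!: dvdE)
  then have "(pderiv ^^ Suc n) P = [:c:] * pderiv R" by (simp add: pderiv_smult)
  then show ?case by (metis dvd_triv_left)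
qed simp

text \<open>The derivative of order s at a is s! times a Taylor coefficient, and s! is invertible
  modulo p for s < p; this is where \<open>l \<le> p\<close> enters.\<close>

lemma mod_dvd_power_if_higher_pderiv:
  assumes p: "prime p"
  shows "\<lbrakk>l \<le> p; \<And>s. s < l \<Longrightarrow> int p dvd poly ((pderiv ^^ s) P) a\<rbrakk> \<Longrightarrow> mod_dvd p ([:-a, 1:] ^ l) P"
proof (induction l)
  case 0
  then show ?case by simp
next
  case (Suc l)
  then obtain V where V: "[:int p:] dvd P - [:-a, 1:] ^ l * V"
    unfolding mod_dvd_def by force
  have "int p dvd poly ((pderiv ^^ l) (P - [:-a, 1:] ^ l * V)) a"
    using V const_dvd_higher_pderiv const_dvd_poly by blast
  then have "int p dvd poly ((pderiv ^^ l) P) a - fact l * poly V a"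
    by (simp add: higher_pderiv_diff poly_higher_pderiv_linear_power_mult)
  moreover have "int p dvd poly ((pderiv ^^ l) P) a" using Suc.prems by simp
  ultimately have "int p dvd fact l * poly V a" by (simp add: dvd_diff_right_iff)
  moreover have "\<not> int p dvd fact l"
  proof -
    have "int p dvd int (fact l) \<longleftrightarrow> p \<le> l"
      unfolding of_nat_dvd_iff using p by (rule prime_dvd_fact_iff)
    then show ?thesis using Suc.prems(1) by (simp only: of_nat_fact)
  qed
  ultimately have "int p dvd poly V a"
    using int_prime_dvd_mult_iff[OF p] by blast
  then have "[:int p:] dvd [:-a, 1:] ^ l * (V - [:-a, 1:] * synthetic_div V a)"
    using mod_dvd_synthetic_div by (intro dvd_mult)
  with V have "[:int p:] dvd (P - [:-a, 1:] ^ l * V) + [:-a, 1:] ^ l * (V - [:-a, 1:] * synthetic_div V a)"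
    by (rule dvd_add)
  also have "\<dots> = P - [:-a, 1:] ^ Suc l * synthetic_div V a" by (simp add: algebra_simps)
  finally show ?case unfolding mod_dvd_def by blast
qed

lemma degree_pos_if_root:
  assumes "int p dvd poly P a" "\<not> [:int p:] dvd P"
  shows "degree P > 0"
proof (rule ccontr)
  assume "\<not> degree P > 0"
  then obtain c where "P = [:c:]" by (auto elim: degree_eq_zeroE)
  with assms show False by simp
qed

text \<open>Induction on the total multiplicity: removing one factor X - a lowers the degree and
  \<open>m a\<close> by one. The powers at the other points survive because X - a does not vanish
  there; for this, distinct elements of \<open>S\<close> must be distinct modulo p.\<close>

lemma sum_multiplicities_le_degree:
  assumes p: "prime p" and S: "finite S" "S \<subseteq> {0..<int p}"
  shows "\<lbrakk>\<not> [:int p:] dvd P; \<And>a. a \<in> S \<Longrightarrow> mod_dvd p ([:-a, 1:] ^ m a) P\<rbrakk> \<Longrightarrow> sum m S \<le> degree P"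
proof (induction "sum m S" arbitrary: m P)
  case 0
  then show ?case by simp
next
  case (Suc N)
  then obtain a where a: "a \<in> S" "m a > 0"
    by (metis S(1) gr0I sum.neutral zero_less_Suc less_numeral_extra(3))
  then obtain k where k: "m a = Suc k" using gr0_conv_Suc by blast
  define Q where "Q = synthetic_div P a"
  obtain U where U: "[:int p:] dvd P - [:-a, 1:] ^ m a * U"
    using Suc.prems(2)[OF a(1)] unfolding mod_dvd_def by blast
  have root: "int p dvd poly P a"
    using const_dvd_poly[OF U, of a] k by simp
  have Q: "[:int p:] dvd P - [:-a, 1:] * Q" unfolding Q_def by (rule mod_dvd_synthetic_div[OF root])
  have nz: "\<not> [:int p:] dvd Q"
  proof
    assume "[:int p:] dvd Q"
    then have "[:int p:] dvd (P - [:-a, 1:] * Q) + [:-a, 1:] * Q" by (intro dvd_add Q dvd_mult)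
    with Suc.prems(1) show False by simp
  qed
  have deg: "degree P = Suc (degree Q)"
    using degree_pos_if_root[OF root Suc.prems(1)] unfolding Q_def by (simp add: degree_synthetic_div)
  define m' where "m' = m(a := k)"
  have sum': "sum m S = Suc (sum m' S)"
    using a k S(1) by (simp add: m'_def sum.remove[of S a])
  have "mod_dvd p ([:-b, 1:] ^ m' b) Q" if b: "b \<in> S" for b
  proof (cases "b = a")
    case True
    have "[:int p:] dvd (P - [:-a, 1:] ^ m a * U) - (P - [:-a, 1:] * Q)" by (intro dvd_diff U Q)
    also have "\<dots> = [:-a, 1:] ^ 1 * (Q - [:-a, 1:] ^ k * U)" by (simp add: k algebra_simps)
    finally have "[:int p:] dvd Q - [:-a, 1:] ^ k * U" using p const_dvd_linear_power_mult by blast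
    with True show ?thesis unfolding mod_dvd_def m'_def by auto
  next
    case False
    obtain V where V: "[:int p:] dvd P - [:-b, 1:] ^ m b * V"
      using Suc.prems(2)[OF b] unfolding mod_dvd_def by blast
    have "[:int p:] dvd (P - [:-b, 1:] ^ m b * V) - (P - [:-a, 1:] * Q)" by (intro dvd_diff V Q)
    also have "\<dots> = [:-a, 1:] * Q - [:-b, 1:] ^ m b * V" by simp
    finally have *: "mod_dvd p ([:-b, 1:] ^ m b) ([:-a, 1:] * Q)" unfolding mod_dvd_def by blast
    have "\<not> int p dvd b - a"
    proof
      assume "int p dvd b - a"
      moreover have "\<bar>b - a\<bar> < int p" using subsetD[OF S(2) a(1)] subsetD[OF S(2) b] by (simp add: abs_less_iff)
      ultimately show False using False zdvd_imp_le[of "int p" "\<bar>b - a\<bar>"] by simp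
    qed
    then have "\<not> int p dvd poly [:-a, 1:] b" by (simp add: algebra_simps)
    from mod_dvd_power_cancel[OF p this *] show ?thesis using False by (simp add: m'_def)
  qed
  then have "sum m' S \<le> degree Q"
    using Suc.hyps(1)[of m' Q] Suc.hyps(2) sum' nz by simp
  with sum' deg show ?case by simp
qed

section \<open>Orders of vanishing and their parity\<close>

lemma dvd_diff_trans: "d dvd a - b \<Longrightarrow> d dvd b - c \<Longrightarrow> d dvd a - c" for a :: "'a::comm_ring_1"
  using dvd_add[of d "a - b" "b - c"] by simp

lemma dvd_diff_mult: "d dvd a - b \<Longrightarrow> d dvd a' - b' \<Longrightarrow> d dvd a * a' - b * b'"
  for a :: "'a::comm_ring_1"
  using dvd_diff_trans[of d "a * a'" "b * a'" "b * b'"]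
  by (metis dvd_mult dvd_mult2 left_diff_distrib right_diff_distrib)

lemma dvd_diff_power: "d dvd a - b \<Longrightarrow> d dvd a ^ n - b ^ n" for a :: "'a::comm_ring_1"
  by (induction n) (simp_all add: dvd_diff_mult)

lemma exists_unramified_part:
  "\<not> [:int p:] dvd P \<Longrightarrow>
    \<exists>i Q. [:int p:] dvd P - [:-a, 1:] ^ i * Q \<and> \<not> int p dvd poly Q a"
proof (induction "degree P" arbitrary: P rule: less_induct)
  case less
  show ?case
  proof (cases "int p dvd poly P a")
    case False
    then show ?thesis by (intro exI[of _ 0] exI[of _ P]) simp
  next
    case True
    define Q where "Q = synthetic_div P a"
    have Q: "[:int p:] dvd P - [:-a, 1:] * Q" unfolding Q_def by (rule mod_dvd_synthetic_div[OF True])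
    have "\<not> [:int p:] dvd Q"
    proof
      assume "[:int p:] dvd Q"
      then have "[:int p:] dvd (P - [:-a, 1:] * Q) + [:-a, 1:] * Q" by (intro dvd_add Q dvd_mult)
      with less.prems show False by simp
    qed
    moreover have "degree Q < degree P"
      using degree_pos_if_root[OF True less.prems] unfolding Q_def by (simp add: degree_synthetic_div)
    ultimately obtain i R where R: "[:int p:] dvd Q - [:-a, 1:] ^ i * R" "\<not> int p dvd poly R a"
      using less.hyps by blast
    have "[:int p:] dvd (P - [:-a, 1:] * Q) + [:-a, 1:] * (Q - [:-a, 1:] ^ i * R)"
      by (intro dvd_add Q dvd_mult R)
    also have "\<dots> = P - [:-a, 1:] ^ Suc i * R" by (simp add: algebra_simps)
    finally show ?thesis using R(2) by blast
  qed
qed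

lemma linear_powers_cong_imp_root:
  assumes p: "prime p" and "s < t" and AB: "[:int p:] dvd [:-a, 1:] ^ s * A - [:-a, 1:] ^ t * B"
  shows "int p dvd poly A a"
proof -
  obtain k where k: "t = s + Suc k" using \<open>s < t\<close> less_iff_Suc_add by auto
  have "[:-a, 1:] ^ s * A - [:-a, 1:] ^ t * B = [:-a, 1:] ^ s * (A - [:-a, 1:] ^ Suc k * B)"
    unfolding k power_add by (simp only: right_diff_distrib mult.assoc)
  then have "[:int p:] dvd A - [:-a, 1:] ^ Suc k * B"
    using AB const_dvd_linear_power_mult[OF p] by metis
  from const_dvd_poly[OF this, of a] show ?thesis by simp
qed

text \<open>Compare the parities of the orders of vanishing at \<open>a\<close> on both sides.\<close>
lemma odd_order_times_square_cong_square:
  assumes p: "prime p" and "odd e" and F: "\<not> int p dvd poly F a" and c: "\<not> int p dvd c"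
    and eq: "[:int p:] dvd [:-a, 1:] ^ e * F * k ^ 2 - [:c:] * m ^ 2"
  shows "[:int p:] dvd k \<and> [:int p:] dvd m"
proof (cases "[:int p:] dvd k")
  case True
  then have "[:int p:] dvd [:-a, 1:] ^ e * F * k ^ 2" by (simp add: power2_eq_square)
  with eq have "[:int p:] dvd [:c:] * m ^ 2" using dvd_diff_right_iff by blast
  then have "[:int p:] dvd m ^ 2" using c unfolding const_dvd_mult_iff[OF p] by simp
  with True show ?thesis using const_dvd_power[OF p] by blast
next
  case False
  have "\<not> [:int p:] dvd [:-a, 1:] ^ e * F * k ^ 2"
    using False F const_dvd_poly[of "int p" F a]
    by (auto simp: const_dvd_mult_iff[OF p] dest!: const_dvd_power[OF p] simp: not_const_dvd_linear[OF p])
  with eq have "\<not> [:int p:] dvd [:c:] * m ^ 2" using dvd_diff_left_iff by blast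
  then have "\<not> [:int p:] dvd m" by (auto simp only: power2_eq_square intro: dvd_mult)
  then obtain j m' where m': "[:int p:] dvd m - [:-a, 1:] ^ j * m'" "\<not> int p dvd poly m' a"
    using exists_unramified_part by blast
  obtain i k' where k': "[:int p:] dvd k - [:-a, 1:] ^ i * k'" "\<not> int p dvd poly k' a"
    using exists_unramified_part False by blast
  let ?u = "[:-a, 1:]"
  define A where "A = F * k' ^ 2"
  define B where "B = [:c:] * m' ^ 2"
  have "[:int p:] dvd ?u ^ i * k' - k" using k'(1) dvd_minus_iff[of "[:int p:]" "k - ?u ^ i * k'"] by simp
  then have 1: "[:int p:] dvd ?u ^ e * F * (?u ^ i * k') ^ 2 - ?u ^ e * F * k ^ 2"
    by (intro dvd_diff_mult dvd_diff_power) auto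
  have 2: "[:int p:] dvd [:c:] * m ^ 2 - [:c:] * (?u ^ j * m') ^ 2"
    by (intro dvd_diff_mult dvd_diff_power m') auto
  have "[:int p:] dvd ?u ^ e * F * (?u ^ i * k') ^ 2 - [:c:] * (?u ^ j * m') ^ 2"
    by (rule dvd_diff_trans[OF dvd_diff_trans[OF 1 eq] 2])
  moreover have "?u ^ e * F * (?u ^ i * k') ^ 2 = ?u ^ (e + 2 * i) * A"
    unfolding A_def power_mult_distrib power_add by (simp add: power_mult mult_ac flip: power_mult)
  moreover have "[:c:] * (?u ^ j * m') ^ 2 = ?u ^ (2 * j) * B"
    unfolding B_def power_mult_distrib by (simp only: mult_ac flip: power_mult)
  ultimately have *: "[:int p:] dvd ?u ^ (e + 2 * i) * A - ?u ^ (2 * j) * B" by simp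
  have "\<not> int p dvd poly A a" "\<not> int p dvd poly B a"
    using F k'(2) m'(2) c unfolding A_def B_def by (simp_all add: int_prime_dvd_mult_iff[OF p] power2_eq_square)
  moreover have "e + 2 * i \<noteq> 2 * j" using \<open>odd e\<close> by presburger
  ultimately have False
    using linear_powers_cong_imp_root[OF p _ *] 
      linear_powers_cong_imp_root[OF p, of "2*j" "e+2*i" a B A]
      * dvd_minus_iff[of "[:int p:]" "?u ^ (e + 2 * i) * A - ?u ^ (2 * j) * B"]
    unfolding minus_diff_eq by (metis linorder_neqE_nat)
  then show ?thesis ..
qed

section \<open>Frobenius and independence of the auxiliary terms\<close>

lemma const_dvd_of_nat: "[:int p:] dvd of_nat n \<longleftrightarrow> p dvd n"
  by (simp add: of_nat_poly)

lemma freshman_power_cong: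
  assumes p: "prime p"
  shows "[:int p:] dvd (u + v) ^ p - (u ^ p + v ^ p)"
proof -
  have "p > 0" using p prime_gt_0_nat by blast
  have "(u + v) ^ p = (\<Sum>k\<le>p. of_nat (p choose k) * u ^ k * v ^ (p - k))" by (rule binomial_ring)
  also have "{..p} = insert 0 (insert p {0<..<p})" using \<open>p > 0\<close> by auto
  also have "(\<Sum>k\<in>\<dots>. of_nat (p choose k) * u ^ k * v ^ (p - k)) =
      v ^ p + (u ^ p + (\<Sum>k\<in>{0<..<p}. of_nat (p choose k) * u ^ k * v ^ (p - k)))"
    using \<open>p > 0\<close> by (subst sum.insert; simp)+
  finally have "(u + v) ^ p - (u ^ p + v ^ p) =
      (\<Sum>k\<in>{0<..<p}. of_nat (p choose k) * u ^ k * v ^ (p - k))" by simp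
  also have "[:int p:] dvd \<dots>"
  proof (intro dvd_sum dvd_mult2)
    fix k assume "k \<in> {0<..<p}"
    then have "p dvd (p choose k)" using p by (intro dvd_choose_prime) auto
    then show "[:int p:] dvd of_nat (p choose k)" by (simp only: const_dvd_of_nat)
  qed
  finally show ?thesis .
qed

lemma int_fermat:
  assumes p: "prime p"
  shows "int p dvd c ^ p - c"
proof (cases "int p dvd c")
  case True
  then show ?thesis using prime_gt_0_nat[OF p] by (metis dvd_diff dvd_power dvd_trans)
next
  case False
  have "[nat (c mod int p) ^ (p - 1) = 1] (mod p)"
  proof (rule fermat_theorem[OF p])
    show "\<not> p dvd nat (c mod int p)"
    proof -
      have "int (nat (c mod int p)) = c mod int p" using prime_gt_0_nat[OF p] by simp
      then have "p dvd nat (c mod int p) \<longleftrightarrow> int p dvd c mod int p" by (metis int_dvd_int_iff)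
      then show ?thesis using False dvd_mod_iff[OF dvd_refl, of "int p" c] by simp
    qed
  qed
  then have "[int (nat (c mod int p) ^ (p - 1)) = int 1] (mod int p)"
    unfolding cong_int_iff .
  then have "[(c mod int p) ^ (p - 1) = 1] (mod int p)" using prime_gt_0_nat[OF p] by simp
  then have "[c ^ (p - 1) = 1] (mod int p)" by (simp add: cong_def power_mod)
  then have "[c * c ^ (p - 1) = c * 1] (mod int p)" by (rule cong_scalar_left)
  moreover have "c * c ^ (p - 1) = c ^ p" using prime_gt_0_nat[OF p] by (simp flip: power_Suc)
  ultimately show ?thesis by (simp add: cong_iff_dvd_diff)
qed

text \<open>Write f = f(0) + X g, then apply Frobenius and Fermat. It is a weak form of f ^ p = f (X
  ^ p), strong enough for computing modulo X ^ p.\<close>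

lemma power_prime_cong_const:
  assumes p: "prime p"
  shows "\<exists>W. [:int p:] dvd f ^ p - ([:poly f 0:] + [:0, 1:] ^ p * W)"
proof -
  obtain g where g: "f = [:poly f 0:] + [:0, 1:] * g"
    by (metis add.commute diff_zero mult_pCons_left synthetic_div_correct' minus_zero)
  have "[:int p:] dvd ([:poly f 0:] + [:0, 1:] * g) ^ p - ([:poly f 0:] ^ p + ([:0, 1:] * g) ^ p)"
    by (rule freshman_power_cong[OF p])
  then have 1: "[:int p:] dvd f ^ p - ([:poly f 0:] ^ p + ([:0, 1:] * g) ^ p)" using g by simp
  have "[:poly f 0:] ^ p - [:poly f 0:] = [:poly f 0 ^ p - poly f 0:]"
    by (simp add: poly_const_pow)
  then have 2: "[:int p:] dvd [:poly f 0:] ^ p - [:poly f 0:]"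
    using int_fermat[OF p, of "poly f 0"] by simp
  have "[:int p:] dvd (f ^ p - ([:poly f 0:] ^ p + ([:0, 1:] * g) ^ p)) + ([:poly f 0:] ^ p - [:poly f 0:])"
    by (intro dvd_add 1 2)
  also have "\<dots> = f ^ p - ([:poly f 0:] + [:0, 1:] ^ p * g ^ p)"
    by (simp only: power_mult_distrib algebra_simps)
  finally show ?thesis by blast
qed

text \<open>Squaring \<open>K = - f ^ ((p - 1) div 2) * M\<close> gives \<open>f * K\<^sup>2 = f ^ p * M\<^sup>2\<close>,
  and \<open>f ^ p\<close> is constant modulo \<open>X ^ p\<close>.\<close>
lemma stepanov_independence:
  assumes p: "prime p" "odd p" and "odd e" and F: "\<not> int p dvd poly F a"
    and f: "f = [:-a, 1:] ^ e * F" and c: "\<not> int p dvd poly f 0" and degf: "degree f \<le> d"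
    and D: "2 * D + d < p"
  shows "\<lbrakk>\<And>j. j < J \<Longrightarrow> degree (k j) \<le> D \<and> degree (m j) \<le> D;
     [:int p:] dvd (\<Sum>j<J. (k j + f ^ ((p - 1) div 2) * m j) * [:0, 1:] ^ (p * j))\<rbrakk>
    \<Longrightarrow> \<forall>j<J. [:int p:] dvd k j \<and> [:int p:] dvd m j"
proof (induction J arbitrary: k m)
  case 0
  then show ?case by simp
next
  case (Suc J)
  define g where "g = f ^ ((p - 1) div 2)"
  define X :: "int poly" where "X = [:0, 1:] ^ p"
  define K where "K = (\<Sum>j<J. k (Suc j) * X ^ j)"
  define M where "M = (\<Sum>j<J. m (Suc j) * X ^ j)"
  define Z where "Z = (\<Sum>j<J. (k (Suc j) + g * m (Suc j)) * X ^ j)"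
  have Z: "Z = K + g * M"
    unfolding Z_def K_def M_def by (simp add: sum_distrib_left sum.distrib algebra_simps)
  have "(\<Sum>j<Suc J. (k j + g * m j) * [:0, 1:] ^ (p * j)) = (k 0 + g * m 0) + X * Z"
    unfolding Z_def sum.lessThan_Suc_shift sum_distrib_left
    by (simp add: X_def power_add mult_ac flip: power_mult)
  then have tot: "[:int p:] dvd (k 0 + g * m 0) + X * Z"
    using Suc.prems(2) unfolding g_def by simp
  obtain W where W: "[:int p:] dvd f ^ p - ([:poly f 0:] + X * W)"
    using power_prime_cong_const[OF p(1), of f] unfolding X_def by blast
  have fg: "f * g ^ 2 = f ^ p"
    unfolding g_def using p(2) by (simp add: odd_two_times_div_two_nat flip: power_mult power_Suc)
  define A where "A = k 0 + X * K"
  define B where "B = m 0 + X * M"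
  have "[:int p:] dvd (A + g * B)"
    using tot unfolding Z A_def B_def by (simp add: algebra_simps)
  \<comment> \<open>The conjugate A - g B clears the half power g, and the factor f turns g ^ 2 into
    f ^ p.\<close>
  then have "[:int p:] dvd f * (A - g * B) * (A + g * B)" by (rule dvd_mult)
  moreover have "f * (A - g * B) * (A + g * B) = f * A ^ 2 - f ^ p * B ^ 2"
    unfolding fg[symmetric] by (simp add: power2_eq_square algebra_simps)
  ultimately have "[:int p:] dvd f * A ^ 2 - f ^ p * B ^ 2" by simp
  moreover have "[:int p:] dvd f ^ p * B ^ 2 - ([:poly f 0:] + X * W) * B ^ 2"
    by (intro dvd_diff_mult W) simp
  ultimately have "[:int p:] dvd f * A ^ 2 - ([:poly f 0:] + X * W) * B ^ 2"
    by (rule dvd_diff_trans)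
  moreover define V where "V = f * (k 0 * K + k 0 * K + X * K ^ 2) - W * B ^ 2
    - [:poly f 0:] * (m 0 * M + m 0 * M + X * M ^ 2)"
  moreover define Q where "Q = f * k 0 ^ 2 - [:poly f 0:] * m 0 ^ 2"
  have "f * (k0 + X * K) ^ 2 - (c + X * W) * (m0 + X * M) ^ 2 = (f * k0 ^ 2 - c * m0 ^ 2) +
      X * (f * (k0 * K + k0 * K + X * K ^ 2) - W * (m0 + X * M) ^ 2 - c * (m0 * M + m0 * M + X * M ^ 2))"
    for k0 m0 c :: "int poly"
    by (simp add: power2_eq_square algebra_simps)
  then have "f * A ^ 2 - ([:poly f 0:] + X * W) * B ^ 2 = Q + X * V"
    unfolding A_def Q_def V_def B_def .
  ultimately have QV: "[:int p:] dvd Q + X * V" by simp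
  \<comment> \<open>Q is what remains modulo X ^ p. Since its degree is below p, which is what 2 D +
    d < p is for, it must itself vanish modulo p.\<close>
  have "degree Q < p"
  proof -
    have "degree (f * k 0 ^ 2) \<le> d + (D + D)"
      unfolding power2_eq_square using degf Suc.prems(1)[of 0]
      by (intro order_trans[OF degree_mult_le] add_mono) auto
    moreover have "degree ([:poly f 0:] * m 0 ^ 2) \<le> 0 + (D + D)"
      unfolding power2_eq_square using Suc.prems(1)[of 0]
      by (intro order_trans[OF degree_mult_le] add_mono) auto
    ultimately have "degree Q \<le> d + (D + D)"
      unfolding Q_def by (intro degree_diff_le) auto
    with D show ?thesis by simp
  qed
  have "[:int p:] dvd Q"
    unfolding const_poly_dvd_iff
  proof
    fix i
    show "int p dvd coeff Q i"
    proof (cases "i < p")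
      case True
      have "X = monom 1 p" unfolding X_def by (simp add: monom_altdef)
      then have "coeff (Q + X * V) i = coeff Q i" using True by (simp add: coeff_monom_mult)
      then show ?thesis using QV unfolding const_poly_dvd_iff by metis
    next
      case False
      then show ?thesis using \<open>degree Q < p\<close> by (simp add: coeff_eq_0)
    qed
  qed
  then have zero: "[:int p:] dvd k 0 \<and> [:int p:] dvd m 0"
    using odd_order_times_square_cong_square[OF p(1) \<open>odd e\<close> F c] unfolding Q_def f by blast
  \<comment> \<open>With the terms for j = 0 gone, X ^ p cancels and the induction hypothesis
    applies to the shifted families.\<close>
  then have "[:int p:] dvd k 0 + g * m 0" by simp
  with tot have "[:int p:] dvd X * Z" using dvd_add_right_iff by blast
  then have "[:int p:] dvd Z"
    unfolding X_def using const_dvd_linear_power_mult[OF p(1)] by blast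
  then have "[:int p:] dvd (\<Sum>j<J. (k (Suc j) + f ^ ((p - 1) div 2) * m (Suc j)) * [:0, 1:] ^ (p * j))"
    unfolding Z_def X_def g_def by (simp add: power_mult)
  then have "\<forall>j<J. [:int p:] dvd k (Suc j) \<and> [:int p:] dvd m (Suc j)"
    using Suc.prems(1) by (intro Suc.IH) auto
  with zero show ?case using less_Suc_eq_0_disj by auto
qed

section \<open>Stepanov's method\<close>

text \<open>\<open>dstep f n s k\<close> is the cofactor of \<open>f ^ (n - s)\<close> in the \<open>s\<close>-th derivative of \<open>f ^ n * k\<close>.\<close>
fun dstep :: "int poly \<Rightarrow> nat \<Rightarrow> nat \<Rightarrow> int poly \<Rightarrow> int poly" where
  "dstep f n 0 k = k"
| "dstep f n (Suc s) k = of_nat (n - s) * pderiv f * dstep f n s k + f * pderiv (dstep f n s k)"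

lemma higher_pderiv_power_mult:
  "s \<le> n \<Longrightarrow> (pderiv ^^ s) (f ^ n * k) = f ^ (n - s) * dstep f n s k"
proof (induction s)
  case 0
  then show ?case by simp
next
  case (Suc s)
  then obtain r where r: "n - s = Suc r" "n - Suc s = r"
    by (metis Suc_diff_Suc Suc_le_lessD)
  have "pderiv (f ^ Suc r) = f ^ r * (of_nat (Suc r) * pderiv f)"
    by (simp add: pderiv_power_Suc of_nat_poly mult_ac del: of_nat_Suc power_Suc)
  then have "pderiv (f ^ Suc r * D) = f ^ r * (of_nat (Suc r) * pderiv f * D + f * pderiv D)" for D
    unfolding pderiv_mult by (simp only: power_Suc distrib_left) (simp only: mult_ac add_ac)
  with Suc r show ?case by (simp del: of_nat_Suc power_Suc)
qed

lemma dstep_diff: "dstep f n s (k - k') = dstep f n s k - dstep f n s k'"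
  by (induction s) (simp_all add: pderiv_diff right_diff_distrib)

lemma degree_pderiv_le: "degree (pderiv f) \<le> degree f"
  by (intro degree_le) (simp add: coeff_pderiv coeff_eq_0)

text \<open>The degree grows with s but not with n, which is the reason for keeping the high power
  of f outside the cofactor.\<close>

lemma degree_dstep_le: "degree (dstep f n s k) \<le> degree k + s * degree f"
proof (induction s)
  case 0
  then show ?case by simp
next
  case (Suc s)
  let ?D = "dstep f n s k"
  have "degree (of_nat (n - s) * pderiv f) \<le> 0 + degree f"
    using degree_pderiv_le[of f] by (intro order_trans[OF degree_mult_le] add_mono) auto
  from add_mono[OF this Suc] have "degree (of_nat (n - s) * pderiv f * ?D) \<le> (0 + degree f) + (degree k + s * degree f)"
    by (rule order_trans[OF degree_mult_le])
  moreover have "degree (f * pderiv ?D) \<le> degree f + (degree k + s * degree f)"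
    using Suc degree_pderiv_le[of ?D] by (intro order_trans[OF degree_mult_le] add_mono) auto
  ultimately show ?case by (auto intro!: degree_add_le)
qed

text \<open>The derivative of X ^ (p j) has the factor p j, so X ^ (p j) acts as a constant modulo
  p. Such factors enlarge the space of auxiliary polynomials without complicating
  derivatives.\<close>

lemma higher_pderiv_monomial_mult_cong:
  "[:int p:] dvd (pderiv ^^ s) ([:0, 1:] ^ (p * j) * Y) - [:0, 1:] ^ (p * j) * (pderiv ^^ s) Y"
proof (induction s)
  case 0
  then show ?case by simp
next
  case (Suc s)
  let ?X = "[:0, 1:] ^ (p * j) :: int poly"
  have "[:int p:] dvd pderiv ?X"
  proof (cases "p * j")
    case (Suc n)
    have "pderiv ?X = smult (int (p * j)) ([:0, 1:] ^ n)"
      unfolding Suc by (simp add: pderiv_power_Suc pderiv_pCons del: of_nat_Suc power_Suc)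
    also have "\<dots> = [:int p:] * smult (int j) ([:0, 1:] ^ n)" by (simp add: mult.commute)
    finally show ?thesis by (metis dvd_triv_left)
  next
    case 0
    then show ?thesis by (simp only: power_0 pderiv_1 dvd_0_right)
  qed
  moreover have "[:int p:] dvd pderiv ((pderiv ^^ s) (?X * Y) - ?X * (pderiv ^^ s) Y)"
    using const_dvd_higher_pderiv[OF Suc, of 1] by simp
  then have "[:int p:] dvd (pderiv ^^ Suc s) (?X * Y) - ?X * (pderiv ^^ Suc s) Y - (pderiv ^^ s) Y * pderiv ?X"
    by (simp add: pderiv_diff pderiv_mult algebra_simps)
  ultimately show ?case using dvd_diff_left_iff dvd_mult by blast
qed

text \<open>Fewer equations (\<open>B\<close>) than unknowns (\<open>A\<close>) modulo p: among p ^
  card A assignments two have the same image, and their difference is the solution.\<close>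

lemma exists_nontrivial_linear_solution:
  fixes T :: "('a \<Rightarrow> int) \<Rightarrow> 'b \<Rightarrow> int"
  assumes p: "p > 1" and fin: "finite A" "finite B" and card: "card B < card A"
    and T: "\<And>u v b. b \<in> B \<Longrightarrow> T (\<lambda>a. u a - v a) b = T u b - T v b"
  obtains u a where "a \<in> A" "\<not> int p dvd u a" "\<And>b. b \<in> B \<Longrightarrow> int p dvd T u b"
proof -
  define \<Omega> where "\<Omega> = A \<rightarrow>\<^sub>E {0..<int p}"
  define \<Phi> where "\<Phi> = (\<lambda>u. restrict (\<lambda>b. T u b mod int p) B)"
  have "card (\<Phi> ` \<Omega>) \<le> card (B \<rightarrow>\<^sub>E {0..<int p})"
    using p fin by (intro card_mono finite_PiE) (auto simp: \<Phi>_def)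
  also have "\<dots> = p ^ card B" using fin by (simp add: card_PiE)
  also have "\<dots> < p ^ card A" using p card by simp
  also have "\<dots> = card \<Omega>" using fin by (simp add: \<Omega>_def card_PiE)
  finally have "\<not> inj_on \<Phi> \<Omega>" by (rule pigeonhole)
  then obtain u v where uv: "u \<in> \<Omega>" "v \<in> \<Omega>" "u \<noteq> v" "\<Phi> u = \<Phi> v"
    by (auto simp: inj_on_def)
  obtain a where a: "a \<in> A" "u a \<noteq> v a"
    using uv unfolding \<Omega>_def by (metis PiE_ext)
  have "u a \<in> {0..<int p}" "v a \<in> {0..<int p}" using uv a unfolding \<Omega>_def by auto
  then have "\<not> int p dvd u a - v a"
    using a(2) dvd_imp_le_int[of "u a - v a" "int p"] by auto
  moreover have "int p dvd T (\<lambda>a. u a - v a) b" if "b \<in> B" for b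
  proof -
    have "T u b mod int p = T v b mod int p" using fun_cong[OF uv(4), of b] that by (simp add: \<Phi>_def)
    then show ?thesis using T[OF that, of u v] by (simp add: mod_eq_dvd_iff)
  qed
  ultimately show ?thesis using that[of a "\<lambda>a. u a - v a"] a(1) by blast
qed

text \<open>An auxiliary polynomial \<open>R\<close>, nonzero modulo p, is made to vanish to order l
  wherever f ^ g0 = 1. There x ^ p = x as well, so its s-th derivative is f ^ (l - s) times a
  polynomial \<open>\<sigma> u s\<close> of low degree, and asking all coefficients of the latter to
  vanish is a linear system. The claim compares l times the number of points with the degree of
  \<open>R\<close>.\<close>

lemma stepanov_bound:
  assumes p: "prime p" "odd p" and "odd e" and F: "\<not> int p dvd poly F a"
    and f: "f = [:-a, 1:] ^ e * F" and c: "\<not> int p dvd poly f 0" and degf: "degree f \<le> d"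
    and D: "2 * D + d < p" and l: "l \<le> p" and J: "l * (D + l * d + J + 1) < 2 * J * D"
  shows "l * card {x \<in> {0..<int p}. int p dvd poly f x ^ ((p - 1) div 2) - 1} \<le>
    (l + (p - 1) div 2) * d + D + p * J"
proof -
  define g0 where "g0 = (p - 1) div 2"
  \<comment> \<open>For s < l the degree of \<open>\<sigma> u s\<close> is at most E - 1. This makes
    l E equations for 2 J D unknowns; the hypothesis on J says that the unknowns prevail.\<close>
  define E where "E = D + l * d + J + 1"
  \<comment> \<open>The unknown with index (\<beta>, j, i) is the coefficient of X ^ i in
    \<open>k j\<close> for \<beta> = False and in \<open>m j\<close> for \<beta> = True.\<close>
  define K where "K = (\<lambda>(u :: bool \<times> nat \<times> nat \<Rightarrow> int) \<beta> j. \<Sum>i<D. monom (u (\<beta>, j, i)) i)"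
  define \<sigma> where "\<sigma> = (\<lambda>u s. \<Sum>j<J. (dstep f l s (K u False j) + dstep f (l + g0) s (K u True j)) * [:0, 1:] ^ j)"
  have K_diff: "K (\<lambda>a. u a - v a) \<beta> j = K u \<beta> j - K v \<beta> j" for u v \<beta> j
    unfolding K_def by (simp add: sum_subtractf flip: diff_monom)
  have \<sigma>_diff: "\<sigma> (\<lambda>a. u a - v a) s = \<sigma> u s - \<sigma> v s" for u v s
    unfolding \<sigma>_def K_diff dstep_diff by (simp add: sum_subtractf algebra_simps sum.distrib)
  define A where "A = (UNIV :: bool set) \<times> {..<J} \<times> {..<D}"
  define B where "B = {..<l} \<times> {..<E}"
  have "card A = 2 * J * D" "card B = l * E" by (simp_all add: A_def B_def card_cartesian_product card_UNIV_bool)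
  then have "card B < card A" using J by (simp add: E_def)
  moreover have fin: "finite A" "finite B" by (simp_all add: A_def B_def)
  moreover have T: "(\<lambda>(s, i). coeff (\<sigma> (\<lambda>a. u a - v a) s) i) b =
      (\<lambda>(s, i). coeff (\<sigma> u s) i) b - (\<lambda>(s, i). coeff (\<sigma> v s) i) b" for u v b
    by (cases b) (simp add: \<sigma>_diff)
  ultimately obtain u \<alpha> where \<alpha>: "\<alpha> \<in> A" "\<not> int p dvd u \<alpha>"
    and u: "\<And>b. b \<in> B \<Longrightarrow> int p dvd (\<lambda>(s, i). coeff (\<sigma> u s) i) b"
    using exists_nontrivial_linear_solution[of p A B "\<lambda>u (s, i). coeff (\<sigma> u s) i",
          OF prime_gt_1_nat[OF p(1)] fin _ T] by blast
  define k where "k = K u False"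
  define m where "m = K u True"
  have coeff_K: "coeff (K u \<beta> j) i = u (\<beta>, j, i)" if "i < D" for \<beta> j i
    using that unfolding K_def by (simp add: coeff_sum sum.delta')
  have deg_K: "degree (K u \<beta> j) \<le> D" for \<beta> j
    unfolding K_def by (intro degree_sum_le) (auto intro: order_trans[OF degree_monom_le])
  have deg_X: "degree ([:0, 1:] ^ n :: int poly) = n" for n by (simp add: degree_power_eq)
  have \<sigma>_zero: "[:int p:] dvd \<sigma> u s" if s: "s < l" for s
    unfolding const_poly_dvd_iff
  proof
    fix i
    show "int p dvd coeff (\<sigma> u s) i"
    proof (cases "i < E")
      case True
      with s show ?thesis using u[of "(s, i)"] by (simp add: B_def)
    next
      case False
      have dd: "degree (dstep f n s (K u \<beta> j)) \<le> D + l * d" for n \<beta> j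
        using s degf deg_K by (intro order_trans[OF degree_dstep_le] add_mono mult_mono) auto
      have "degree (\<sigma> u s) \<le> D + l * d + J"
        unfolding \<sigma>_def
      proof (intro degree_sum_le order_trans[OF degree_mult_le] add_mono degree_add_le dd)
        fix j assume "j \<in> {..<J}"
        then show "degree ([:0, 1:] ^ j :: int poly) \<le> J" using deg_X[of j] by simp
      qed simp
      with False show ?thesis by (simp add: E_def coeff_eq_0)
    qed
  qed
  \<comment> \<open>The factor f ^ l keeps both exponents, l and l + g0, above every order s < l of
    differentiation, so that f ^ (l - s) can be taken out.\<close>
  define R where "R = (\<Sum>j<J. [:0, 1:] ^ (p * j) * (f ^ l * k j + f ^ (l + g0) * m j))"
  have R: "R = f ^ l * (\<Sum>j<J. (k j + f ^ g0 * m j) * [:0, 1:] ^ (p * j))"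
    unfolding R_def sum_distrib_left by (intro sum.cong) (simp_all add: power_add algebra_simps)
  have R_nz: "\<not> [:int p:] dvd R"
  proof
    assume "[:int p:] dvd R"
    moreover have "\<not> [:int p:] dvd f ^ l"
      using F const_dvd_poly[of "int p" F a] const_dvd_power[OF p(1)] const_dvd_linear_power_mult[OF p(1)]
      unfolding f by blast
    ultimately have "[:int p:] dvd (\<Sum>j<J. (k j + f ^ g0 * m j) * [:0, 1:] ^ (p * j))"
      unfolding R const_dvd_mult_iff[OF p(1)] by blast
    then have *: "\<forall>j<J. [:int p:] dvd k j \<and> [:int p:] dvd m j"
      unfolding g0_def
      using stepanov_independence[OF p \<open>odd e\<close> F f c degf D, of J k m] deg_K
      unfolding k_def m_def by blast
    obtain \<beta> j i where ji: "\<alpha> = (\<beta>, j, i)" "j < J" "i < D" using \<alpha>(1) by (auto simp: A_def)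
    have "[:int p:] dvd K u \<beta> j" using * ji(2) unfolding k_def m_def by (cases \<beta>) auto
    then have "int p dvd u \<alpha>" using coeff_K[OF ji(3)] ji(1) unfolding const_poly_dvd_iff by metis
    with \<alpha>(2) show False ..
  qed
  have deg_R: "degree R \<le> (l + g0) * d + D + p * J"
    unfolding R_def
  proof (intro degree_sum_le)
    fix j assume j: "j \<in> {..<J}"
    have deg_fn: "degree (f ^ n) \<le> (l + g0) * d" if "n \<le> l + g0" for n
    proof -
      have "degree (f ^ n) \<le> degree f * n" by (rule degree_power_le)
      also have "\<dots> \<le> d * (l + g0)" using that degf by (intro mult_mono) auto
      finally show ?thesis by (simp add: mult.commute)
    qed
    have "degree (f ^ l * k j + f ^ (l + g0) * m j) \<le> (l + g0) * d + D"
      unfolding k_def m_def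
      by (intro degree_add_le order_trans[OF degree_mult_le] add_mono deg_fn deg_K) auto
    moreover have "degree ([:0, 1:] ^ (p * j) :: int poly) \<le> p * J" using j deg_X[of "p * j"] by simp
    ultimately show "degree ([:0, 1:] ^ (p * j) * (f ^ l * k j + f ^ (l + g0) * m j)) \<le> (l + g0) * d + D + p * J"
      by (intro order_trans[OF degree_mult_le]) simp
  qed simp
  define S where "S = {x \<in> {0..<int p}. int p dvd poly f x ^ g0 - 1}"
  have "mod_dvd p ([:-x, 1:] ^ l) R" if x: "x \<in> S" for x
  proof (rule mod_dvd_power_if_higher_pderiv[OF p(1) l])
    fix s assume s: "s < l"
    define Y where "Y = (\<lambda>j. f ^ (l - s) * dstep f l s (k j) + f ^ (l + g0 - s) * dstep f (l + g0) s (m j))"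
    have hp: "(pderiv ^^ s) (f ^ l * k j + f ^ (l + g0) * m j) = Y j" for j
      using s by (simp add: Y_def higher_pderiv_power_mult higher_pderiv_add)
    have "[:int p:] dvd (pderiv ^^ s) R - (\<Sum>j<J. [:0, 1:] ^ (p * j) * Y j)"
      unfolding R_def higher_pderiv_sum sum_subtractf[symmetric]
      by (intro dvd_sum) (simp only: higher_pderiv_monomial_mult_cong flip: hp)
    from const_dvd_poly[OF this, of x]
    have 1: "int p dvd poly ((pderiv ^^ s) R) x - (\<Sum>j<J. x ^ (p * j) * poly (Y j) x)"
      by (simp add: poly_sum)
    have 2: "int p dvd x ^ (p * j) * poly (Y j) x - poly f x ^ (l - s) *
        (x ^ j * (poly (dstep f l s (k j)) x + poly (dstep f (l + g0) s (m j)) x))" for j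
    proof -
      have "l + g0 - s = (l - s) + g0" using s by simp
      then have Yx: "poly (Y j) x = poly f x ^ (l - s) *
          (poly (dstep f l s (k j)) x + poly f x ^ g0 * poly (dstep f (l + g0) s (m j)) x)"
        unfolding Y_def by (simp add: power_add algebra_simps)
      have "int p dvd (poly (dstep f l s (k j)) x + poly f x ^ g0 * poly (dstep f (l + g0) s (m j)) x)
         - (poly (dstep f l s (k j)) x + poly (dstep f (l + g0) s (m j)) x)"
        using dvd_mult2[of "int p" "poly f x ^ g0 - 1" "poly (dstep f (l + g0) s (m j)) x"] x
        by (simp add: S_def algebra_simps)
      moreover have "int p dvd x ^ (p * j) - x ^ j"
        unfolding power_mult by (intro dvd_diff_power int_fermat p)
      ultimately have "int p dvd x ^ (p * j) * (poly f x ^ (l - s) *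
          (poly (dstep f l s (k j)) x + poly f x ^ g0 * poly (dstep f (l + g0) s (m j)) x)) -
        x ^ j * (poly f x ^ (l - s) *
          (poly (dstep f l s (k j)) x + poly (dstep f (l + g0) s (m j)) x))"
        by (intro dvd_diff_mult) auto
      then show ?thesis unfolding Yx by (simp only: mult_ac)
    qed
    have "int p dvd (\<Sum>j<J. x ^ (p * j) * poly (Y j) x) - poly f x ^ (l - s) * poly (\<sigma> u s) x"
      using 2 unfolding \<sigma>_def poly_sum sum_distrib_left sum_subtractf[symmetric]
      by (intro dvd_sum) (simp add: k_def m_def algebra_simps)
    from dvd_diff_trans[OF 1 this]
    have "int p dvd poly ((pderiv ^^ s) R) x - poly f x ^ (l - s) * poly (\<sigma> u s) x" .
    moreover have "int p dvd poly (\<sigma> u s) x" using \<sigma>_zero[OF s] const_dvd_poly by blast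
    ultimately show "int p dvd poly ((pderiv ^^ s) R) x"
      using dvd_diff_left_iff dvd_mult by blast
  qed
  then have "(\<Sum>x\<in>S. l) \<le> degree R"
    by (intro sum_multiplicities_le_degree[OF p(1) finite_subset[of S "{0..<int p}"] _ R_nz])
       (auto simp: S_def)
  with deg_R show ?thesis unfolding S_def g0_def by (simp add: mult.commute)
qed

section \<open>Character sums of polynomials\<close>

lemma Legendre_eq_0_iff: "Legendre a p = 0 \<longleftrightarrow> p dvd a"
  by (auto simp: Legendre_def cong_0_iff)

lemma Legendre_values: "Legendre a p \<in> {-1, 0, 1}"
  by (auto simp: Legendre_def)

lemma abs_Legendre_le_1: "\<bar>Legendre a p\<bar> \<le> 1"
  by (auto simp: Legendre_def)

lemma Legendre_cong: "[a = b] (mod p) \<Longrightarrow> Legendre a p = Legendre b p"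
  unfolding Legendre_def QuadRes_def by (auto simp: cong_def)

lemma cong_signs_imp_eq:
  assumes "[a = b] (mod p)" "\<bar>a\<bar> \<le> 1" "\<bar>b\<bar> \<le> 1" "p > (2::int)"
  shows "a = b"
proof (rule ccontr)
  assume "a \<noteq> b"
  then have "\<bar>p\<bar> \<le> \<bar>a - b\<bar>" using assms(1) by (intro dvd_imp_le_int) (auto simp: cong_iff_dvd_diff)
  with assms(2-4) show False by linarith
qed

text \<open>Euler's criterion gives multiplicativity modulo p, and numbers in {-1, 0, 1} that agree
  modulo p > 2 are equal.\<close>

lemma Legendre_mult:
  assumes "prime p" "odd p"
  shows "Legendre (a * b) (int p) = Legendre a (int p) * Legendre b (int p)"
proof (rule cong_signs_imp_eq)
  have "p > 2" using assms prime_odd_nat prime_ge_2_nat by (metis dvd_refl le_neq_implies_less)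
  then show "int p > 2" by simp
  show "[Legendre (a * b) (int p) = Legendre a (int p) * Legendre b (int p)] (mod int p)"
    using cong_mult[OF euler_criterion[OF assms(1) \<open>p > 2\<close>, of a] euler_criterion[OF assms(1) \<open>p > 2\<close>, of b]]
      euler_criterion[OF assms(1) \<open>p > 2\<close>, of "a * b"]
    by (metis cong_sym cong_trans power_mult_distrib)
  show "\<bar>Legendre a (int p) * Legendre b (int p)\<bar> \<le> 1"
    unfolding abs_mult by (intro mult_le_one abs_Legendre_le_1) auto
qed (rule abs_Legendre_le_1)

lemma Legendre_1: "prime p \<Longrightarrow> Legendre 1 (int p) = 1"
  using prime_gt_1_nat[of p] unfolding Legendre_def QuadRes_def
  by (auto simp: cong_0_iff intro!: exI[of _ 1])

lemma Legendre_prod: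
  assumes "prime p" "odd p" "finite A"
  shows "Legendre (prod f A) (int p) = (\<Prod>x\<in>A. Legendre (f x) (int p))"
  using assms(3) by (induction A) (simp_all add: Legendre_mult[OF assms(1,2)] Legendre_1[OF assms(1)])

lemma card_roots_mod_prime_le:
  assumes "prime p" "\<not> [:int p:] dvd f"
  shows "card {x \<in> {0..<int p}. int p dvd poly f x} \<le> degree f"
proof -
  let ?S = "{x \<in> {0..<int p}. int p dvd poly f x}"
  have fin: "finite ?S" by (rule finite_subset[of _ "{0..<int p}"]) auto
  have "mod_dvd p ([:-x, 1:] ^ 1) f" if "x \<in> ?S" for x
    using that mod_dvd_synthetic_div[of p f x] unfolding mod_dvd_def by auto
  then have "(\<Sum>x\<in>?S. 1) \<le> degree f"
    by (intro sum_multiplicities_le_degree[OF assms(1) fin _ assms(2)]) auto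
  then show ?thesis by simp
qed

text \<open>Parameters: l = 2 \<mu> is about sqrt p, D about p / 2, and J = \<mu> + 3 d. Then 2 J D
  exceeds l D by 6 d D, about 3 d p, which pays for the remaining l (l d + J + 1), at most about 1.5
  d p. After division by l the term p J / l is p / 2 plus an error of order d sqrt p.\<close>

lemma card_square_values_bound:
  assumes p: "prime p" "odd p" and "odd e" and F: "\<not> int p dvd poly F a"
    and f: "f = [:-a, 1:] ^ e * F" and c: "\<not> int p dvd poly f 0" and degf: "degree f \<le> d"
    and d: "d \<ge> 1" and large: "p \<ge> 5 * d + 50"
  shows "real (card {x \<in> {0..<int p}. int p dvd poly f x ^ ((p - 1) div 2) - 1}) \<le>
    real p / 2 + 9 * real d * sqrt (real p)"
proof -
  define s where "s = sqrt (real p)"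
  have s2: "s * s = real p" by (simp add: s_def)
  have s7: "s \<ge> 7" unfolding s_def using large by (intro real_le_rsqrt) auto
  define \<mu> where "\<mu> = nat \<lfloor>s / 2\<rfloor>"
  have \<mu>: "real \<mu> \<le> s / 2" "real \<mu> \<ge> s / 2 - 1" "real \<mu> \<ge> s / 4"
    unfolding \<mu>_def using s7 by linarith+
  define D where "D = (p - d - 1) div 2"
  have D: "2 * D + d < p" "2 * real D \<ge> real p - real d - 2"
    unfolding D_def using large by linarith+
  have D': "real D \<ge> 0.4 * real p" "real D \<le> real p / 2" using D large by linarith+
  define J where "J = \<mu> + 3 * d"
  have \<mu>\<mu>: "real \<mu> * real \<mu> \<le> real p / 4"
    using mult_mono[OF \<mu>(1) \<mu>(1)] s7 s2 by simp
  have "real (2 * \<mu> * (D + 2 * \<mu> * d + J + 1)) < real (2 * J * D)"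
  proof -
    have "4 * (real \<mu> * real \<mu>) * d + 2 * (real \<mu> * real \<mu>) + 6 * real \<mu> * d + 2 * real \<mu>
        \<le> real p * d + real p / 2 * d + 3 * s * d + s * d"
    proof (intro add_mono)
      show "4 * (real \<mu> * real \<mu>) * d \<le> real p * d" using \<mu>\<mu> by (intro mult_right_mono) auto
      have "2 * (real \<mu> * real \<mu>) \<le> real p / 2 * 1" using \<mu>\<mu> by simp
      also have "\<dots> \<le> real p / 2 * d" using d by (intro mult_left_mono) auto
      finally show "2 * (real \<mu> * real \<mu>) \<le> real p / 2 * d" .
      show "6 * real \<mu> * d \<le> 3 * s * d" using \<mu> by (intro mult_right_mono) auto
      have "2 * real \<mu> \<le> s * 1" using \<mu> by simp
      also have "\<dots> \<le> s * d" using d s7 by (intro mult_left_mono) auto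
      finally show "2 * real \<mu> \<le> s * d" .
    qed
    also have "\<dots> = (1.5 * (s * s) + 4 * s) * d" using s2 by (simp add: algebra_simps)
    also have "\<dots> < 2.4 * (s * s) * d"
    proof (intro mult_strict_right_mono)
      have "7 * s \<le> s * s" using s7 by (intro mult_right_mono) auto
      then show "1.5 * (s * s) + 4 * s < 2.4 * (s * s)" using s7 by linarith
    qed (use d in simp)
    also have "\<dots> \<le> 6 * real D * d" using D' s2 by (intro mult_right_mono) auto
    finally show ?thesis unfolding J_def by (simp add: algebra_simps)
  qed
  then have "2 * \<mu> * (D + 2 * \<mu> * d + J + 1) < 2 * J * D" by (simp only: of_nat_less_iff)
  moreover have "2 * \<mu> \<le> p"
  proof -
    have "real (2 * \<mu>) \<le> s * 1" using \<mu> by simp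
    also have "\<dots> \<le> s * s" using s7 by (intro mult_left_mono) auto
    finally show ?thesis using s2 by simp
  qed
  ultimately have "2 * \<mu> * card {x \<in> {0..<int p}. int p dvd poly f x ^ ((p - 1) div 2) - 1} \<le>
      (2 * \<mu> + (p - 1) div 2) * d + D + p * J"
    by (intro stepanov_bound[OF p \<open>odd e\<close> F f c degf D(1)])
  then have "real (2 * \<mu> * card {x \<in> {0..<int p}. int p dvd poly f x ^ ((p - 1) div 2) - 1}) \<le>
      real ((2 * \<mu> + (p - 1) div 2) * d + D + p * J)"
    by (simp only: of_nat_le_iff)
  also have "\<dots> \<le> (2 * real \<mu> + real p / 2) * d + real p / 2 * d + real p * (\<mu> + 3 * d)"
  proof -
    have "real ((p - 1) div 2) \<le> real p / 2" by linarith
    moreover have "real D \<le> real p / 2 * d"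
      using D'(2) mult_left_mono[of 1 "real d" "real p / 2"] d by simp
    ultimately show ?thesis
      unfolding J_def of_nat_add of_nat_mult by (intro add_mono mult_right_mono mult_left_mono) auto
  qed
  also have "\<dots> = 2 * real \<mu> * (real p / 2 + d) + 4 * d * (s * s)" by (simp add: s2 algebra_simps)
  \<comment> \<open>By s \<le> 4 \<mu> the excess becomes a multiple of 2 \<mu>, which cancels. The
    term 8 d s from here and d \<le> d s below give the constant 9.\<close>
  also have "4 * d * (s * s) \<le> 4 * d * (4 * \<mu> * s)"
    using \<mu>(3) s7 by (intro mult_left_mono mult_right_mono) auto
  finally have "2 * real \<mu> * real (card {x \<in> {0..<int p}. int p dvd poly f x ^ ((p - 1) div 2) - 1})
      \<le> 2 * real \<mu> * (real p / 2 + d + 8 * d * s)"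
    by (simp add: algebra_simps)
  moreover have "real \<mu> > 0" using \<mu>(3) s7 by linarith
  ultimately have "real (card {x \<in> {0..<int p}. int p dvd poly f x ^ ((p - 1) div 2) - 1})
      \<le> real p / 2 + d + 8 * d * s" by simp
  also have "real d \<le> d * s" using s7 by (simp add: mult_le_cancel_left1)
  finally show ?thesis by (simp add: s_def algebra_simps)
qed

text \<open>The symbol is 1 on S, 0 on Z and -1 elsewhere, so the sum is at most 2 card S + card Z -
  p; hence 19 = 2 * 9 + 1.\<close>

lemma Legendre_poly_sum_bound:
  assumes p: "prime p" "odd p" and "odd e" and F: "\<not> int p dvd poly F a"
    and f: "f = [:-a, 1:] ^ e * F" and c: "\<not> int p dvd poly f 0" and degf: "degree f \<le> d"
    and d: "d \<ge> 1" and large: "p \<ge> 5 * d + 50"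
  shows "real_of_int (\<Sum>x\<in>{0..<int p}. Legendre (poly f x) (int p)) \<le> 19 * real d * sqrt (real p)"
proof -
  define S where "S = {x \<in> {0..<int p}. int p dvd poly f x ^ ((p - 1) div 2) - 1}"
  define Z where "Z = {x \<in> {0..<int p}. int p dvd poly f x}"
  have "\<not> [:int p:] dvd f" using c const_dvd_poly by blast
  then have Z: "card Z \<le> d"
    using card_roots_mod_prime_le[OF p(1), of f] degf unfolding Z_def by linarith
  have "p > 2" using large by simp
  have "Legendre (poly f x) (int p) \<le> 2 * of_bool (x \<in> S) + of_bool (x \<in> Z) - 1" if x: "x \<in> {0..<int p}" for x
  proof -
    consider "Legendre (poly f x) (int p) = -1" | "Legendre (poly f x) (int p) = 0"
      | "Legendre (poly f x) (int p) = 1"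
      using Legendre_values by blast
    then show ?thesis
    proof cases
      case 2
      then have "x \<in> Z" using x by (simp add: Z_def Legendre_eq_0_iff)
      then show ?thesis using 2 by simp
    next
      case 3
      then have "[1 = poly f x ^ ((p - 1) div 2)] (mod int p)"
        using euler_criterion[OF p(1) \<open>p > 2\<close>, of "poly f x"] by simp
      then have "x \<in> S" using x by (simp add: S_def cong_iff_dvd_diff dvd_diff_commute)
      then show ?thesis using 3 by simp
    qed simp
  qed
  then have "(\<Sum>x\<in>{0..<int p}. Legendre (poly f x) (int p)) \<le>
      (\<Sum>x\<in>{0..<int p}. 2 * of_bool (x \<in> S) + of_bool (x \<in> Z) - 1)"
    by (intro sum_mono) auto
  also have "\<dots> = 2 * int (card S) + int (card Z) - int p"
  proof -
    have "(\<Sum>x\<in>{0..<int p}. of_bool (x \<in> A)) = int (card A)" if "A \<subseteq> {0..<int p}" for A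
      using that by (simp add: of_bool_def sum.If_cases Int_absorb1)
    moreover have "S \<subseteq> {0..<int p}" "Z \<subseteq> {0..<int p}" by (auto simp: S_def Z_def)
    ultimately show ?thesis by (simp add: sum.distrib sum_subtractf flip: sum_distrib_left)
  qed
  finally have "real_of_int (\<Sum>x\<in>{0..<int p}. Legendre (poly f x) (int p)) \<le>
      2 * real (card S) + real (card Z) - real p" by linarith
  also have "\<dots> \<le> 2 * (real p / 2 + 9 * real d * sqrt (real p)) + d * sqrt (real p) - real p"
  proof -
    have "sqrt (real p) \<ge> 1" using \<open>p > 2\<close> by simp
    then have "real d \<le> d * sqrt (real p)" by (simp add: mult_le_cancel_left1)
    then have "real (card Z) \<le> d * sqrt (real p)" using Z by linarith
    moreover have "real (card S) \<le> real p / 2 + 9 * real d * sqrt (real p)"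
      unfolding S_def by (rule card_square_values_bound[OF p \<open>odd e\<close> F f c degf d large])
    ultimately show ?thesis by (intro diff_right_mono add_mono mult_left_mono) auto
  qed
  finally show ?thesis by (simp add: algebra_simps)
qed

section \<open>Moments of short character sums\<close>

text \<open>An odd fibre over v makes -v a root of odd order of the product of the X + \<phi> i, as
  Stepanov's bound requires. Shifts in 1, ..., p - 1 keep the constant term nonzero modulo
  p.\<close>

lemma Legendre_prod_shift_sum_bound:
  fixes \<phi> :: "nat \<Rightarrow> int"
  assumes p: "prime p" "odd p" and large: "p \<ge> 5 * n + 50"
    and \<phi>: "\<And>i. i < n \<Longrightarrow> \<phi> i \<in> {1..<int p}"
    and odd: "odd (card {i. i < n \<and> \<phi> i = v})"
  shows "real_of_int (\<Sum>x\<in>{0..<int p}. \<Prod>i<n. Legendre (x + \<phi> i) (int p)) \<le> 19 * real n * sqrt (real p)"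
proof -
  define I where "I = {i. i < n \<and> \<phi> i = v}"
  have "I \<noteq> {}" using odd unfolding I_def by force
  then have n: "n \<ge> 1" by (auto simp: I_def)
  define f where "f = (\<Prod>i<n. [:\<phi> i, 1:])"
  define F where "F = (\<Prod>i\<in>{..<n} - I. [:\<phi> i, 1:])"
  have small: "\<not> int p dvd x" if "\<bar>x\<bar> < int p" "x \<noteq> 0" for x
    using that dvd_imp_le_int[of x "int p"] by auto
  have v: "v \<in> {1..<int p}" using \<open>I \<noteq> {}\<close> \<phi> by (auto simp: I_def)
  have dvd_prod: "int p dvd (\<Prod>i\<in>A. g i) \<longleftrightarrow> (\<exists>i\<in>A. int p dvd g i)" if "finite A" for A and g :: "nat \<Rightarrow> int"
    using that p(1) by (simp add: prime_dvd_prod_iff)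
  have "f = (\<Prod>i\<in>I. [:\<phi> i, 1:]) * F"
    unfolding f_def F_def by (subst prod.subset_diff[of I]) (auto simp: I_def mult.commute)
  also have "(\<Prod>i\<in>I. [:\<phi> i, 1:]) = [:- (- v), 1:] ^ card I" by (simp add: I_def)
  finally have f: "f = [:- (- v), 1:] ^ card I * F" .
  have F: "\<not> int p dvd poly F (- v)"
  proof -
    have "poly F (- v) = (\<Prod>i\<in>{..<n} - I. \<phi> i - v)" by (simp add: F_def poly_prod)
    moreover have "\<not> int p dvd \<phi> i - v" if "i \<in> {..<n} - I" for i
      using that \<phi>[of i] v by (intro small) (auto simp: I_def abs_less_iff)
    ultimately show ?thesis by (simp add: dvd_prod)
  qed
  have c: "\<not> int p dvd poly f 0"
  proof -
    have "\<not> int p dvd \<phi> i" if "i < n" for i using \<phi>[OF that] by (intro small) auto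
    then show ?thesis by (simp add: f_def poly_prod dvd_prod)
  qed
  have "degree f \<le> (\<Sum>i<n. degree [:\<phi> i, 1:])"
    unfolding f_def using degree_prod_sum_le[of "{..<n}" "\<lambda>i. [:\<phi> i, 1:]"] by (simp add: o_def)
  then have deg: "degree f \<le> n" by simp
  have "Legendre (poly f x) (int p) = (\<Prod>i<n. Legendre (x + \<phi> i) (int p))" for x
    by (simp add: f_def poly_prod Legendre_prod[OF p] add.commute)
  then show ?thesis
    using Legendre_poly_sum_bound[OF p odd[folded I_def] F f c deg n large] by simp
qed

section \<open>Tuples with even fibres\<close>

lemma card_le_if_fibers_even:
  fixes \<phi> :: "nat \<Rightarrow> 'a"
  assumes "\<And>v. even (card {i. i < 2 * r \<and> \<phi> i = v})"
  shows "card (\<phi> ` {..<2 * r}) \<le> r"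
proof -
  have "2 \<le> card {i. i < 2 * r \<and> \<phi> i = v}" if v: "v \<in> \<phi> ` {..<2 * r}" for v
  proof -
    have "{i. i < 2 * r \<and> \<phi> i = v} \<noteq> {}" "finite {i. i < 2 * r \<and> \<phi> i = v}" using v by auto
    then have "card {i. i < 2 * r \<and> \<phi> i = v} \<noteq> 0" by simp
    with assms[of v] show ?thesis by (metis One_nat_def less_2_cases not_le odd_one)
  qed
  then have "(\<Sum>v\<in>\<phi> ` {..<2 * r}. 2) \<le> (\<Sum>v\<in>\<phi> ` {..<2 * r}. card {i. i < 2 * r \<and> \<phi> i = v})"
    by (rule sum_mono)
  also have "\<dots> = card {..<2 * r}"
    using sum.image_gen[of "{..<2 * r}" "\<lambda>_. 1::nat" \<phi>] by (simp add: lessThan_def conj_commute)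
  finally show ?thesis by simp
qed

text \<open>Such a tuple takes at most r values, so it is a word w of r letters from A read through
  an index map \<pi> from 2 r positions to r letters; the bound counts the pairs (w, \<pi>).\<close>

lemma card_even_fiber_tuples_le:
  assumes "finite A" "r > 0"
  shows "card {\<phi> \<in> {..<2 * r} \<rightarrow>\<^sub>E A. \<forall>v. even (card {i. i < 2 * r \<and> \<phi> i = v})} \<le> card A ^ r * r ^ (2 * r)"
    (is "card ?E \<le> _")
proof -
  define G where "G = (\<lambda>(w :: nat \<Rightarrow> 'a, \<pi> :: nat \<Rightarrow> nat). restrict (\<lambda>i. w (\<pi> i)) {..<2 * r})"
  define P where "P = ({..<r} \<rightarrow>\<^sub>E A) \<times> ({..<2 * r} \<rightarrow>\<^sub>E {..<r})"
  have "?E \<subseteq> G ` P"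
  proof
    fix \<phi> assume \<phi>: "\<phi> \<in> ?E"
    define V where "V = \<phi> ` {..<2 * r}"
    have V: "card V \<le> r" "finite V" "V \<noteq> {}" "V \<subseteq> A"
      using card_le_if_fibers_even[of r \<phi>] \<phi> \<open>r > 0\<close> unfolding V_def by (auto simp: lessThan_empty_iff)
    obtain h where h: "bij_betw h {..<card V} V"
      using V(2) ex_bij_betw_nat_finite atLeast0LessThan by metis
    obtain z where z: "z \<in> V" using V(3) by blast
    define w where "w = restrict (\<lambda>j. if j < card V then h j else z) {..<r}"
    have w: "w \<in> {..<r} \<rightarrow>\<^sub>E A" using V(4) z bij_betwE[OF h] unfolding w_def by auto
    have "\<forall>i\<in>{..<2 * r}. \<exists>j<r. w j = \<phi> i"
    proof
      fix i assume "i \<in> {..<2 * r}"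
      then have "\<phi> i \<in> h ` {..<card V}" using h by (auto simp: V_def bij_betw_def)
      then obtain j where "j < card V" "h j = \<phi> i" by auto
      then show "\<exists>j<r. w j = \<phi> i" using V(1) by (intro exI[of _ j]) (auto simp: w_def)
    qed
    then obtain \<pi> where \<pi>: "\<forall>i\<in>{..<2 * r}. \<pi> i < r \<and> w (\<pi> i) = \<phi> i" by metis
    have "\<phi> = G (w, restrict \<pi> {..<2 * r})"
    proof
      fix i show "\<phi> i = G (w, restrict \<pi> {..<2 * r}) i"
        using \<phi> \<pi> by (cases "i < 2 * r") (auto simp: G_def PiE_def extensional_def)
    qed
    moreover have "(w, restrict \<pi> {..<2 * r}) \<in> P" using w \<pi> by (auto simp: P_def)
    ultimately show "\<phi> \<in> G ` P" by blast
  qed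
  then have "card ?E \<le> card P"
    using assms(1) by (intro surj_card_le) (auto simp: P_def intro!: finite_PiE finite_cartesian_product)
  also have "\<dots> = card A ^ r * r ^ (2 * r)"
    using assms(1) by (simp add: P_def card_cartesian_product card_PiE)
  finally show ?thesis .
qed

text \<open>Expanding the power gives one complete sum per tuple of shifts. For even fibres the
  product is a square, and the trivial bound p is used for these few tuples; every other tuple
  contributes at most 19 (2 r) sqrt p.\<close>

lemma Legendre_moment_bound:
  assumes p: "prime p" "odd p" and large: "p \<ge> 10 * r + 50" and r: "r > 0" and L: "L < p"
  shows "real_of_int (\<Sum>x\<in>{0..<int p}. (\<Sum>h\<in>{1..int L}. Legendre (x + h) (int p)) ^ (2 * r))
    \<le> real (r ^ (2 * r)) * real L ^ r * real p + 38 * real r * sqrt (real p) * real L ^ (2 * r)"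
proof -
  define \<Omega> where "\<Omega> = {..<2 * r} \<rightarrow>\<^sub>E {1..int L}"
  define T where "T = (\<lambda>\<phi>. \<Sum>x\<in>{0..<int p}. \<Prod>i<2 * r. Legendre (x + \<phi> i) (int p))"
  define E where "E = {\<phi> \<in> \<Omega>. \<forall>v. even (card {i. i < 2 * r \<and> \<phi> i = v})}"
  have fin: "finite \<Omega>" unfolding \<Omega>_def by (intro finite_PiE) auto
  have "(\<Sum>h\<in>{1..int L}. Legendre (x + h) (int p)) ^ (2 * r) =
      (\<Sum>\<phi>\<in>\<Omega>. \<Prod>i<2 * r. Legendre (x + \<phi> i) (int p))" for x
    using prod_sum_PiE[of "{..<2 * r}" "\<lambda>_. {1..int L}" "\<lambda>_ h. Legendre (x + h) (int p)"]
    by (simp add: \<Omega>_def)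
  then have "real_of_int (\<Sum>x\<in>{0..<int p}. (\<Sum>h\<in>{1..int L}. Legendre (x + h) (int p)) ^ (2 * r)) =
      (\<Sum>\<phi>\<in>\<Omega>. real_of_int (T \<phi>))"
    unfolding T_def by (simp add: sum.swap[of _ \<Omega>] del: of_int_prod)
  also have "\<dots> = (\<Sum>\<phi>\<in>E. real_of_int (T \<phi>)) + (\<Sum>\<phi>\<in>\<Omega> - E. real_of_int (T \<phi>))"
    using fin by (subst sum.subset_diff[of E]) (auto simp: E_def)
  also have "\<dots> \<le> (\<Sum>\<phi>\<in>E. real p) + (\<Sum>\<phi>\<in>\<Omega> - E. 19 * real (2 * r) * sqrt (real p))"
  proof (intro add_mono sum_mono)
    fix \<phi> assume "\<phi> \<in> E"
    have "(\<Prod>i<2 * r. Legendre (x + \<phi> i) (int p)) \<le> 1" for x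
    proof -
      have "\<bar>\<Prod>i<2 * r. Legendre (x + \<phi> i) (int p)\<bar> \<le> 1"
        unfolding abs_prod by (intro prod_le_1) (auto intro: abs_Legendre_le_1)
      then show ?thesis by simp
    qed
    then have "T \<phi> \<le> (\<Sum>x\<in>{0..<int p}. 1)" unfolding T_def by (intro sum_mono)
    then show "real_of_int (T \<phi>) \<le> real p" by simp
  next
    fix \<phi> assume "\<phi> \<in> \<Omega> - E"
    then obtain v where "odd (card {i. i < 2 * r \<and> \<phi> i = v})" "\<phi> \<in> \<Omega>" by (auto simp: E_def)
    then show "real_of_int (T \<phi>) \<le> 19 * real (2 * r) * sqrt (real p)"
      unfolding T_def using large L
      by (intro Legendre_prod_shift_sum_bound[OF p, where v = v]) (auto simp: \<Omega>_def PiE_def Pi_def)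
  qed
  also have "\<dots> = real (card E) * real p + real (card (\<Omega> - E)) * (38 * real r * sqrt (real p))" by simp
  also have "\<dots> \<le> (real L ^ r * real (r ^ (2 * r))) * real p + real L ^ (2 * r) * (38 * real r * sqrt (real p))"
  proof (intro add_mono mult_right_mono)
    have "card E \<le> card {1..int L} ^ r * r ^ (2 * r)"
      unfolding E_def \<Omega>_def using r by (intro card_even_fiber_tuples_le) auto
    then have "real (card E) \<le> real (L ^ r * r ^ (2 * r))" unfolding of_nat_le_iff by simp
    then show "real (card E) \<le> real L ^ r * real (r ^ (2 * r))" by simp
    have "card (\<Omega> - E) \<le> card \<Omega>" using fin by (intro card_mono) auto
    also have "\<dots> = L ^ (2 * r)" by (simp add: \<Omega>_def card_PiE)
    finally have "real (card (\<Omega> - E)) \<le> real (L ^ (2 * r))" unfolding of_nat_le_iff .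
    then show "real (card (\<Omega> - E)) \<le> real L ^ (2 * r)" by simp
  qed auto
  finally show ?thesis by (simp add: mult_ac)
qed

section \<open>Chebyshev and Mertens estimates; Vinogradov's trick\<close>

text \<open>Legendre's formula for the factorial in logarithmic form: \<open>n div m\<close> grows
  by one exactly when m divides n + 1, and these increments add up to ln (n + 1).\<close>

lemma ln_fact_mangoldt: "ln (fact n :: real) = (\<Sum>m=1..n. mangoldt m * real (n div m))"
proof (induction n)
  case 0
  then show ?case by simp
next
  case (Suc n)
  have eq: "real (Suc n div m) = real (n div m) + (if m dvd Suc n then 1 else 0)" for m
    by (auto simp: div_Suc dvd_eq_mod_eq_0)
  have "(\<Sum>m=1..Suc n. mangoldt m * real (Suc n div m)) =
      (\<Sum>m=1..Suc n. mangoldt m * real (n div m)) + (\<Sum>m=1..Suc n. if m dvd Suc n then mangoldt m else 0)"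
    unfolding sum.distrib[symmetric] by (intro sum.cong refl) (simp only: eq, simp add: algebra_simps)
  also have "(\<Sum>m=1..Suc n. mangoldt m * real (n div m)) = (\<Sum>m=1..n. mangoldt m * real (n div m))" by simp
  also have "(\<Sum>m=1..Suc n. if m dvd Suc n then mangoldt m else 0) = (\<Sum>m | m dvd Suc n. mangoldt m :: real)"
  proof (intro sum.mono_neutral_cong_right subsetI)
    fix m assume "m \<in> {m. m dvd Suc n}"
    then show "m \<in> {1..Suc n}" using dvd_imp_le[of m "Suc n"] dvd_pos_nat[of "Suc n" m] by simp
  qed auto
  also have "\<dots> = ln (real (Suc n))" by (subst mangoldt_sum) auto
  also have "(\<Sum>m=1..n. mangoldt m * real (n div m)) + ln (real (Suc n)) = ln (fact (Suc n))"
    unfolding Suc[symmetric] by (simp add: ln_mult)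
  finally show ?case ..
qed

section \<open>Chebyshev's function via central binomial coefficients\<close>

definition psi :: "nat \<Rightarrow> real" where "psi n = (\<Sum>m=1..n. mangoldt m)"

lemma psi_mono: "m \<le> n \<Longrightarrow> psi m \<le> psi n"
  unfolding psi_def by (intro sum_mono2) (auto simp: mangoldt_nonneg)

lemma ln_central_binomial_mangoldt:
  "ln (real (2 * n choose n)) = (\<Sum>m=1..2 * n. mangoldt m * (real (2 * n div m) - 2 * real (n div m)))"
proof -
  have "real (2 * n choose n) = fact (2 * n) / (fact n * fact n)"
    using binomial_fact[of n "2 * n", where ?'a = real] by simp
  then have "ln (real (2 * n choose n)) = ln (fact (2 * n)) - 2 * ln (fact n)"
    by (simp add: ln_div ln_mult)
  also have "ln (fact n :: real) = (\<Sum>m=1..2 * n. mangoldt m * real (n div m))"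
    unfolding ln_fact_mangoldt by (intro sum.mono_neutral_left) auto
  finally show ?thesis
    unfolding ln_fact_mangoldt by (simp add: sum_subtractf sum_distrib_left algebra_simps)
qed

lemma div_double_bounds:
  assumes "m > 0"
  shows "real (2 * n div m) - 2 * real (n div m) \<in> {0, 1}"
proof -
  have "2 * n div m = 2 * (n div m) + 2 * (n mod m) div m"
  proof -
    have "2 * n = 2 * (n div m * m + n mod m)" by simp
    also have "\<dots> = 2 * (n mod m) + (2 * (n div m)) * m" by (simp only: distrib_left mult.assoc add.commute)
    finally have "2 * n div m = (2 * (n mod m) + (2 * (n div m)) * m) div m" by (rule arg_cong)
    with assms show ?thesis by (simp only: div_mult_self1 less_numeral_extra(3) not_gr0)
  qed
  moreover have "2 * (n mod m) < 2 * m" using assms by simp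
  then have "2 * (n mod m) div m < 2" using assms by (subst div_less_iff_less_mult) auto
  ultimately show ?thesis by auto
qed

text \<open>In ln (2 n choose n) the coefficient of \<open>mangoldt m\<close> is at least 1 for n <
  m \<le> 2 n and never negative.\<close>

lemma psi_double_diff_le: "psi (2 * n) - psi n \<le> 2 * real n * ln 2"
proof -
  have "psi (2 * n) - psi n = (\<Sum>m=n+1..2 * n. mangoldt m)"
  proof -
    have "{1..2 * n} = {1..n} \<union> {n+1..2 * n}" by auto
    then have "psi (2 * n) = psi n + (\<Sum>m=n+1..2 * n. mangoldt m)"
      unfolding psi_def by (simp add: sum.union_disjoint)
    then show ?thesis by simp
  qed
  also have "\<dots> \<le> (\<Sum>m=n+1..2 * n. mangoldt m * (real (2 * n div m) - 2 * real (n div m)))"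
  proof (rule sum_mono)
    fix m assume m: "m \<in> {n+1..2 * n}"
    then have "2 * n div m \<ge> 1" by (simp add: div_greater_zero_iff Suc_le_eq)
    then have "1 \<le> real (2 * n div m) - 2 * real (n div m)" using m by auto
    from mult_left_mono[OF this mangoldt_nonneg[of m]]
    show "mangoldt m \<le> mangoldt m * (real (2 * n div m) - 2 * real (n div m))" by simp
  qed
  also have "\<dots> \<le> (\<Sum>m=1..2 * n. mangoldt m * (real (2 * n div m) - 2 * real (n div m)))"
  proof (intro sum_mono2 mult_nonneg_nonneg mangoldt_nonneg)
    fix m assume "m \<in> {1..2 * n} - {n+1..2 * n}"
    then show "0 \<le> real (2 * n div m) - 2 * real (n div m)" using div_double_bounds[of m n] by auto
  qed auto
  also have "\<dots> = ln (real (2 * n choose n))" by (rule ln_central_binomial_mangoldt[symmetric])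
  also have "\<dots> \<le> ln (2 ^ (2 * n))"
  proof -
    have "2 * n choose n \<le> 2 ^ (2 * n)" by (rule binomial_le_pow2)
    then have "real (2 * n choose n) \<le> 2 ^ (2 * n)" by (metis of_nat_le_iff of_nat_numeral of_nat_power)
    then show ?thesis by (subst ln_le_cancel_iff) auto
  qed
  also have "\<dots> = 2 * real n * ln 2" by (simp add: ln_realpow)
  finally show ?thesis .
qed

text \<open>The same coefficients are at most 1, so \<open>psi (2 * n)\<close> dominates the
  logarithm of the central binomial coefficient.\<close>

lemma psi_double_ge:
  assumes "n > 0"
  shows "psi (2 * n) \<ge> 2 * real n * ln 2 - ln (2 * real n)"
proof -
  have "4 ^ n / (2 * real n) \<le> real (2 * n choose n)"
    using assms by (rule central_binomial_lower_bound)
  then have "ln (4 ^ n / (2 * real n)) \<le> ln (real (2 * n choose n))"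
    using assms by (subst ln_le_cancel_iff) auto
  also have "\<dots> \<le> (\<Sum>m=1..2 * n. mangoldt m * 1)"
    unfolding ln_central_binomial_mangoldt
  proof (intro sum_mono mult_left_mono mangoldt_nonneg)
    fix m assume "m \<in> {1..2 * n}"
    then show "real (2 * n div m) - 2 * real (n div m) \<le> 1" using div_double_bounds[of m n] by auto
  qed
  also have "ln (4 ^ n / (2 * real n)) = 2 * real n * ln 2 - ln (2 * real n)"
  proof -
    have "ln (4 :: real) = 2 * ln 2" using ln_realpow[of 2 2] by simp
    then show ?thesis using assms by (simp add: ln_div ln_realpow ln_mult)
  qed
  finally show ?thesis by (simp add: psi_def)
qed

lemma psi_le: "psi n \<le> 4 * real n"
proof (induction n rule: less_induct)
  case (less n)
  have ln2: "ln 2 \<le> (1 :: real)" using ln_2_less_1 by simp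
  consider "n = 0" | "n = 1" | "n = 2" | "n \<ge> 3" by linarith
  then show ?case
  proof cases
    case 3
    have "psi 2 = mangoldt 2" by (simp add: psi_def numeral_2_eq_2)
    then show ?thesis using 3 ln2 by simp
  next
    case 4
    \<comment> \<open>Halving upwards gives psi n \<le> psi k + 2 k ln 2 \<le> 6 k \<le> 3 (n + 1),
      which is at most 4 n from n = 3 on.\<close>
    define k where "k = (n + 1) div 2"
    have k: "k < n" "n \<le> 2 * k" "real k \<le> (real n + 1) / 2"
      using 4 of_nat_div_le_of_nat[where 'a = real, of "n + 1" 2] unfolding k_def by (linarith, linarith, simp)
    have "psi n \<le> psi (2 * k)" by (rule psi_mono[OF k(2)])
    also have "\<dots> \<le> psi k + 2 * real k * ln 2" using psi_double_diff_le[of k] by simp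
    also have "\<dots> \<le> 4 * real k + 2 * real k * 1" using less.IH[OF k(1)] ln2 by (intro add_mono mult_left_mono) auto
    also have "\<dots> \<le> 4 * real n" using k(3) 4 by simp
    finally show ?thesis .
  qed (auto simp: psi_def)
qed

section \<open>Mertens' estimates and prime counts\<close>

lemma ln_fact_ge: "n > 0 \<Longrightarrow> ln (fact n :: real) \<ge> real n * ln n - real n"
proof (induction n)
  case 0
  then show ?case by simp
next
  case (Suc n)
  show ?case
  proof (cases "n = 0")
    case False
    have "ln (real (Suc n)) = ln (real n * (1 + 1 / real n))" using False by (simp add: distrib_left add.commute)
    also have "\<dots> = ln (real n) + ln (1 + 1 / real n)" using False by (intro ln_mult_pos) (auto simp: add_pos_nonneg)
    finally have "ln (real (Suc n)) - ln (real n) = ln (1 + 1 / real n)" by simp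
    also have "\<dots> \<le> 1 / real n" using ln_add_one_self_le_self[of "1 / real n"] by simp
    finally have "real n * (ln (real (Suc n)) - ln (real n)) \<le> 1" using False by (simp add: field_simps)
    moreover have "ln (fact (Suc n) :: real) = ln (real (Suc n)) + ln (fact n)"
      by (simp add: ln_mult)
    ultimately show ?thesis using Suc False by (simp add: algebra_simps)
  qed simp
qed

text \<open>In n times the sum, replacing n / m by its integer part leaves ln (n!) and costs at most
  psi n \<le> 4 n.\<close>

lemma mertens_upper:
  assumes "n > 0"
  shows "(\<Sum>m=1..n. mangoldt m / real m) \<le> ln (real n) + 4"
proof -
  have "real n * (\<Sum>m=1..n. mangoldt m / real m) = (\<Sum>m=1..n. mangoldt m * (real n / real m))"
    by (simp add: sum_distrib_left mult_ac)
  also have "\<dots> \<le> (\<Sum>m=1..n. mangoldt m * (real (n div m) + 1))"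
  proof (intro sum_mono mult_left_mono mangoldt_nonneg)
    fix m
    have "\<lfloor>real n / real m\<rfloor> = int (n div m)" by (rule floor_divide_of_nat_eq)
    then show "real n / real m \<le> real (n div m) + 1" by linarith
  qed
  also have "\<dots> = ln (fact n) + psi n"
    unfolding ln_fact_mangoldt psi_def by (simp add: algebra_simps sum.distrib)
  also have "\<dots> \<le> real n * ln (real n) + 4 * real n"
  proof (intro add_mono psi_le)
    have "ln (fact n :: real) \<le> ln (real n ^ n)"
      using assms fact_le_power[of n, where ?'a = real] by (subst ln_le_cancel_iff) auto
    then show "ln (fact n :: real) \<le> real n * ln (real n)" using assms by (simp add: ln_realpow)
  qed
  finally have "real n * (\<Sum>m=1..n. mangoldt m / real m) \<le> real n * (ln (real n) + 4)"
    by (simp add: algebra_simps)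
  then show ?thesis using assms by simp
qed

lemma mertens_lower:
  assumes "n > 0"
  shows "(\<Sum>m=1..n. mangoldt m / real m) \<ge> ln (real n) - 1"
proof -
  have "real n * (ln (real n) - 1) \<le> ln (fact n)" using ln_fact_ge[OF assms] by (simp add: algebra_simps)
  also have "\<dots> \<le> (\<Sum>m=1..n. mangoldt m * (real n / real m))"
    unfolding ln_fact_mangoldt
    by (intro sum_mono mult_left_mono mangoldt_nonneg) (rule of_nat_div_le_of_nat)
  also have "\<dots> = real n * (\<Sum>m=1..n. mangoldt m / real m)" by (simp add: sum_distrib_left mult_ac)
  finally show ?thesis using assms by simp
qed

text \<open>One-sided summation by parts. The induction carries a stronger bound with the extra term
  w n * (partial sum - K), which is never positive.\<close>

lemma abel_summation_bound:
  fixes w e :: "nat \<Rightarrow> real"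
  assumes "\<And>n. n > y \<Longrightarrow> w (Suc n) \<le> w n" and "\<And>n. n > y \<Longrightarrow> w n \<ge> 0"
    and "\<And>n. n > y \<Longrightarrow> (\<Sum>m=Suc y..n. e m) \<le> K" and "n > y"
  shows "(\<Sum>m=Suc y..n. w m * e m) \<le> K * w (Suc y)"
proof -
  have "(\<Sum>m=Suc y..n. w m * e m) \<le> w n * ((\<Sum>m=Suc y..n. e m) - K) + K * w (Suc y)"
    using \<open>n > y\<close>
  proof (induction n rule: dec_induct[of "Suc y", simplified Suc_le_eq, consumes 1, case_names base step])
    case base
    then show ?case by (simp add: algebra_simps)
  next
    case (step n)
    have "w n * ((\<Sum>m=Suc y..n. e m) - K) \<le> w (Suc n) * ((\<Sum>m=Suc y..n. e m) - K)"
      using assms(1,3)[of n] step by (intro mult_right_mono_neg) auto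
    with step show ?case by (simp add: algebra_simps)
  qed
  also have "w n * ((\<Sum>m=Suc y..n. e m) - K) \<le> 0"
    using assms(2,3)[of n] \<open>n > y\<close> by (intro mult_nonneg_nonpos) auto
  finally show ?thesis by simp
qed

text \<open>With weights 1 / ln m, \<open>mangoldt m / m\<close> is compared with ln m - ln (m - 1),
  whose weighted sum is dominated by a telescoping double logarithm. Partial sums of the difference
  are at most 4 + 1 = 5 by the upper and lower Mertens bounds.\<close>

lemma sum_prime_reciprocals_le:
  assumes y: "y \<ge> 2" and "y \<le> x"
  shows "(\<Sum>q | prime q \<and> y < q \<and> q \<le> x. 1 / real q) \<le> ln (ln (real x) / ln (real y)) + 5 / ln (real y)"
proof (cases "x = y")
  case True
  then have e: "{q. prime q \<and> y < q \<and> q \<le> x} = {}" by auto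
  show ?thesis unfolding e using y True by simp
next
  case False
  then have xy: "x > y" using assms by simp
  define w where "w = (\<lambda>m. 1 / ln (real m))"
  define d where "d = (\<lambda>m. ln (real m) - ln (real (m - 1)))"
  have tel: "(\<Sum>m=Suc y..n. G m - G (m - 1)) = G n - G y" if "n > y" for n and G :: "nat \<Rightarrow> real"
    using that by (intro sum_telescope'') simp
  have "(\<Sum>q | prime q \<and> y < q \<and> q \<le> x. 1 / real q) =
      (\<Sum>q | prime q \<and> y < q \<and> q \<le> x. w q * (mangoldt q / real q))"
  proof (rule sum.cong)
    fix q assume "q \<in> {q. prime q \<and> y < q \<and> q \<le> x}"
    then have "prime q" "ln (real q) > 0" using y by auto
    then show "1 / real q = w q * (mangoldt q / real q)" by (simp add: w_def)
  qed simp
  also have "\<dots> \<le> (\<Sum>m=Suc y..x. w m * (mangoldt m / real m))"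
    using y by (intro sum_mono2) (auto simp: w_def intro!: mult_nonneg_nonneg mangoldt_nonneg divide_nonneg_nonneg)
  also have "\<dots> = (\<Sum>m=Suc y..x. w m * d m) + (\<Sum>m=Suc y..x. w m * (mangoldt m / real m - d m))"
    by (simp add: algebra_simps sum.distrib sum_subtractf)
  also have "\<dots> \<le> (ln (ln (real x)) - ln (ln (real y))) + 5 * w (Suc y)"
  proof (rule add_mono)
    have "(\<Sum>m=Suc y..x. w m * d m) \<le> (\<Sum>m=Suc y..x. ln (ln (real m)) - ln (ln (real (m - 1))))"
    proof (rule sum_mono)
      fix m assume m: "m \<in> {Suc y..x}"
      then have pos: "ln (real (m - 1)) > 0" "ln (real m) > 0" using y by auto
      \<comment> \<open>The inequality ln t \<le> t - 1 at t = ln (m - 1) / ln m stands in for a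
        comparison with the integral of 1 / (x ln x).\<close>
      then have "ln (ln (real (m - 1)) / ln (real m)) \<le> ln (real (m - 1)) / ln (real m) - 1"
        by (intro ln_le_minus_one) auto
      then show "w m * d m \<le> ln (ln (real m)) - ln (ln (real (m - 1)))"
        using pos by (simp add: w_def d_def ln_div diff_divide_distrib)
    qed
    then show "(\<Sum>m=Suc y..x. w m * d m) \<le> ln (ln (real x)) - ln (ln (real y))"
      using tel[OF xy, of "\<lambda>m. ln (ln (real m))"] by simp
    show "(\<Sum>m=Suc y..x. w m * (mangoldt m / real m - d m)) \<le> 5 * w (Suc y)"
    proof (rule abel_summation_bound)
      fix n assume n: "n > y"
      show "w (Suc n) \<le> w n" "0 \<le> w n" using n y by (auto simp: w_def frac_le)
      have "(\<Sum>m=1..n. mangoldt m / real m) = (\<Sum>m=1..y. mangoldt m / real m) + (\<Sum>m=Suc y..n. mangoldt m / real m)"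
        using n by (subst sum.union_disjoint[symmetric]) (auto intro: sum.cong)
      then have "(\<Sum>m=Suc y..n. mangoldt m / real m) \<le> ln (real n) - ln (real y) + 5"
        using mertens_upper[of n] mertens_lower[of y] n y by simp
      then show "(\<Sum>m=Suc y..n. mangoldt m / real m - d m) \<le> 5"
        using tel[OF n, of "\<lambda>m. ln (real m)"] by (simp add: sum_subtractf[where f = "\<lambda>m. mangoldt m / real m"] d_def)
    qed (rule xy)
  qed
  also have "5 * w (Suc y) \<le> 5 / ln (real y)" using y by (simp add: w_def frac_le)
  finally show ?thesis using y xy by (simp add: ln_div)
qed

text \<open>At most ln n / ln q powers of a prime q are up to n, each of weight ln q, so every prime
  contributes at most ln n.\<close>

lemma psi_le_card_primes: "psi n \<le> real (card {q. prime q \<and> q \<le> n}) * ln (real n)"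
proof -
  define A where "A = {m \<in> {1..n}. primepow m}"
  define P where "P = {q. prime q \<and> q \<le> n}"
  have finP: "finite P" unfolding P_def by (rule finite_subset[of _ "{..n}"]) auto
  have apd: "aprimedivisor m \<in> P" if m: "m \<in> A" for m
  proof -
    have m': "primepow m" "m \<le> n" "m > 1" using m primepow_gt_Suc_0 by (auto simp: A_def)
    have "aprimedivisor m \<le> m" using m'(3) by (intro aprimedivisor_le_nat) auto
    moreover have "prime (aprimedivisor m)"
      using m'(1) prime_aprimedivisor'[of m] m'(3) by auto
    ultimately show ?thesis using m' by (simp add: P_def)
  qed
  have "psi n = (\<Sum>m\<in>A. mangoldt m)"
    unfolding psi_def A_def by (intro sum.mono_neutral_right) (auto simp: mangoldt_def)
  also have "\<dots> = (\<Sum>q\<in>P. \<Sum>m | m \<in> A \<and> aprimedivisor m = q. mangoldt m)"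
    using apd finP by (intro sum.group[symmetric]) (auto simp: A_def)
  also have "\<dots> \<le> (\<Sum>q\<in>P. ln (real n))"
  proof (rule sum_mono)
    fix q assume q: "q \<in> P"
    then have qp: "prime q" "q \<le> n" by (auto simp: P_def)
    define t where "t = nat \<lfloor>ln (real n) / ln (real q)\<rfloor>"
    have lnq: "ln (real q) > 0" using prime_gt_1_nat[OF qp(1)] by simp
    have n: "n > 0" using qp prime_gt_0_nat[OF qp(1)] by simp
    have sub: "{m. m \<in> A \<and> aprimedivisor m = q} \<subseteq> (\<lambda>k. q ^ k) ` {1..t}"
    proof
      fix m assume m: "m \<in> {m. m \<in> A \<and> aprimedivisor m = q}"
      then have "primepow m" "m \<le> n" by (auto simp: A_def)
      then obtain r k where rk: "prime r" "k > 0" "m = r ^ k" by (auto simp: primepow_def)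
      then have "r = q" using m by (simp add: aprimedivisor_prime_power)
      then have "real q ^ k \<le> real n" using rk \<open>m \<le> n\<close> by (simp flip: of_nat_power)
      then have "ln (real q ^ k) \<le> ln (real n)" using n prime_gt_0_nat[OF qp(1)] by (subst ln_le_cancel_iff) auto
      then have "real k \<le> ln (real n) / ln (real q)"
        using lnq prime_gt_0_nat[OF qp(1)] by (simp add: ln_realpow field_simps)
      then have "k \<le> t" unfolding t_def by linarith
      then show "m \<in> (\<lambda>k. q ^ k) ` {1..t}" using rk \<open>r = q\<close> by auto
    qed
    then have "card {m. m \<in> A \<and> aprimedivisor m = q} \<le> t"
      using surj_card_le[of "{1..t}" _ "\<lambda>k. q ^ k"] by simp
    have "(\<Sum>m | m \<in> A \<and> aprimedivisor m = q. mangoldt m :: real) =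
        (\<Sum>m | m \<in> A \<and> aprimedivisor m = q. ln (real q))"
      by (intro sum.cong) (auto simp: A_def mangoldt_def)
    also have "\<dots> = real (card {m. m \<in> A \<and> aprimedivisor m = q}) * ln (real q)" by simp
    also have "\<dots> \<le> real t * ln (real q)"
      using \<open>card _ \<le> t\<close> lnq by (intro mult_right_mono) auto
    also have "\<dots> \<le> (ln (real n) / ln (real q)) * ln (real q)"
      using lnq n unfolding t_def by (intro mult_right_mono) (auto simp: of_nat_nat)
    finally show "(\<Sum>m | m \<in> A \<and> aprimedivisor m = q. mangoldt m :: real) \<le> ln (real n)" using lnq by simp
  qed
  finally show ?thesis by (simp add: P_def)
qed

lemma card_primes_ge:
  assumes "n \<ge> 2"
  shows "real (card {q. prime q \<and> q \<le> n}) * ln (real n) \<ge> (real n - 1) * ln 2 - ln (real n)"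
proof -
  define k where "k = n div 2"
  have k: "k > 0" "2 * k \<le> n" "real n - 1 \<le> 2 * real k" using assms unfolding k_def by linarith+
  have "(real n - 1) * ln 2 - ln (real n) \<le> 2 * real k * ln 2 - ln (2 * real k)"
    using k by (intro diff_mono mult_right_mono) auto
  also have "\<dots> \<le> psi (2 * k)" using k by (intro psi_double_ge) auto
  also have "\<dots> \<le> psi n" by (rule psi_mono[OF k(2)])
  also have "\<dots> \<le> real (card {q. prime q \<and> q \<le> n}) * ln (real n)" by (rule psi_le_card_primes)
  finally show ?thesis .
qed

section \<open>Bias of the Legendre symbol on an initial interval\<close>

lemma Legendre_1_if_prime_factors:
  assumes p: "prime p" "odd p"
  shows "\<lbrakk>n > 0; \<And>q. prime q \<Longrightarrow> q dvd n \<Longrightarrow> Legendre (int q) (int p) = 1\<rbrakk> \<Longrightarrow> Legendre (int n) (int p) = 1"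
proof (induction n rule: less_induct)
  case (less n)
  show ?case
  proof (cases "n = 1")
    case True
    then show ?thesis using Legendre_1[OF p(1)] by simp
  next
    case False
    then obtain q where q: "prime q" "q dvd n" using prime_factor_nat by blast
    then obtain m where m: "n = q * m" by blast
    have "m < n" "m > 0" using m less.prems(1) prime_gt_1_nat[OF q(1)] by auto
    moreover have "Legendre (int r) (int p) = 1" if "prime r" "r dvd m" for r
      using less.prems(2)[OF that(1)] dvd_mult[OF that(2), of q] m by blast
    ultimately have "Legendre (int m) (int p) = 1" by (rule less.IH)
    moreover have "Legendre (int n) (int p) = Legendre (int q) (int p) * Legendre (int m) (int p)"
      unfolding m of_nat_mult by (rule Legendre_mult[OF p])
    ultimately show ?thesis using less.prems(2)[OF q] by simp
  qed
qed

text \<open>Vinogradov's trick: a nonresidue has a nonresidue prime factor, and these all exceed \<open>y\<close>.\<close>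
lemma Legendre_sum_ge_if_least_nonresidue_large:
  assumes p: "prime p" "odd p" and y: "2 \<le> y" "y \<le> B" and B: "B < p"
    and res: "\<And>n. 1 \<le> n \<Longrightarrow> n \<le> y \<Longrightarrow> Legendre (int n) (int p) = 1"
  shows "real_of_int (\<Sum>n=1..B. Legendre (int n) (int p)) \<ge>
    real B * (1 - 2 * (ln (ln (real B) / ln (real y)) + 5 / ln (real y)))"
proof -
  define Q where "Q = {q. prime q \<and> y < q \<and> q \<le> B}"
  have finQ: "finite Q" unfolding Q_def by (rule finite_subset[of _ "{..B}"]) auto
  \<comment> \<open>Dropping from 1 to -1 costs 2, charged to a prime factor in Q; charging several
    factors only weakens the bound.\<close>
  have "real_of_int (Legendre (int n) (int p)) \<ge> 1 - 2 * (\<Sum>q\<in>Q. if q dvd n then 1 else 0)"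
    if n: "n \<in> {1..B}" for n
  proof (cases "Legendre (int n) (int p) = 1")
    case True
    then show ?thesis by (simp add: sum_nonneg)
  next
    case False
    then obtain q where q: "prime q" "q dvd n" "Legendre (int q) (int p) \<noteq> 1"
      using Legendre_1_if_prime_factors[OF p, of n] n by auto
    then have "q \<le> B" using n dvd_imp_le[of q n] by auto
    moreover have "y < q" using q res[of q] prime_gt_0_nat[OF q(1)] by (cases "q \<le> y") auto
    ultimately have "q \<in> Q" using q by (simp add: Q_def)
    then have "(\<Sum>q\<in>Q. if q dvd n then 1 else 0 :: real) \<ge> 1"
      using finQ q(2) member_le_sum[of q Q "\<lambda>q. if q dvd n then 1 else 0 :: real"] by auto
    moreover have "real_of_int (Legendre (int n) (int p)) \<ge> -1"
      using abs_Legendre_le_1[of "int n" "int p"] by linarith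
    ultimately show ?thesis by linarith
  qed
  then have "(\<Sum>n=1..B. 1 - 2 * (\<Sum>q\<in>Q. if q dvd n then 1 else 0 :: real)) \<le>
      (\<Sum>n=1..B. real_of_int (Legendre (int n) (int p)))"
    by (intro sum_mono) auto
  moreover have "(\<Sum>n=1..B. 1 - 2 * (\<Sum>q\<in>Q. if q dvd n then 1 else 0 :: real)) =
      real B - 2 * (\<Sum>q\<in>Q. \<Sum>n=1..B. if q dvd n then 1 else 0)"
    unfolding sum_subtractf sum_distrib_left[symmetric] by (subst sum.swap) simp
  moreover have "(\<Sum>q\<in>Q. \<Sum>n=1..B. if q dvd n then 1 else 0 :: real) \<le> (\<Sum>q\<in>Q. real B * (1 / real q))"
  proof (rule sum_mono)
    fix q assume "q \<in> Q"
    then have "q > 0" by (auto simp: Q_def)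
    have "{n \<in> {1..B}. q dvd n} \<subseteq> (\<lambda>k. q * k) ` {1..B div q}"
    proof
      fix n assume n: "n \<in> {n \<in> {1..B}. q dvd n}"
      then obtain k where k: "n = q * k" by blast
      have "k \<ge> 1" using n k by (cases k) auto
      moreover have "k \<le> B div q" using n k \<open>q > 0\<close> by (simp add: less_eq_div_iff_mult_less_eq mult.commute)
      ultimately show "n \<in> (\<lambda>k. q * k) ` {1..B div q}" using k by auto
    qed
    then have "card {n \<in> {1..B}. q dvd n} \<le> B div q"
      using surj_card_le[of "{1..B div q}" _ "\<lambda>k. q * k"] by simp
    then have "real (card {n \<in> {1..B}. q dvd n}) \<le> real B / real q"
      using of_nat_div_le_of_nat[where 'a = real, of B q] by linarith
    then show "(\<Sum>n=1..B. if q dvd n then 1 else 0 :: real) \<le> real B * (1 / real q)"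
      by (simp add: sum.If_cases Int_def)
  qed
  moreover have "\<dots> = real B * (\<Sum>q\<in>Q. 1 / real q)" by (rule sum_distrib_left[symmetric])
  moreover have "\<dots> \<le> real B * (ln (ln (real B) / ln (real y)) + 5 / ln (real y))"
    unfolding Q_def by (intro mult_left_mono sum_prime_reciprocals_le y) auto
  ultimately have "real B - 2 * (real B * (ln (ln (real B) / ln (real y)) + 5 / ln (real y)))
      \<le> real_of_int (\<Sum>n=1..B. Legendre (int n) (int p))" by simp
  then show ?thesis by (simp add: algebra_simps)
qed

section \<open>Coincidences among the fractions\<close>

text \<open>The product of distinct primes dividing U divides U, so it is below p \<le> z ^ K, while
  each factor is at least z.\<close>

lemma card_prime_divisors_less:
  fixes U :: int
  assumes S: "finite S" "\<And>q. q \<in> S \<Longrightarrow> prime q \<and> z \<le> q \<and> int q dvd U"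
    and U: "U \<noteq> 0" "\<bar>U\<bar> < int p" and z: "z > 1" "p \<le> z ^ K"
  shows "card S < K"
proof -
  have "(\<Prod>q\<in>S. q) dvd nat \<bar>U\<bar>"
    using S
  proof (induction S rule: finite_induct)
    case (insert q S)
    have "q dvd nat \<bar>U\<bar>" using insert.prems[of q] by (simp flip: int_dvd_int_iff)
    moreover have "coprime q q'" if "q' \<in> S" for q'
      using insert.hyps(2) insert.prems[of q] insert.prems[of q'] that by (intro primes_coprime) auto
    then have "coprime q (\<Prod>q\<in>S. q)" by (rule prod_coprime_right)
    moreover have "(\<Prod>q\<in>S. q) dvd nat \<bar>U\<bar>" by (rule insert.IH) (rule insert.prems, simp)
    ultimately have "q * (\<Prod>q\<in>S. q) dvd nat \<bar>U\<bar>" by (intro divides_mult)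
    then show ?case unfolding prod.insert[OF insert.hyps] .
  qed simp
  then have le: "(\<Prod>q\<in>S. q) \<le> nat \<bar>U\<bar>" using U(1) by (intro dvd_imp_le) auto
  have "z ^ card S = (\<Prod>q\<in>S. z)" by simp
  also have "\<dots> \<le> (\<Prod>q\<in>S. q)" using S(2) by (intro prod_mono) auto
  also have "\<dots> < p" using le U(2) by linarith
  also have "\<dots> \<le> z ^ K" by (rule z(2))
  finally show ?thesis by (rule power_less_imp_less_exp[OF z(1)])
qed

text \<open>Cross-multiplied equality of two fractions, arranged as k times a small integer being
  congruent to a small integer, so that k can be eliminated between two coincidences.\<close>

definition collide :: "nat \<Rightarrow> int \<Rightarrow> nat \<Rightarrow> nat \<Rightarrow> nat \<Rightarrow> nat \<Rightarrow> nat \<Rightarrow> nat \<Rightarrow> bool" where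
  "collide p k a b q a' b' q' \<longleftrightarrow>
    int p dvd k * (int a * int q - int a' * int q') - int a * int a' * (int b' * int q - int b * int q')"

text \<open>The fractions \<open>(a * b - k) / (a * q)\<close> and \<open>(a' * b' - k) / (a' * q')\<close> modulo \<open>p\<close> agree.\<close>
lemma collide_if_eq:
  assumes "int p dvd t * (int a * int q) - (int a * int b - k)"
    and "int p dvd t * (int a' * int q') - (int a' * int b' - k)"
  shows "collide p k a b q a' b' q'"
proof -
  have "int p dvd (t * (int a' * int q') - (int a' * int b' - k)) * (int a * int q)
      - (t * (int a * int q) - (int a * int b - k)) * (int a' * int q')"
    by (rule dvd_diff[OF dvd_mult2[OF assms(2)] dvd_mult2[OF assms(1)]])
  also have "\<dots> = k * (int a * int q - int a' * int q') - int a * int a' * (int b' * int q - int b * int q')"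
    by (simp add: algebra_simps)
  finally show ?thesis unfolding collide_def .
qed

lemma int_eq_if_cong_small:
  fixes x y :: int
  assumes "int p dvd x - y" "\<bar>x\<bar> \<le> M" "\<bar>y\<bar> \<le> M" "2 * M < int p"
  shows "x = y"
  using assms dvd_imp_le_int[of "x - y" "int p"] by (cases "x = y") auto

lemma abs_diff_prod_le:
  fixes x y x' y' :: nat
  assumes "x \<le> X" "y \<le> Y" "x' \<le> X" "y' \<le> Y"
  shows "\<bar>int x * int y - int x' * int y'\<bar> \<le> int (X * Y)"
proof -
  have "int (x * y) \<le> int (X * Y)" "int (x' * y') \<le> int (X * Y)"
    unfolding of_nat_le_iff using assms by (intro mult_le_mono; simp)+
  moreover have "0 \<le> int (x * y)" "0 \<le> int (x' * y')" by simp_all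
  ultimately show ?thesis unfolding of_nat_mult by linarith
qed

text \<open>A fixed coincidence reads k v0 = U modulo p, any other k v' = U'. Eliminating k gives U'
  v0 = U v' modulo p and, by \<open>size\<close>, in the integers. The prime a divides U', which has
  the factor a a', but not v' = a q - a' q', as a differs from a' and from the elements of Q. So a
  divides U, which is independent of the second coincidence.\<close>

lemma ex_common_multiple_of_colliding_first:
  assumes p: "prime p" and k: "\<not> int p dvd k"
    and A: "\<And>a. a \<in> A \<Longrightarrow> prime a \<and> a \<le> M" and Q: "\<And>q. q \<in> Q \<Longrightarrow> prime q \<and> q \<le> N" and AQ: "A \<inter> Q = {}"
    and B: "B \<ge> 1" and size: "2 * (M ^ 3 * B * N ^ 2) < p"
  obtains U :: int where "U \<noteq> 0" "\<bar>U\<bar> < int p"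
    "\<And>a a' b b' q q'. \<lbrakk>a \<in> A; a' \<in> A; a \<noteq> a'; b \<le> B; b' \<le> B; q \<in> Q; q' \<in> Q; collide p k a b q a' b' q'\<rbrakk>
      \<Longrightarrow> int a dvd U"
proof (cases "\<exists>a a' b b' q q'. a \<in> A \<and> a' \<in> A \<and> a \<noteq> a' \<and> b \<le> B \<and> b' \<le> B \<and> q \<in> Q \<and> q' \<in> Q \<and>
    collide p k a b q a' b' q'")
  case False
  show ?thesis
  proof (rule that[of 1])
    show "\<bar>1\<bar> < int p" using prime_gt_1_nat[OF p] by simp
  qed (use False in \<open>blast | simp\<close>)+
next
  case True
  define v where "v = (\<lambda>a q a' q'. int a * int q - int a' * int q')"
  define u where "u = (\<lambda>a b q a' b' q'. int a * int a' * (int b' * int q - int b * int q'))"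
  have vb: "\<bar>v a q a' q'\<bar> \<le> int (M * N)" if "a \<in> A" "a' \<in> A" "q \<in> Q" "q' \<in> Q" for a a' q q'
    unfolding v_def using that A Q by (intro abs_diff_prod_le) auto
  have ub: "\<bar>u a b q a' b' q'\<bar> \<le> int (M * M * (B * N))"
    if "a \<in> A" "a' \<in> A" "q \<in> Q" "q' \<in> Q" "b \<le> B" "b' \<le> B" for a a' b b' q q'
  proof -
    have "\<bar>u a b q a' b' q'\<bar> = int (a * a') * \<bar>int b' * int q - int b * int q'\<bar>"
      by (simp add: u_def abs_mult)
    also have "\<dots> \<le> int (M * M) * int (B * N)"
      using that A Q by (intro mult_mono abs_diff_prod_le) (auto simp flip: of_nat_mult intro: mult_le_mono)
    finally show ?thesis by simp
  qed
  \<comment> \<open>\<open>M * N\<close> bounds the multipliers v of k, and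
    \<open>M * M * (B * N)\<close> the right-hand sides u.\<close>
  have small: "M * N * (M * M * (B * N)) = M ^ 3 * B * N ^ 2"
    by (simp add: power3_eq_cube power2_eq_square)
  obtain a0 a0' b0 b0' q0 q0' where w: "a0 \<in> A" "a0' \<in> A" "a0 \<noteq> a0'" "b0 \<le> B" "b0' \<le> B"
    "q0 \<in> Q" "q0' \<in> Q" "collide p k a0 b0 q0 a0' b0' q0'" using True by blast
  define v0 where "v0 = v a0 q0 a0' q0'"
  define U where "U = u a0 b0 q0 a0' b0' q0'"
  have ndvd: "\<not> int a dvd v a q a' q'" if "a \<in> A" "a' \<in> A" "a \<noteq> a'" "q' \<in> Q" for a a' q q'
  proof
    assume "int a dvd v a q a' q'"
    then have "int a dvd int a' * int q'"
      unfolding v_def by (simp add: dvd_diff_right_iff)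
    then have "a dvd a' \<or> a dvd q'" using A[OF that(1)] by (simp add: int_prime_dvd_mult_iff)
    moreover have "a \<noteq> q'" using that AQ by auto
    ultimately show False using A Q that by (metis primes_dvd_imp_eq)
  qed
  have v0: "v0 \<noteq> 0" unfolding v0_def using ndvd[OF w(1,2,3,7), of q0] by auto
  have ge1: "M \<ge> 1" "N \<ge> 1" using A[OF w(1)] Q[OF w(6)] prime_ge_1_nat by (metis le_trans)+
  have MN: "M * M * (B * N) < p" "M * N < p"
  proof -
    have "1 * (M * M * (B * N)) \<le> M * N * (M * M * (B * N))" using ge1 by (intro mult_le_mono1) simp
    then show "M * M * (B * N) < p" using size unfolding small by linarith
    have "M * N * 1 \<le> M * N * (M * M * (B * N))" using ge1 B by (intro mult_le_mono2) simp
    then show "M * N < p" using size unfolding small by linarith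
  qed
  show ?thesis
  proof (rule that[of U])
    show "U \<noteq> 0"
    proof
      assume "U = 0"
      moreover have "int p dvd k * v0 - U"
        using w(8) unfolding collide_def U_def u_def v0_def v_def .
      ultimately have "int p dvd k * v0" by simp
      then have "int p dvd v0" using k int_prime_dvd_mult_iff[OF p] by blast
      then have "\<bar>int p\<bar> \<le> \<bar>v0\<bar>" using v0 by (intro dvd_imp_le_int)
      then show False using vb[OF w(1,2,6,7)] MN(2) unfolding v0_def by linarith
    qed
    show "\<bar>U\<bar> < int p" using ub[OF w(1,2,6,7,4,5)] MN(1) unfolding U_def by linarith
    fix a a' b b' q q'
    assume *: "a \<in> A" "a' \<in> A" "a \<noteq> a'" "b \<le> B" "b' \<le> B" "q \<in> Q" "q' \<in> Q" "collide p k a b q a' b' q'"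
    define v' where "v' = v a q a' q'"
    define U' where "U' = u a b q a' b' q'"
    have "int p dvd (k * v0 - U) * v' - (k * v' - U') * v0"
      unfolding v0_def v'_def U_def U'_def u_def v_def
      by (rule dvd_diff[OF dvd_mult2[OF w(8)[unfolded collide_def]] dvd_mult2[OF *(8)[unfolded collide_def]]])
    then have "int p dvd U' * v0 - U * v'" by (simp add: algebra_simps)
    moreover have le: "\<bar>x * y\<bar> \<le> int (M ^ 3 * B * N ^ 2)"
      if "\<bar>x\<bar> \<le> int (M * M * (B * N))" "\<bar>y\<bar> \<le> int (M * N)" for x y
    proof -
      have "\<bar>x * y\<bar> \<le> int (M * M * (B * N)) * int (M * N)"
        unfolding abs_mult using that by (intro mult_mono) auto
      also have "\<dots> = int (M * N * (M * M * (B * N)))" by (simp add: mult_ac)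
      finally show ?thesis unfolding small .
    qed
    have "\<bar>U' * v0\<bar> \<le> int (M ^ 3 * B * N ^ 2)" "\<bar>U * v'\<bar> \<le> int (M ^ 3 * B * N ^ 2)"
      unfolding U'_def U_def v0_def v'_def using * w by (intro le ub vb; simp)+
    ultimately have "U' * v0 = U * v'"
      using size by (intro int_eq_if_cong_small[of p _ _ "int (M ^ 3 * B * N ^ 2)"]) (linarith+)
    moreover have "int a dvd U' * v0" unfolding U'_def u_def by simp
    ultimately have "int a dvd U * v'" by simp
    then show "int a dvd U"
      using ndvd[OF *(1,2,3,7), of q] A[OF *(1)] int_prime_dvd_mult_iff unfolding v'_def by blast
  qed
qed

text \<open>For a = a' a coincidence reads k (q - q') = a (b' q - b q') modulo p. Eliminating k
  against a fixed one, k v0 = a u0, gives q' (b v0 - u0) = q (b' v0 - u0) in the integers, so q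
  divides U = b v0 - u0. If U were 0, then (a b - k) v0 = 0 modulo p, which is excluded as v0 is
  small and nonzero.\<close>

lemma ex_common_multiple_of_colliding_third:
  assumes p: "prime p" and Q: "\<And>q. q \<in> Q \<Longrightarrow> prime q \<and> q \<le> N"
    and a: "\<not> int p dvd int a" and t: "\<not> int p dvd int a * int b - k" and b: "b \<le> B" and B: "B \<ge> 1"
    and size: "2 * (B * N ^ 2) < p"
  obtains U :: int where "U \<noteq> 0" "\<bar>U\<bar> < int p"
    "\<And>b' q q'. \<lbrakk>b' \<le> B; q \<in> Q; q' \<in> Q; q \<noteq> q'; collide p k a b q a b' q'\<rbrakk> \<Longrightarrow> int q dvd U"
proof (cases "\<exists>b' q q'. b' \<le> B \<and> q \<in> Q \<and> q' \<in> Q \<and> q \<noteq> q' \<and> collide p k a b q a b' q'")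
  case False
  show ?thesis
  proof (rule that[of 1])
    show "\<bar>1\<bar> < int p" using prime_gt_1_nat[OF p] by simp
  qed (use False in \<open>blast | simp\<close>)+
next
  case True
  have rel: "int p dvd k * (int q - int q') - int a * (int b' * int q - int b * int q')"
    if "collide p k a b q a b' q'" for q q' b'
  proof -
    have "int p dvd int a * (k * (int q - int q') - int a * (int b' * int q - int b * int q'))"
      using that unfolding collide_def by (simp add: algebra_simps)
    then show ?thesis using a int_prime_dvd_mult_iff[OF p] by blast
  qed
  obtain b0 q0 q0' where w: "b0 \<le> B" "q0 \<in> Q" "q0' \<in> Q" "q0 \<noteq> q0'" "collide p k a b q0 a b0 q0'"
    using True by blast
  define v0 where "v0 = int q0 - int q0'"
  define u0 where "u0 = int b0 * int q0 - int b * int q0'"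
  have ub: "\<bar>int b' * int q - int b * int q'\<bar> \<le> int (B * N)" if "b' \<le> B" "q \<in> Q" "q' \<in> Q" for b' q q'
    using that b Q by (intro abs_diff_prod_le) auto
  have vb: "\<bar>int q - int q'\<bar> \<le> int N" if "q \<in> Q" "q' \<in> Q" for q q'
    using Q[OF that(1)] Q[OF that(2)] by linarith
  have le: "\<bar>x * y\<bar> \<le> int (B * N ^ 2)" if "\<bar>x\<bar> \<le> int (B * N)" "\<bar>y\<bar> \<le> int N" for x y
  proof -
    have "\<bar>x * y\<bar> \<le> int (B * N) * int N" unfolding abs_mult using that by (intro mult_mono) auto
    then show ?thesis by (simp add: power2_eq_square mult_ac)
  qed
  have "N \<ge> 2" using Q[OF w(2)] prime_ge_2_nat le_trans by blast
  then have BN: "2 * (B * N) \<le> B * N ^ 2" by (simp add: power2_eq_square)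
  show ?thesis
  proof (rule that[of "int b * v0 - u0"])
    have rel0: "int p dvd k * v0 - int a * u0" using rel[OF w(5)] unfolding v0_def u0_def .
    show "int b * v0 - u0 \<noteq> 0"
    proof
      assume eq: "int b * v0 - u0 = 0"
      have "(int a * int b - k) * v0 = int a * (int b * v0 - u0) - (k * v0 - int a * u0)"
        by (simp add: algebra_simps)
      also have "int p dvd \<dots>" 
        using rel0 unfolding eq by (simp only: mult_zero_right diff_0 dvd_minus_iff)
      finally have "int p dvd (int a * int b - k) * v0" .
      then have "int p dvd v0" using t int_prime_dvd_mult_iff[OF p] by blast
      moreover have "v0 \<noteq> 0" using w(4) by (simp add: v0_def)
      ultimately have "\<bar>int p\<bar> \<le> \<bar>v0\<bar>" by (intro dvd_imp_le_int)
      also have "\<dots> \<le> int (1 * N)" using vb[OF w(2,3)] unfolding v0_def by simp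
      also have "\<dots> \<le> int (2 * (B * N))" unfolding of_nat_le_iff using B by (simp add: mult_le_cancel2 )
      finally show False using BN size by linarith
    qed
    have "\<bar>int b * v0\<bar> \<le> int (B * N)"
      unfolding abs_mult using b vb[OF w(2,3)] unfolding v0_def of_nat_mult by (intro mult_mono) auto
    then show "\<bar>int b * v0 - u0\<bar> < int p"
      using ub[OF w(1,2,3)] BN size unfolding u0_def by linarith
    fix b' q q' assume *: "b' \<le> B" "q \<in> Q" "q' \<in> Q" "q \<noteq> q'" "collide p k a b q a b' q'"
    define u where "u = int b' * int q - int b * int q'"
    define v where "v = int q - int q'"
    have "int p dvd (k * v0 - int a * u0) * v - (k * v - int a * u) * v0"
      unfolding u_def v_def by (rule dvd_diff[OF dvd_mult2[OF rel0] dvd_mult2[OF rel[OF *(5)]]])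
    also have "\<dots> = int a * (u * v0 - u0 * v)" by (simp add: algebra_simps)
    finally have "int p dvd u * v0 - u0 * v" using a int_prime_dvd_mult_iff[OF p] by blast
    moreover have "\<bar>u * v0\<bar> \<le> int (B * N ^ 2)" "\<bar>u0 * v\<bar> \<le> int (B * N ^ 2)"
      unfolding u_def u0_def v0_def v_def using * w by (intro le ub vb; simp)+
    ultimately have "u * v0 = u0 * v"
      using size by (intro int_eq_if_cong_small[of p _ _ "int (B * N ^ 2)"]) (linarith+)
    then have "int q' * (int b * v0 - u0) = int q * (int b' * v0 - u0)"
      unfolding u_def v_def by (simp add: algebra_simps)
    then have "int q dvd int q' * (int b * v0 - u0)" by simp
    moreover have "\<not> q dvd q'" using Q[OF *(2)] Q[OF *(3)] *(4) primes_dvd_imp_eq by blast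
    ultimately show "int q dvd int b * v0 - u0"
      using Q[OF *(2)] int_prime_dvd_mult_iff[of q "int q'"] by simp
  qed
qed

section \<open>Comparing biased short sums with the moment\<close>

lemma sum_shift_ge:
  fixes \<chi> :: "nat \<Rightarrow> int"
  assumes "\<And>n. \<bar>\<chi> n\<bar> \<le> 1"
  shows "(\<Sum>b=1..B. \<chi> (b + m)) \<ge> (\<Sum>b=1..B. \<chi> b) - 2 * int m"
proof (induction m)
  case 0
  then show ?case by simp
next
  case (Suc m)
  have "(\<Sum>b=1..B. \<chi> (b + m)) + \<chi> (Suc (B + m)) = \<chi> (Suc m) + (\<Sum>b=1..B. \<chi> (b + Suc m))"
  proof (induction B)
    case 0
    then show ?case by simp
  next
    case (Suc B)
    then show ?case by simp
  qed
  moreover have "\<chi> (Suc (B + m)) \<le> 1" "\<chi> (Suc m) \<ge> -1" "\<chi> (Suc m) \<le> 1" "\<chi> (Suc (B + m)) \<ge> -1"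
    using assms[of "Suc (B + m)"] assms[of "Suc m"] by (simp_all add: abs_le_iff)
  ultimately show ?case using Suc by simp
qed

text \<open>A pointwise substitute for Hoelder's inequality: above the threshold, x is at most x
  times (x / \<tau>) ^ n.\<close>

lemma le_threshold_plus_power:
  fixes x \<tau> :: real
  assumes "x \<ge> 0" "\<tau> > 0"
  shows "x \<le> \<tau> + x ^ Suc n / \<tau> ^ n"
proof (cases "x \<le> \<tau>")
  case True
  then show ?thesis using assms by (simp add: add_increasing2)
next
  case False
  then have "\<tau> ^ n \<le> x ^ n" using assms by (intro power_mono) auto
  then have "x * \<tau> ^ n \<le> x * x ^ n" using assms by (intro mult_left_mono) auto
  then have "x \<le> x ^ Suc n / \<tau> ^ n" using assms by (simp add: pos_le_divide_eq)
  then show ?thesis using assms by simp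
qed

lemma ex_residue_solution:
  assumes p: "prime p" and n: "\<not> int p dvd n"
  shows "\<exists>t\<in>{0..<int p}. int p dvd t * n - m"
proof -
  have "coprime n (int p)"
    using n p by (metis coprime_commute prime_imp_coprime prime_int_nat_transfer nat_int prime_nat_int_transfer)
  then obtain x where x: "[n * x = 1] (mod int p)" using cong_solve_coprime_int by blast
  define t where "t = (m * x) mod int p"
  have "[t = m * x] (mod int p)" by (simp add: t_def cong_def)
  then have "[t * n = m * x * n] (mod int p)" by (rule cong_scalar_right)
  also have "m * x * n = m * (n * x)" by (simp add: mult_ac)
  also have "[m * (n * x) = m * 1] (mod int p)" by (rule cong_scalar_left[OF x])
  finally have "int p dvd t * n - m" by (simp add: cong_iff_dvd_diff)
  moreover have "t \<in> {0..<int p}" using prime_gt_0_nat[OF p] by (simp add: t_def)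
  ultimately show ?thesis by blast
qed

text \<open>Deleting few triples makes the fractions \<open>t\<close> distinct, so the power moment over all residues
  bounds the one over the remaining triples.\<close>
lemma biased_sums_inequality:
  fixes W :: real
  assumes p: "prime p" "odd p" and k: "\<not> int p dvd k"
    and A: "\<And>a. a \<in> A \<Longrightarrow> prime a \<and> z \<le> a \<and> a \<le> M" and Q: "\<And>q. q \<in> Q \<Longrightarrow> prime q \<and> z \<le> q \<and> q \<le> N"
    and AQ: "A \<inter> Q = {}" and B: "B \<ge> 1" and size: "2 * (M ^ 3 * B * N ^ 2) < p"
    and small: "M < p" "N < p" "M \<ge> 1" and z: "z > 1" "p \<le> z ^ K"
    and hyp: "\<And>a n. a \<in> A \<Longrightarrow> 1 \<le> n \<Longrightarrow> n \<le> B + L * N \<Longrightarrow>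
      Legendre (int a * int n * (int a * int n - k)) (int p) = -1"
    and W: "W \<le> real_of_int (\<Sum>n=1..B. Legendre (int n) (int p))"
    and r: "r > 0" and \<tau>: "\<tau> > 0"
    and moment: "real_of_int (\<Sum>x\<in>{0..<int p}. (\<Sum>h\<in>{1..int L}. Legendre (x + h) (int p)) ^ (2 * r)) \<le> V"
  shows "real (card A * card Q) * real L * (W - 2 * real L * real N) \<le>
    real (card A * card Q) * real B * \<tau> + V / \<tau> ^ (2 * r - 1) + real L * real B * real K * (real (card A) + real (card Q))"
proof -
  define \<chi> where "\<chi> = (\<lambda>n. Legendre n (int p))"
  have finA: "finite A" using A by (intro finite_subset[of A "{..M}"]) auto
  have finQ: "finite Q" using Q by (intro finite_subset[of Q "{..N}"]) auto
  have ndvd: "\<not> int p dvd int x" if "0 < x" "x < p" for x using that by (auto dest: dvd_imp_le)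
  have ndA: "\<not> int p dvd int a" if "a \<in> A" for a
    using A[OF that] small(1) prime_gt_0_nat by (intro ndvd) auto
  have ndQ: "\<not> int p dvd int q" if "q \<in> Q" for q
    using Q[OF that] small(2) prime_gt_0_nat by (intro ndvd) auto
  have nd_hyp: "\<not> int p dvd int a * int n - k" if "a \<in> A" "1 \<le> n" "n \<le> B + L * N" for a n
  proof
    assume "int p dvd int a * int n - k"
    then have "Legendre (int a * int n * (int a * int n - k)) (int p) = 0"
      by (simp add: Legendre_eq_0_iff)
    with hyp[OF that] show False by simp
  qed
  define T where "T = A \<times> {1..B} \<times> Q"
  \<comment> \<open>This is (a b - k) / (a q) modulo p; adding h to it replaces b by b + h
    q.\<close>
  define t where "t = (\<lambda>(a, b, q). SOME t. t \<in> {0..<int p} \<and> int p dvd t * (int a * int q) - (int a * int b - k))"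
  have t: "t (a, b, q) \<in> {0..<int p}" "int p dvd t (a, b, q) * (int a * int q) - (int a * int b - k)"
    if "a \<in> A" "q \<in> Q" for a b q
  proof -
    have "\<not> int p dvd int a * int q" using ndA ndQ that int_prime_dvd_mult_iff[OF p(1)] by blast
    from ex_residue_solution[OF p(1) this] 
    have "\<exists>t. t \<in> {0..<int p} \<and> int p dvd t * (int a * int q) - (int a * int b - k)" by blast
    from someI_ex[OF this] show "t (a, b, q) \<in> {0..<int p}" 
      "int p dvd t (a, b, q) * (int a * int q) - (int a * int b - k)" by (simp_all add: t_def)
  qed
  define S where "S = (\<lambda>(a :: nat, b :: nat, q :: nat). \<bar>\<Sum>h\<in>{1..int L}. \<chi> (int b + h * int q)\<bar>)"
  have S: "S (a, b, q) = \<bar>\<Sum>h\<in>{1..int L}. \<chi> (t (a, b, q) + h)\<bar>" if "a \<in> A" "b \<in> {1..B}" "q \<in> Q" for a b q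
  proof -
    \<comment> \<open>At n = b + h q, \<open>hyp\<close> gives \<chi>(a n - k) = -\<chi>(a)
      \<chi>(n). As (t + h) a q = a n - k modulo p, all that remains is the sign -\<chi>(q), which
      does not depend on h.\<close>
    have "\<chi> (t (a, b, q) + h) = - \<chi> (int q) * \<chi> (int b + h * int q)" if h: "h \<in> {1..int L}" for h
    proof -
      define n where "n = b + nat h * q"
      have n: "int n = int b + h * int q" using h by (simp add: n_def)
      have "nat h * q \<le> L * N" using h Q[OF \<open>q \<in> Q\<close>] by (intro mult_le_mono) auto
      then have n_bd: "1 \<le> n" "n \<le> B + L * N" using \<open>b \<in> {1..B}\<close> by (auto simp: n_def)
      have h1: "\<chi> (int a) * \<chi> (int n) * \<chi> (int a * int n - k) = -1"
        using hyp[OF \<open>a \<in> A\<close> n_bd] unfolding \<chi>_def Legendre_mult[OF p] .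
      have "[(t (a, b, q) + h) * (int a * int q) = int a * int n - k] (mod int p)"
        using t(2)[OF \<open>a \<in> A\<close> \<open>q \<in> Q\<close>, of b] unfolding n cong_iff_dvd_diff by (simp add: algebra_simps)
      from Legendre_cong[OF this]
      have h2: "\<chi> (t (a, b, q) + h) * (\<chi> (int a) * \<chi> (int q)) = \<chi> (int a * int n - k)"
        unfolding \<chi>_def Legendre_mult[OF p] .
      have "\<chi> (int a) \<noteq> 0" "\<chi> (int q) \<noteq> 0"
        unfolding \<chi>_def Legendre_eq_0_iff using ndA ndQ \<open>a \<in> A\<close> \<open>q \<in> Q\<close> by auto
      moreover have "\<chi> x \<in> {-1, 0, 1}" for x unfolding \<chi>_def by (rule Legendre_values)
      from this[of "int a"] this[of "int q"] this[of "int n"] this[of "t (a, b, q) + h"] calculation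
      show ?thesis using h1 h2 unfolding n[symmetric] by auto
    qed
    then have "(\<Sum>h\<in>{1..int L}. \<chi> (t (a, b, q) + h)) = - \<chi> (int q) * (\<Sum>h\<in>{1..int L}. \<chi> (int b + h * int q))"
      by (simp add: sum_distrib_left)
    moreover have "\<bar>\<chi> (int q)\<bar> = 1"
      using Legendre_values[of "int q" "int p"] Legendre_eq_0_iff[of "int q" "int p"] ndQ[OF \<open>q \<in> Q\<close>]
      unfolding \<chi>_def by auto
    ultimately show ?thesis unfolding S_def by (simp add: abs_mult)
  qed
  have S_le: "S x \<le> int L" for x
  proof -
    obtain a b q where x: "x = (a, b, q)" by (cases x)
    have "\<bar>\<Sum>h\<in>{1..int L}. \<chi> (int b + h * int q)\<bar> \<le> (\<Sum>h\<in>{1..int L}. 1)"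
      by (rule order_trans[OF sum_abs]) (intro sum_mono, simp add: \<chi>_def abs_Legendre_le_1)
    then show ?thesis by (simp add: S_def x)
  qed
  \<comment> \<open>Discarded are all triples whose a meets a coincidence with another a' and, for
    each (a, b), those whose q meets one with another q' at the same a. Equal a and q force equal b,
    so \<open>t\<close> separates the remaining triples.\<close>
  define badA where "badA = {a \<in> A. \<exists>a' b b' q q'. a' \<in> A \<and> a \<noteq> a' \<and> b \<le> B \<and> b' \<le> B \<and> q \<in> Q \<and> q' \<in> Q \<and>
    collide p k a b q a' b' q'}"
  define badQ where "badQ = (\<lambda>(a, b). {q \<in> Q. \<exists>b' q'. b' \<le> B \<and> q' \<in> Q \<and> q \<noteq> q' \<and> collide p k a b q a b' q'})"
  have badA: "card badA \<le> K"
  proof -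
    obtain U :: int where "U \<noteq> 0" "\<bar>U\<bar> < int p" "\<And>a. a \<in> badA \<Longrightarrow> int a dvd U"
    proof (rule ex_common_multiple_of_colliding_first[OF p(1) k _ _ AQ B size])
      fix U :: int
      assume U: "U \<noteq> 0" "\<bar>U\<bar> < int p" "\<And>a a' b b' q q'. \<lbrakk>a \<in> A; a' \<in> A; a \<noteq> a'; b \<le> B; b' \<le> B; q \<in> Q; q' \<in> Q;
        collide p k a b q a' b' q'\<rbrakk> \<Longrightarrow> int a dvd U"
      show thesis using U(3) by (intro that[OF U(1,2)]) (auto simp: badA_def)
    qed (use A Q in auto)
    then have "card badA < K"
      using A finA by (intro card_prime_divisors_less[OF _ _ _ _ z]) (auto simp: badA_def)
    then show ?thesis by simp
  qed
  have badQ: "card (badQ (a, b)) \<le> K" if ab: "a \<in> A" "b \<in> {1..B}" for a b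
  proof -
    have "B * N ^ 2 \<le> M ^ 3 * B * N ^ 2" using small(3) by simp
    then have size': "2 * (B * N ^ 2) < p" using size by linarith
    have nd: "\<not> int p dvd int a * int b - k" using ab by (intro nd_hyp) auto
    obtain U :: int where "U \<noteq> 0" "\<bar>U\<bar> < int p" "\<And>q. q \<in> badQ (a, b) \<Longrightarrow> int q dvd U"
    proof (rule ex_common_multiple_of_colliding_third[OF p(1) _ ndA[OF ab(1)] nd _ B size'])
      fix U :: int
      assume U: "U \<noteq> 0" "\<bar>U\<bar> < int p" "\<And>b' q q'. \<lbrakk>b' \<le> B; q \<in> Q; q' \<in> Q; q \<noteq> q'; collide p k a b q a b' q'\<rbrakk>
        \<Longrightarrow> int q dvd U"
      show thesis using U(3) by (intro that[OF U(1,2)]) (auto simp: badQ_def)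
    qed (use ab Q in auto)
    then have "card (badQ (a, b)) < K"
      using Q finQ by (intro card_prime_divisors_less[OF _ _ _ _ z]) (auto simp: badQ_def)
    then show ?thesis by simp
  qed
  define D where "D = (badA \<times> {1..B} \<times> Q) \<union> (SIGMA a:A. SIGMA b:{1..B}. badQ (a, b))"
  have DT: "D \<subseteq> T" unfolding D_def T_def badA_def badQ_def by auto
  have finT: "finite T" using finA finQ by (simp add: T_def)
  have cardD: "card D \<le> K * (B * card Q) + card A * (B * K)"
  proof -
    have finb: "finite (badQ (a, b))" for a b using finQ by (simp add: badQ_def)
    have "card (SIGMA a:A. SIGMA b:{1..B}. badQ (a, b)) = (\<Sum>a\<in>A. \<Sum>b\<in>{1..B}. card (badQ (a, b)))"
      using finA finb by (subst card_SigmaI) (auto intro!: sum.cong card_SigmaI)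
    also have "\<dots> \<le> (\<Sum>a\<in>A. \<Sum>b\<in>{1..B}. K)" using badQ by (intro sum_mono) auto
    finally have "card (SIGMA a:A. SIGMA b:{1..B}. badQ (a, b)) \<le> card A * (B * K)" by simp
    moreover have "card (badA \<times> {1..B} \<times> Q) \<le> K * (B * card Q)"
      using badA by (simp add: card_cartesian_product)
    ultimately show ?thesis unfolding D_def by (meson add_mono card_Un_le order_trans)
  qed
  have inj: "inj_on t (T - D)"
  proof (rule inj_onI)
    fix x x' assume x: "x \<in> T - D" and x': "x' \<in> T - D" and eq: "t x = t x'"
    obtain a b q a' b' q' where xx: "x = (a, b, q)" "x' = (a', b', q')" by (cases x; cases x')
    have m: "a \<in> A" "b \<in> {1..B}" "q \<in> Q" "a' \<in> A" "b' \<in> {1..B}" "q' \<in> Q"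
      using x x' by (auto simp: xx T_def)
    have c: "collide p k a b q a' b' q'"
      using t(2)[OF m(1,3), of b] t(2)[OF m(4,6), of b'] eq unfolding xx
      by (intro collide_if_eq[of p "t (a, b, q)"]) simp_all
    have "a \<notin> badA" using x m by (auto simp: xx D_def)
    then have aa: "a = a'" using c m by (auto simp: badA_def)
    have "q \<notin> badQ (a, b)" using x m by (auto simp: xx D_def)
    then have qq: "q = q'" using c m aa by (auto simp: badQ_def)
    have "int p dvd int a * int a * (int q * (int b' - int b))"
      using c dvd_minus_iff[of "int p" "int a * int a * (int q * (int b' - int b))"]
      unfolding collide_def aa[symmetric] qq[symmetric] by (simp add: algebra_simps)
    then have d: "int p dvd int b' - int b" using ndA[OF m(1)] ndQ[OF m(3)] int_prime_dvd_mult_iff[OF p(1)] by blast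
    have "B * (2 * 1) \<le> B * (2 * (M ^ 3 * N ^ 2))"
    proof -
      have "N \<ge> 1" using Q[OF m(3)] prime_gt_0_nat[of q] by auto
      then show ?thesis using small(3) by (intro mult_le_mono2) simp
    qed
    also have "\<dots> = 2 * (M ^ 3 * B * N ^ 2)" by simp
    finally have "2 * int B < int p" using size by linarith
    then have "int b' = int b" using d m by (intro int_eq_if_cong_small[of p _ _ "int B"]) auto
    then show "x = x'" by (simp add: xx aa qq)
  qed
  have lower: "real (card A * card Q) * real L * (W - 2 * real L * real N) \<le> (\<Sum>x\<in>T. real_of_int (S x))"
  proof -
    \<comment> \<open>For fixed h the sum over b is the sum over [1, B] shifted by h q \<le> L N,
      which lowers it by at most 2 L N.\<close>
    have *: "real L * (W - 2 * real L * real N) \<le> (\<Sum>b\<in>{1..B}. real_of_int (S (a, b, q)))" if "q \<in> Q" for a q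
    proof -
      have "W - 2 * real L * real N \<le> real_of_int (\<Sum>b\<in>{1..B}. \<chi> (int b + h * int q))" if h: "h \<in> {1..int L}" for h
      proof -
        define m where "m = nat h * q"
        have "m \<le> L * N" using h Q[OF \<open>q \<in> Q\<close>] unfolding m_def by (intro mult_le_mono) auto
        then have mm: "real m \<le> real L * real N" by (metis of_nat_le_iff of_nat_mult)
        have "(\<Sum>b=1..B. \<chi> (int (b + m))) \<ge> (\<Sum>b=1..B. \<chi> (int b)) - 2 * int m"
          using sum_shift_ge[of "\<lambda>n. \<chi> (int n)" B m] by (simp add: \<chi>_def abs_Legendre_le_1)
        moreover have "int (b + m) = int b + h * int q" for b using h by (simp add: m_def)
        ultimately have "(\<Sum>b=1..B. \<chi> (int b + h * int q)) \<ge> (\<Sum>b=1..B. \<chi> (int b)) - 2 * int m" by simp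
        then have "real_of_int (\<Sum>b=1..B. \<chi> (int b + h * int q)) \<ge> real_of_int (\<Sum>b=1..B. \<chi> (int b)) - 2 * real m"
          by linarith
        then show ?thesis using W mm unfolding \<chi>_def by linarith
      qed
      then have "(\<Sum>h\<in>{1..int L}. W - 2 * real L * real N) \<le>
          (\<Sum>h\<in>{1..int L}. real_of_int (\<Sum>b\<in>{1..B}. \<chi> (int b + h * int q)))" by (rule sum_mono)
      also have "\<dots> = (\<Sum>b\<in>{1..B}. real_of_int (\<Sum>h\<in>{1..int L}. \<chi> (int b + h * int q)))"
        unfolding of_int_sum by (rule sum.swap)
      also have "\<dots> \<le> (\<Sum>b\<in>{1..B}. real_of_int (S (a, b, q)))"
        by (intro sum_mono) (simp only: S_def prod.case of_int_le_iff abs_ge_self)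
      finally show ?thesis by simp
    qed
    have "real (card A * card Q) * real L * (W - 2 * real L * real N) =
        (\<Sum>a\<in>A. \<Sum>q\<in>Q. real L * (W - 2 * real L * real N))" by simp
    also have "\<dots> \<le> (\<Sum>a\<in>A. \<Sum>q\<in>Q. \<Sum>b\<in>{1..B}. real_of_int (S (a, b, q)))"
      using * by (intro sum_mono) auto
    also have "\<dots> = (\<Sum>a\<in>A. \<Sum>b\<in>{1..B}. \<Sum>q\<in>Q. real_of_int (S (a, b, q)))"
      by (intro sum.cong refl sum.swap)
    also have "\<dots> = (\<Sum>x\<in>T. real_of_int (S x))" by (simp add: T_def sum.cartesian_product)
    finally show ?thesis .
  qed
  define n where "n = 2 * r - 1"
  have n: "Suc n = 2 * r" using r by (simp add: n_def)
  have "(\<Sum>x\<in>T. real_of_int (S x)) = (\<Sum>x\<in>T - D. real_of_int (S x)) + (\<Sum>x\<in>D. real_of_int (S x))"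
    by (rule sum.subset_diff[OF DT finT])
  also have "\<dots> \<le> (\<Sum>x\<in>T - D. \<tau> + real_of_int (S x) ^ Suc n / \<tau> ^ n) + (\<Sum>x\<in>D. real L)"
  proof (intro add_mono sum_mono)
    fix x show "real_of_int (S x) \<le> \<tau> + real_of_int (S x) ^ Suc n / \<tau> ^ n"
      using \<tau> by (intro le_threshold_plus_power) (auto simp: S_def split: prod.splits)
    show "real_of_int (S x) \<le> real L" using S_le[of x] by linarith
  qed
  also have "\<dots> = real (card (T - D)) * \<tau> + (\<Sum>x\<in>T - D. real_of_int (S x) ^ (2 * r)) / \<tau> ^ n + real (card D) * real L"
    by (simp add: sum.distrib sum_divide_distrib n del: power_Suc)
  also have "\<dots> \<le> real (card A * card Q) * real B * \<tau> + V / \<tau> ^ n + real (K * (B * card Q) + card A * (B * K)) * real L"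
  proof (intro add_mono mult_right_mono divide_right_mono)
    have "card (T - D) \<le> card T" using finT by (intro card_mono) auto
    also have "\<dots> = card A * card Q * B" by (simp add: T_def card_cartesian_product)
    finally have "real (card (T - D)) \<le> real (card A * card Q * B)" unfolding of_nat_le_iff .
    then show "real (card (T - D)) \<le> real (card A * card Q) * real B" by simp
    show "real (card D) \<le> real (K * (B * card Q) + card A * (B * K))" using cardD by (simp only: of_nat_le_iff)
    have "(\<Sum>x\<in>T - D. S x ^ (2 * r)) = (\<Sum>x\<in>T - D. (\<Sum>h\<in>{1..int L}. \<chi> (t x + h)) ^ (2 * r))"
    proof (rule sum.cong)
      fix x assume "x \<in> T - D"
      then obtain a b q where "x = (a, b, q)" "a \<in> A" "b \<in> {1..B}" "q \<in> Q" by (auto simp: T_def)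
      then show "S x ^ (2 * r) = (\<Sum>h\<in>{1..int L}. \<chi> (t x + h)) ^ (2 * r)"
        using S[of a b q] by (simp add: power_even_abs)
    qed simp
    also have "\<dots> = (\<Sum>x\<in>t ` (T - D). (\<Sum>h\<in>{1..int L}. \<chi> (x + h)) ^ (2 * r))"
      using inj by (simp add: sum.reindex)
    also have "\<dots> \<le> (\<Sum>x\<in>{0..<int p}. (\<Sum>h\<in>{1..int L}. \<chi> (x + h)) ^ (2 * r))"
      using t(1) by (intro sum_mono2) (auto simp: T_def zero_le_even_power)
    finally have "real_of_int (\<Sum>x\<in>T - D. S x ^ (2 * r)) \<le> V"
      using moment unfolding \<chi>_def by (meson of_int_le_iff order_trans)
    then show "(\<Sum>x\<in>T - D. real_of_int (S x) ^ (2 * r)) \<le> V" by simp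
  qed (use \<tau> in auto)
  finally show ?thesis using lower unfolding n_def by (simp add: algebra_simps)
qed

section \<open>Points on the hyperbola\<close>

text \<open>Otherwise squaring would be surjective on a finite set, hence injective, yet 1 and p - 1
  have the same square.\<close>

lemma ex_nonresidue:
  assumes p: "prime p" "odd p"
  shows "\<exists>n>0. n \<le> p \<and> \<not> QuadRes (int p) (int n)"
proof (rule ccontr)
  assume "\<not> (\<exists>n>0. n \<le> p \<and> \<not> QuadRes (int p) (int n))"
  then have res: "QuadRes (int p) (int n)" if "n > 0" "n \<le> p" for n using that by blast
  have p3: "p \<ge> 3" using p prime_ge_2_nat[of p] by (cases "p = 2") auto
  define sq where "sq = (\<lambda>x :: int. x ^ 2 mod int p)"
  have sub: "{0..<int p} \<subseteq> sq ` {0..<int p}"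
  proof
    fix n assume n: "n \<in> {0..<int p}"
    have "QuadRes (int p) n"
    proof (cases "n = 0")
      case True
      then show ?thesis unfolding QuadRes_def by (intro exI[of _ 0]) simp
    next
      case False
      with n res[of "nat n"] show ?thesis by auto
    qed
    then obtain y where "[y ^ 2 = n] (mod int p)" unfolding QuadRes_def by blast
    then have "n = sq (y mod int p)" using n unfolding sq_def cong_def by (simp add: power_mod)
    moreover have "y mod int p \<in> {0..<int p}" using p3 by simp
    ultimately show "n \<in> sq ` {0..<int p}" by blast
  qed
  have "sq ` {0..<int p} \<subseteq> {0..<int p}" using p3 by (auto simp: sq_def)
  with sub have "sq ` {0..<int p} = {0..<int p}" by blast
  then have inj: "inj_on sq {0..<int p}" by (intro eq_card_imp_inj_on) auto
  have "sq 1 = sq (int p - 1)"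
  proof -
    have "(int p - 1) ^ 2 - 1 ^ 2 = int p * (int p - 2)" by (simp add: power2_eq_square algebra_simps)
    then have "int p dvd (int p - 1) ^ 2 - 1 ^ 2" by (metis dvd_triv_left)
    then show ?thesis unfolding sq_def mod_eq_dvd_iff by (subst dvd_diff_commute)
  qed
  from inj_onD[OF inj this] have "1 = int p - 1" using p3 by simp
  with p3 show False by simp
qed

lemma least_nonresidue_le: "prime p \<Longrightarrow> odd p \<Longrightarrow> least_nonresidue p \<le> p"
proof -
  assume "prime p" "odd p"
  then obtain n where n: "n > 0 \<and> \<not> QuadRes (int p) (int n)" "n \<le> p" using ex_nonresidue by blast
  have "least_nonresidue p \<le> n" unfolding least_nonresidue_def by (rule Least_le) (rule n(1))
  with n(2) show ?thesis by simp
qed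

text \<open>Given x y = c, the equation (x + a) (y + b) = c multiplied by x becomes b x ^ 2 + a b x
  + a c = 0, solved by the quadratic formula. A double root is harmless: the two points differ by
  (a, b).\<close>

lemma ex_box_with_two_points:
  fixes a b :: nat
  assumes p: "prime p" "odd p" and c: "\<not> int p dvd c"
    and a: "1 \<le> a" "a < H" "a < p" and b: "1 \<le> b" "b < H" "b < p"
    and square: "Legendre (int a * int b * (int a * int b - 4 * c)) (int p) \<noteq> -1"
  shows "\<exists>X\<in>{0..<int p}. \<exists>Y\<in>{0..<int p}. card (modular_hyperbola p c \<inter> modular_box p X Y H) \<ge> 2"
proof -
  have p2: "p > 2" using p prime_ge_2_nat[of p] by (cases "p = 2") auto
  have ndvd: "\<not> int p dvd int x" if "0 < x" "x < p" for x using that by (auto dest: dvd_imp_le)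
  have nd: "\<not> int p dvd int a" "\<not> int p dvd int b" "\<not> int p dvd 2"
    using a b p2 ndvd[of 2] by (auto intro!: ndvd)
  note dvd_iff = int_prime_dvd_mult_iff[OF p(1)]
  obtain s where "[s ^ 2 = int a * int b * (int a * int b - 4 * c)] (mod int p)"
  proof (cases "int p dvd int a * int b * (int a * int b - 4 * c)")
    case True
    then show ?thesis by (intro that[of 0]) (simp add: cong_iff_dvd_diff)
  next
    case False
    then have "QuadRes (int p) (int a * int b * (int a * int b - 4 * c))"
      using square unfolding Legendre_def by (auto simp: cong_0_iff split: if_splits)
    then show ?thesis using that unfolding QuadRes_def by blast
  qed
  then have s: "int p dvd s ^ 2 - int a * int b * (int a * int b - 4 * c)" by (simp add: cong_iff_dvd_diff)
  have "\<not> int p dvd 2 * int b" using nd dvd_iff by blast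
  then obtain x where x: "x \<in> {0..<int p}" "int p dvd x * (2 * int b) - (s - int a * int b)"
    using ex_residue_solution[OF p(1)] by blast
  have "int p dvd (x * (2 * int b) - (s - int a * int b)) * (x * (2 * int b) + (s + int a * int b))
      + (s ^ 2 - int a * int b * (int a * int b - 4 * c))"
    by (intro dvd_add dvd_mult2 x s)
  also have "\<dots> = 2 * (2 * (int b * (int b * x ^ 2 + int a * int b * x + int a * c)))"
    by (simp add: power2_eq_square algebra_simps)
  finally have root: "int p dvd int b * x ^ 2 + int a * int b * x + int a * c"
    using nd dvd_iff by blast
  have ndx: "\<not> int p dvd x"
  proof
    assume "int p dvd x"
    then have "int p dvd int b * x ^ 2 + int a * int b * x" by (simp add: power2_eq_square)
    with root have "int p dvd int a * c" by (simp add: dvd_add_right_iff)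
    then show False using nd c dvd_iff by blast
  qed
  then obtain y where y: "y \<in> {0..<int p}" "int p dvd y * x - c"
    using ex_residue_solution[OF p(1)] by blast
  define x' where "x' = (x + int a) mod int p"
  define y' where "y' = (y + int b) mod int p"
  have "int p dvd (int b * x ^ 2 + int a * int b * x + int a * c) + (y * x - c) * (x + int a)"
    by (intro dvd_add dvd_mult2 root y)
  also have "\<dots> = x * ((x + int a) * (y + int b) - c)"
    by (simp add: power2_eq_square algebra_simps)
  finally have "int p dvd (x + int a) * (y + int b) - c" using ndx dvd_iff by blast
  then have "[x' * y' = c] (mod int p)"
    unfolding x'_def y'_def by (simp add: cong_iff_dvd_diff[symmetric] cong_def mod_mult_eq)
  moreover have "[x * y = c] (mod int p)" using y(2) by (simp add: cong_iff_dvd_diff mult.commute)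
  ultimately have hyp: "{(x, y), (x', y')} \<subseteq> modular_hyperbola p c"
    using x y p2 by (auto simp: modular_hyperbola_def x'_def y'_def)
  \<comment> \<open>Offsets in a box start at 1, so the two points get the offsets (1, 1) and (a +
    1, b + 1); this is why a, b < H.\<close>
  define X where "X = (x - 1) mod int p"
  define Y where "Y = (y - 1) mod int p"
  have XY: "[x = X + 1] (mod int p)" "[y = Y + 1] (mod int p)"
    "[x' = X + int (a + 1)] (mod int p)" "[y' = Y + int (b + 1)] (mod int p)"
  proof -
    have shift: "[w + i = (w - 1) mod int p + (i + 1)] (mod int p)" for w i :: int
      unfolding cong_def mod_add_left_eq by simp
    show "[x = X + 1] (mod int p)" "[y = Y + 1] (mod int p)"
      using shift[of x 0] shift[of y 0] by (simp_all add: X_def Y_def)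
    show "[x' = X + int (a + 1)] (mod int p)" "[y' = Y + int (b + 1)] (mod int p)"
      using shift[of x "int a"] shift[of y "int b"] by (simp_all add: X_def Y_def x'_def y'_def add.commute)
  qed
  have "(x, y) \<in> modular_box p X Y H"
    using x y XY(1,2) a unfolding modular_box_def by (auto intro!: bexI[of _ 1])
  moreover have "(x', y') \<in> modular_box p X Y H"
    unfolding modular_box_def mem_Collect_eq prod.case
  proof (intro conjI)
    show "x' \<in> {0..<int p}" "y' \<in> {0..<int p}" using p2 by (simp_all add: x'_def y'_def)
    show "\<exists>i\<in>{1..int H}. \<exists>j\<in>{1..int H}. [x' = X + i] (mod int p) \<and> [y' = Y + j] (mod int p)"
      using XY(3,4) a(2) b(2)
      by (intro bexI[where x = "int (b + 1)", THEN bexI[where x = "int (a + 1)"]] conjI) auto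
  qed
  ultimately have sub: "{(x, y), (x', y')} \<subseteq> modular_hyperbola p c \<inter> modular_box p X Y H"
    using hyp by blast
  have "x \<noteq> x'"
  proof
    assume "x = x'"
    then have "[x + int a = x + 0] (mod int p)" using x(1) unfolding x'_def cong_def by simp
    then show False using nd(1) by (simp add: cong_iff_dvd_diff)
  qed
  then have "card {(x, y), (x', y')} = 2" by simp
  moreover have "finite (modular_hyperbola p c \<inter> modular_box p X Y H)"
    by (rule finite_subset[of _ "{0..<int p} \<times> {0..<int p}"]) (auto simp: modular_hyperbola_def)
  ultimately have "card (modular_hyperbola p c \<inter> modular_box p X Y H) \<ge> 2"
    using card_mono[OF _ sub] by simp
  moreover have "X \<in> {0..<int p}" "Y \<in> {0..<int p}" using p2 by (simp_all add: X_def Y_def)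
  ultimately show ?thesis by blast
qed

section \<open>Comparing powers of p for large p\<close>

lemma eventually_powr_le:
  assumes "\<alpha> < \<beta>"
  shows "eventually (\<lambda>p::nat. C * real p powr \<alpha> \<le> real p powr \<beta>) sequentially"
proof -
  have "eventually (\<lambda>p::nat. C \<le> real p powr (\<beta> - \<alpha>)) sequentially"
    using eventually_ge_at_top[of "nat \<lceil>max C 1 powr (1 / (\<beta> - \<alpha>))\<rceil>"]
  proof eventually_elim
    case (elim p)
    have "C \<le> (max C 1 powr (1 / (\<beta> - \<alpha>))) powr (\<beta> - \<alpha>)"
      using assms by (simp add: powr_powr)
    also have "\<dots> \<le> real p powr (\<beta> - \<alpha>)"
      using elim assms unfolding nat_ceiling_le_eq by (intro powr_mono2) auto
    finally show ?case .
  qed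
  then show ?thesis
  proof eventually_elim
    case (elim p)
    then have "C * real p powr \<alpha> \<le> real p powr (\<beta> - \<alpha>) * real p powr \<alpha>" by (intro mult_right_mono) auto
    then show ?case by (simp flip: powr_add)
  qed
qed

lemma eventually_ln_le_powr:
  assumes "\<kappa> > 0"
  shows "eventually (\<lambda>p::nat. ln (real p) \<le> real p powr \<kappa>) sequentially"
proof -
  have "eventually (\<lambda>p::nat. (2 / \<kappa>) * real p powr (\<kappa> / 2) \<le> real p powr \<kappa>) sequentially"
    using assms by (intro eventually_powr_le) auto
  with eventually_gt_at_top[of 0] show ?thesis
  proof eventually_elim
    case (elim p)
    have "ln (real p powr (\<kappa> / 2)) \<le> real p powr (\<kappa> / 2)"
      using elim by (intro less_imp_le[OF ln_less_self]) auto
    then have "ln (real p) \<le> (2 / \<kappa>) * real p powr (\<kappa> / 2)"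
      using elim assms by (simp add: ln_powr field_simps)
    with elim show ?case by linarith
  qed
qed

text \<open>Of the loss p ^ \<kappa>, one half absorbs the logarithm in Chebyshev's bound and the
  other the constants. Dropping the primes up to u costs at most u, negligible as \<beta> < \<alpha>
  - \<kappa>.\<close>

lemma eventually_card_primes_ge:
  assumes \<kappa>: "\<kappa> > 0" and \<beta>: "0 \<le> \<beta>" "\<beta> < \<alpha> - \<kappa>"
  shows "eventually (\<lambda>p::nat. \<forall>n u. real p powr \<alpha> / 2 \<le> real n \<longrightarrow> n \<le> p \<longrightarrow> real u \<le> real p powr \<beta> + 1 \<longrightarrow>
    real p powr (\<alpha> - \<kappa>) \<le> real (card {q. prime q \<and> u < q \<and> q \<le> n})) sequentially"
proof -
  have ev: "eventually (\<lambda>p::nat. 64 * real p powr (\<alpha> - \<kappa>) \<le> real p powr (\<alpha> - \<kappa> / 2)) sequentially"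
     "eventually (\<lambda>p::nat. 3 * real p powr \<beta> \<le> real p powr (\<alpha> - \<kappa>)) sequentially"
     "eventually (\<lambda>p::nat. ln (real p) \<le> real p powr (\<kappa> / 2)) sequentially"
     "eventually (\<lambda>p::nat. 4 * real p powr 0 \<le> real p powr \<alpha>) sequentially"
    using \<kappa> \<beta> by (intro eventually_powr_le eventually_ln_le_powr; linarith)+
  show ?thesis
    using ev eventually_ge_at_top[of 3]
  proof eventually_elim
    case (elim p)
    have P: "real p \<ge> 3" using elim by simp
    show ?case
    proof (intro allI impI)
      fix n u :: nat
      assume n: "real p powr \<alpha> / 2 \<le> real n" "n \<le> p" and u: "real u \<le> real p powr \<beta> + 1"
      have "real n \<ge> 2" using n elim(4) P by simp
      then have n2: "n \<ge> 2" by simp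
      have lnn: "0 < ln (real n)" "ln (real n) \<le> real p powr (\<kappa> / 2)"
      proof -
        have "ln (real n) \<le> ln (real p)" using n n2 by (subst ln_le_cancel_iff) auto
        then show "ln (real n) \<le> real p powr (\<kappa> / 2)" using elim by simp
      qed (use n2 in auto)
      have "real n / 4 \<le> (real n - 1) * ln 2"
      proof -
        have "ln (1 / 2 :: real) \<le> 1 / 2 - 1" by (rule ln_le_minus_one) simp
        then have "ln 2 \<ge> (1 / 2 :: real)" by (simp add: ln_div)
        then show ?thesis using mult_mono[of "real n / 2" "real n - 1" "1 / 2" "ln 2 :: real"] n2 by simp
      qed
      also have "\<dots> \<le> (real (card {q. prime q \<and> q \<le> n}) + 1) * ln (real n)"
        using card_primes_ge[OF n2] by (simp add: algebra_simps)
      also have "\<dots> \<le> (real (card {q. prime q \<and> q \<le> n}) + 1) * real p powr (\<kappa> / 2)"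
        using lnn by (intro mult_left_mono) auto
      finally have "real p powr \<alpha> / 8 \<le> (real (card {q. prime q \<and> q \<le> n}) + 1) * real p powr (\<kappa> / 2)"
        using n by linarith
      moreover have "real p powr \<alpha> = real p powr (\<alpha> - \<kappa> / 2) * real p powr (\<kappa> / 2)"
        by (simp flip: powr_add)
      ultimately have "real p powr (\<alpha> - \<kappa> / 2) / 8 * real p powr (\<kappa> / 2) \<le>
          (real (card {q. prime q \<and> q \<le> n}) + 1) * real p powr (\<kappa> / 2)" by simp
      moreover have "real p powr (\<kappa> / 2) > 0" using P by simp
      ultimately have "real p powr (\<alpha> - \<kappa> / 2) / 8 \<le> real (card {q. prime q \<and> q \<le> n}) + 1"
        by (rule mult_right_le_imp_le)
      then have big: "8 * real p powr (\<alpha> - \<kappa>) - 1 \<le> real (card {q. prime q \<and> q \<le> n})"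
        using elim(1) by linarith
      have "card {q. prime q \<and> q \<le> n} \<le> card ({q. prime q \<and> u < q \<and> q \<le> n} \<union> {1..u})"
        by (intro card_mono) (auto simp: prime_ge_1_nat[simplified])
      also have "\<dots> \<le> card {q. prime q \<and> u < q \<and> q \<le> n} + u"
        using card_Un_le[of "{q. prime q \<and> u < q \<and> q \<le> n}" "{1..u}"] by simp
      finally have "real (card {q. prime q \<and> q \<le> n}) \<le> real (card {q. prime q \<and> u < q \<and> q \<le> n}) + real u"
        unfolding of_nat_add[symmetric] of_nat_le_iff .
      moreover have "real p powr \<beta> \<ge> 1" using P \<beta> by (simp add: ge_one_powr_ge_zero)
      ultimately show "real p powr (\<alpha> - \<kappa>) \<le> real (card {q. prime q \<and> u < q \<and> q \<le> n})"
        using big u elim(2) by linarith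
    qed
  qed
qed

section \<open>Rounded parameters and the final inequality\<close>

lemma nat_floor_bounds:
  fixes x :: real
  assumes "x \<ge> 2"
  shows "x / 2 \<le> real (nat \<lfloor>x\<rfloor>)" "real (nat \<lfloor>x\<rfloor>) \<le> x"
  using assms by linarith+

lemma nat_ceiling_bounds:
  fixes x :: real
  assumes "x \<ge> 0"
  shows "x \<le> real (nat \<lceil>x\<rceil>)" "real (nat \<lceil>x\<rceil>) \<le> x + 1"
  using assms by linarith+

text \<open>Here \<alpha> and \<beta> are the exponents of B and y. Of the margin 12 \<delta>, half
  absorbs the error 10 / ln y and half remains as mean value.\<close>

lemma Legendre_sum_ge_proportion:
  fixes P \<alpha> \<beta> \<delta> :: real
  assumes p: "prime p" "odd p" and y: "2 \<le> y" "y \<le> B" and B: "B < p"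
    and res: "\<And>n. 1 \<le> n \<Longrightarrow> n \<le> y \<Longrightarrow> Legendre (int n) (int p) = 1"
    and yP: "real p powr \<beta> \<le> real y" and BP: "real B \<le> real p powr \<alpha>" and \<beta>: "\<beta> > 0"
    and \<delta>: "12 * \<delta> = 1 - 2 * ln (\<alpha> / \<beta>)" and large: "10 / (\<beta> * ln (real p)) \<le> 6 * \<delta>"
  shows "6 * \<delta> * real B \<le> real_of_int (\<Sum>n=1..B. Legendre (int n) (int p))"
proof -
  have lnp: "ln (real p) > 0" using y B by simp
  have lny: "\<beta> * ln (real p) \<le> ln (real y)" "ln (real y) > 0"
  proof -
    have "ln (real p powr \<beta>) \<le> ln (real y)" using yP y B by (subst ln_le_cancel_iff) auto
    then show "\<beta> * ln (real p) \<le> ln (real y)" using y B by (simp add: ln_powr)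
  qed (use y in simp)
  have lnB: "ln (real B) \<le> \<alpha> * ln (real p)" "ln (real B) > 0"
  proof -
    have "ln (real B) \<le> ln (real p powr \<alpha>)" using BP y B by (subst ln_le_cancel_iff) auto
    then show "ln (real B) \<le> \<alpha> * ln (real p)" using y B by (simp add: ln_powr)
  qed (use y in simp)
  have "ln (real B) / ln (real y) \<le> (\<alpha> * ln (real p)) / (\<beta> * ln (real p))"
    using lny lnB lnp \<beta> by (intro frac_le) auto
  also have "\<dots> = \<alpha> / \<beta>" using lnp by simp
  finally have ratio: "ln (ln (real B) / ln (real y)) \<le> ln (\<alpha> / \<beta>)"
    using lny lnB by (intro ln_mono) auto
  have "5 / ln (real y) \<le> 5 / (\<beta> * ln (real p))" using lny lnp \<beta> by (intro divide_left_mono) auto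
  moreover have "10 / (\<beta> * ln (real p)) = 2 * (5 / (\<beta> * ln (real p)))" by simp
  ultimately have "6 * \<delta> \<le> 1 - 2 * (ln (ln (real B) / ln (real y)) + 5 / ln (real y))"
    using ratio large \<delta> by argo
  then have "real B * (6 * \<delta>) \<le> real B * (1 - 2 * (ln (ln (real B) / ln (real y)) + 5 / ln (real y)))"
    by (intro mult_left_mono) auto
  also have "\<dots> \<le> real_of_int (\<Sum>n=1..B. Legendre (int n) (int p))"
    by (rule Legendre_sum_ge_if_least_nonresidue_large[OF p y B res])
  finally show ?thesis by (simp add: mult_ac)
qed

text \<open>The threshold is \<tau> = \<delta> L. Of the mean 6 \<delta>, one \<delta> each goes to
  the shifts by h q, to the sums below the threshold and to the discarded triples; 3 \<delta> are
  left against the moment. By sqrt p \<le> (2 L) ^ r the even-fibre part of the moment is of the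
  order of the Weil part, so L ^ (2 r) cancels.\<close>

lemma biased_sums_bound:
  fixes \<delta> :: real
  assumes p: "prime p" "odd p" and k: "\<not> int p dvd k"
    and A: "\<And>a. a \<in> A \<Longrightarrow> prime a \<and> z \<le> a \<and> a \<le> M" and Q: "\<And>q. q \<in> Q \<Longrightarrow> prime q \<and> z \<le> q \<and> q \<le> N"
    and AQ: "A \<inter> Q = {}" and B: "B \<ge> 1" and size: "2 * (M ^ 3 * B * N ^ 2) < p"
    and small: "M < p" "N < p" "M \<ge> 1" "L < p" and z: "z > 1" "p \<le> z ^ 10"
    and hyp: "\<And>a n. a \<in> A \<Longrightarrow> 1 \<le> n \<Longrightarrow> n \<le> B + L * N \<Longrightarrow>
      Legendre (int a * int n * (int a * int n - k)) (int p) = -1"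
    and W: "6 * \<delta> * real B \<le> real_of_int (\<Sum>n=1..B. Legendre (int n) (int p))"
    and r: "r > 0" "p \<ge> 10 * r + 50" and \<delta>: "\<delta> > 0" and L: "L \<ge> 1" "sqrt (real p) \<le> (2 * real L) ^ r"
    and LN: "2 * real L * real N \<le> \<delta> * real B"
    and card: "20 / \<delta> \<le> real (card A)" "20 / \<delta> \<le> real (card Q)"
  shows "3 * \<delta> ^ (2 * r) * (real (card A) * real (card Q) * real B) \<le>
    (real (r ^ (2 * r)) * 2 ^ r + 38 * real r) * sqrt (real p)"
proof -
  define T where "T = real (card A) * real (card Q)"
  define V where "V = real (r ^ (2 * r)) * real L ^ r * real p + 38 * real r * sqrt (real p) * real L ^ (2 * r)"
  have T0: "T \<ge> 0" by (simp add: T_def)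
  have L0: "real L > 0" using L by simp
  have "real_of_int (\<Sum>x\<in>{0..<int p}. (\<Sum>h\<in>{1..int L}. Legendre (x + h) (int p)) ^ (2 * r)) \<le> V"
    unfolding V_def by (rule Legendre_moment_bound[OF p r(2,1) small(4)])
  from biased_sums_inequality[OF p k A Q AQ B size small(1-3) z hyp W r(1) _ this, of "\<delta> * real L"]
  have main: "T * real L * (6 * \<delta> * real B - 2 * real L * real N) \<le>
    T * real B * (\<delta> * real L) + V / (\<delta> * real L) ^ (2 * r - 1) + real L * real B * 10 * (real (card A) + real (card Q))"
    using \<delta> L0 by (simp add: T_def)
  have "T * real L * (5 * \<delta> * real B) \<le> T * real L * (6 * \<delta> * real B - 2 * real L * real N)"
    using T0 LN by (intro mult_left_mono) auto
  moreover have "real L * real B * 10 * (real (card A) + real (card Q)) \<le> real L * real B * (\<delta> * T)"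
  proof -
    have "20 \<le> \<delta> * real (card A)" "20 \<le> \<delta> * real (card Q)"
      using card \<delta> by (simp_all add: pos_divide_le_eq mult.commute)
    then have "20 * real (card Q) \<le> \<delta> * real (card A) * real (card Q)"
      "20 * real (card A) \<le> \<delta> * real (card Q) * real (card A)"
      by (intro mult_right_mono; simp)+
    then have "10 * (real (card A) + real (card Q)) \<le> \<delta> * T" by (simp add: T_def algebra_simps)
    then have "real L * real B * (10 * (real (card A) + real (card Q))) \<le> real L * real B * (\<delta> * T)"
      by (intro mult_left_mono) auto
    then show ?thesis by (simp add: mult_ac)
  qed
  ultimately have "3 * (T * real B) * (\<delta> * real L) \<le> V / (\<delta> * real L) ^ (2 * r - 1)"
    using main by (simp add: algebra_simps)
  then have "3 * (T * real B) * (\<delta> * real L) * (\<delta> * real L) ^ (2 * r - 1) \<le> V"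
    using \<delta> L0 by (simp add: pos_le_divide_eq)
  moreover have "(\<delta> * real L) * (\<delta> * real L) ^ (2 * r - 1) = (\<delta> * real L) ^ (2 * r)"
    using r(1) by (simp flip: power_Suc)
  ultimately have "3 * (T * real B) * (\<delta> ^ (2 * r) * real L ^ (2 * r)) \<le> V"
    by (simp only: mult.assoc flip: power_mult_distrib)
  also have "V \<le> ((real (r ^ (2 * r)) * 2 ^ r + 38 * real r) * sqrt (real p)) * real L ^ (2 * r)"
  proof -
    have "real L ^ r * real p = real L ^ r * (sqrt (real p) * sqrt (real p))" by simp
    also have "\<dots> \<le> real L ^ r * (sqrt (real p) * (2 * real L) ^ r)"
      using L by (intro mult_left_mono) auto
    also have "\<dots> = 2 ^ r * sqrt (real p) * real L ^ (2 * r)"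
    proof -
      have "real L ^ (2 * r) = real L ^ r * real L ^ r" by (simp add: mult_2 power_add)
      then show ?thesis by (simp add: power_mult_distrib mult_ac)
    qed
    finally have "real (r ^ (2 * r)) * (real L ^ r * real p) \<le> real (r ^ (2 * r)) * (2 ^ r * sqrt (real p) * real L ^ (2 * r))"
      by (intro mult_left_mono) auto
    then show ?thesis unfolding V_def by (simp add: algebra_simps)
  qed
  finally have "(3 * \<delta> ^ (2 * r) * (T * real B)) * real L ^ (2 * r) \<le>
      ((real (r ^ (2 * r)) * 2 ^ r + 38 * real r) * sqrt (real p)) * real L ^ (2 * r)"
    by (simp only: mult_ac)
  then have "3 * \<delta> ^ (2 * r) * (T * real B) \<le> (real (r ^ (2 * r)) * 2 ^ r + 38 * real r) * sqrt (real p)"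
    using L0 by (simp only: mult_le_cancel_right_pos zero_less_power)
  then show ?thesis by (simp add: T_def)
qed

text \<open>The exponents of B, M, N, L are \<beta>, \<alpha>, \<theta>, \<eta>. They satisfy 3
  \<alpha> + \<beta> + 2 \<theta> = 1 - \<epsilon> / 2, for \<open>size\<close>; (\<alpha> - \<eta>)
  + (\<theta> - \<eta>) + \<beta> = 1/2 + 7 \<epsilon> / 12, for the contradiction; and \<theta> +
  \<eta> < \<beta>, for shifts short against B.\<close>

lemma eventually_ex_not_minus_one:
  fixes \<epsilon> :: real
  assumes \<epsilon>: "0 < \<epsilon>" "\<epsilon> \<le> 1 / 100"
  shows "eventually (\<lambda>p::nat. prime p \<longrightarrow> odd p \<longrightarrow> (\<forall>c (H::nat). \<not> int p dvd c \<longrightarrow>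
      real p powr (1 / 6 + \<epsilon>) \<le> real H \<longrightarrow>
      (\<forall>n. 1 \<le> n \<longrightarrow> real n \<le> real p powr (1 / (6 * sqrt (exp 1)) + \<epsilon>) \<longrightarrow> Legendre (int n) (int p) = 1) \<longrightarrow>
      (\<exists>a b. 1 \<le> a \<and> a < H \<and> a < p \<and> 1 \<le> b \<and> b < H \<and> b < p \<and>
        Legendre (int a * int b * (int a * int b - 4 * c)) (int p) \<noteq> -1))) sequentially"
proof -
  define s where "s = sqrt (exp 1 :: real)"
  have s: "s > 1" "ln s = 1 / 2" by (simp_all add: s_def ln_sqrt)
  define \<gamma> where "\<gamma> = 1 / (6 * s) + \<epsilon>"
  define \<beta> where "\<beta> = 1 / 6 + \<epsilon>"
  define \<alpha> where "\<alpha> = 1 / 6 - \<epsilon>"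
  define \<theta> where "\<theta> = 1 / 6 + 3 / 4 * \<epsilon>"
  define \<eta> where "\<eta> = \<epsilon> / 12"
  have \<gamma>: "0 < \<gamma>" "\<gamma> < \<beta>" "\<beta> < \<gamma> * s"
  proof -
    show "0 < \<gamma>" using \<epsilon> s by (simp add: \<gamma>_def add_pos_pos)
    show "\<gamma> < \<beta>" using s by (simp add: \<gamma>_def \<beta>_def field_simps)
    have "\<epsilon> * 1 < \<epsilon> * s" using \<epsilon> s by (intro mult_strict_left_mono) auto
    moreover have "\<gamma> * s = 1 / 6 + \<epsilon> * s" using s by (simp add: \<gamma>_def distrib_right)
    ultimately show "\<beta> < \<gamma> * s" by (simp add: \<beta>_def)
  qed
  \<comment> \<open>Any number strictly between \<beta> / \<gamma> and sqrt e would do: the upper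
    bound gives \<delta> > 0, and the lower one puts \<gamma>' below \<gamma>, which leaves room for
    rounding y up.\<close>
  define \<rho> where "\<rho> = (\<beta> / \<gamma> + s) / 2"
  have \<rho>: "\<beta> / \<gamma> < \<rho>" "\<rho> < s" "1 < \<beta> / \<gamma>"
  proof -
    have "\<beta> / \<gamma> < s" using \<gamma> by (simp add: pos_divide_less_eq mult.commute)
    moreover have "x < (x + y) / 2" "(x + y) / 2 < y" if "x < y" for x y :: real
      using that by simp_all
    ultimately show "\<beta> / \<gamma> < \<rho>" "\<rho> < s" unfolding \<rho>_def by blast+
    show "1 < \<beta> / \<gamma>" using \<gamma> by simp
  qed
  have \<rho>1: "\<rho> > 1" using \<rho> by linarith
  define \<gamma>' where "\<gamma>' = \<beta> / \<rho>"
  have \<gamma>': "0 < \<gamma>'" "\<gamma>' < \<gamma>" "\<gamma>' < \<beta>" "\<beta> / \<gamma>' = \<rho>"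
  proof -
    have "\<beta> > 0" using \<gamma> by linarith
    then show "0 < \<gamma>'" "\<gamma>' < \<beta>" "\<beta> / \<gamma>' = \<rho>" using \<rho>1 by (simp_all add: \<gamma>'_def pos_divide_less_eq)
    show "\<gamma>' < \<gamma>" using \<rho>(1) \<gamma>(1) \<rho>1 by (simp add: \<gamma>'_def pos_divide_less_eq mult.commute)
  qed
  define \<delta> where "\<delta> = (1 - 2 * ln \<rho>) / 12"
  have \<delta>: "0 < \<delta>" "\<delta> \<le> 1" "12 * \<delta> = 1 - 2 * ln (\<beta> / \<gamma>')"
  proof -
    have "ln \<rho> < ln s" using \<rho> \<rho>1 by simp
    then show "0 < \<delta>" using s by (simp add: \<delta>_def)
    have "ln \<rho> > 0" using \<rho>1 by simp
    then show "\<delta> \<le> 1" by (simp add: \<delta>_def)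
    show "12 * \<delta> = 1 - 2 * ln (\<beta> / \<gamma>')" by (simp add: \<delta>_def \<gamma>')
  qed
  \<comment> \<open>As L is about p ^ \<eta>, this makes (2 L) ^ r exceed sqrt p, with r depending
    only on \<epsilon>.\<close>
  define r where "r = nat \<lceil>1 / \<eta>\<rceil>"
  have \<eta>: "\<eta> > 0" using \<epsilon> by (simp add: \<eta>_def)
  have "real r \<ge> 1 / \<eta>" unfolding r_def by linarith
  then have r: "real r * \<eta> \<ge> 1" "r > 0" using \<eta> by (auto simp: pos_divide_le_eq intro!: Nat.gr0I)
  define C where "C = real (r ^ (2 * r)) * 2 ^ r + 38 * real r"
  have le: "eventually (\<lambda>p::nat. D * real p powr \<mu> \<le> real p powr \<nu>) sequentially" if "\<mu> < \<nu>" for D \<mu> \<nu>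
    using that by (rule eventually_powr_le)
  have "\<alpha> > 1 / 10 + \<eta>" "\<theta> - \<eta> > \<alpha>" "\<theta> > \<alpha>" "\<beta> > \<theta> + \<eta>" "\<beta> < 1 / 2" "\<eta> < 1 / 2" "\<gamma>' < 1 / 2"
    using \<epsilon> \<gamma>' by (simp_all add: \<alpha>_def \<theta>_def \<beta>_def \<eta>_def)
  note exps = this
  have ev: "eventually (\<lambda>p::nat. 2 * real p powr 0 \<le> real p powr \<eta>) sequentially"
    "eventually (\<lambda>p::nat. 4 * real p powr (1 / 10) \<le> real p powr \<alpha>) sequentially"
    "eventually (\<lambda>p::nat. 2 * real p powr 0 \<le> real p powr (1 / 10)) sequentially"
    "eventually (\<lambda>p::nat. 2 * real p powr (1 - \<epsilon> / 2) \<le> real p powr 1) sequentially"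
    "eventually (\<lambda>p::nat. (8 / \<delta>) * real p powr (\<theta> + \<eta>) \<le> real p powr \<beta>) sequentially"
    "eventually (\<lambda>p::nat. (20 / \<delta>) * real p powr 0 \<le> real p powr (\<alpha> - \<eta>)) sequentially"
    "eventually (\<lambda>p::nat. (20 / \<delta>) * real p powr 0 \<le> real p powr (\<theta> - \<eta>)) sequentially"
    "eventually (\<lambda>p::nat. (4 * (C + 1) / (3 * \<delta> ^ (2 * r))) * real p powr (1 / 2) \<le>
      real p powr ((\<alpha> - \<eta>) + (\<theta> - \<eta>) + \<beta>)) sequentially"
    "eventually (\<lambda>p::nat. 2 * real p powr \<gamma>' \<le> real p powr \<gamma>) sequentially"
    "eventually (\<lambda>p::nat. 8 * real p powr \<gamma>' \<le> real p powr \<beta>) sequentially"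
    "eventually (\<lambda>p::nat. 2 * real p powr 0 \<le> real p powr \<gamma>') sequentially"
    "eventually (\<lambda>p::nat. 2 * real p powr (1 / 2) \<le> real p powr 1) sequentially"
    "eventually (\<lambda>p::nat. 2 * real p powr \<alpha> \<le> real p powr \<theta>) sequentially"
    using exps \<epsilon> \<gamma>' \<eta> by (intro le; simp add: \<alpha>_def \<theta>_def \<beta>_def \<eta>_def)+
  have evA: "eventually (\<lambda>p::nat. \<forall>n u. real p powr \<alpha> / 2 \<le> real n \<longrightarrow> n \<le> p \<longrightarrow> real u \<le> real p powr (1 / 10) + 1 \<longrightarrow>
    real p powr (\<alpha> - \<eta>) \<le> real (card {q. prime q \<and> u < q \<and> q \<le> n})) sequentially"
    using exps \<eta> by (intro eventually_card_primes_ge) auto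
  have evQ: "eventually (\<lambda>p::nat. \<forall>n u. real p powr \<theta> / 2 \<le> real n \<longrightarrow> n \<le> p \<longrightarrow> real u \<le> real p powr \<alpha> + 1 \<longrightarrow>
    real p powr (\<theta> - \<eta>) \<le> real (card {q. prime q \<and> u < q \<and> q \<le> n})) sequentially"
    using exps \<eta> by (intro eventually_card_primes_ge) auto
  show ?thesis
    using ev evA evQ eventually_ge_at_top[of "nat \<lceil>exp (10 / (6 * \<delta> * \<gamma>'))\<rceil>"] eventually_ge_at_top[of "10 * r + 50"]
  proof eventually_elim
    case (elim p)
    define P where "P = real p"
    note E = elim[folded P_def]
    have P: "P \<ge> 60" using elim(17) r(2) by (simp add: P_def)
    have mono: "P powr \<mu> \<le> P powr \<nu>" if "\<mu> \<le> \<nu>" for \<mu> \<nu> using that P by (intro powr_mono) auto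
    have P0: "P powr 0 = 1" "P powr 1 = P" using P by simp_all
    define L where "L = nat \<lfloor>P powr \<eta>\<rfloor>"
    define M where "M = nat \<lfloor>P powr \<alpha>\<rfloor>"
    define N where "N = nat \<lfloor>P powr \<theta>\<rfloor>"
    \<comment> \<open>Half of p ^ \<beta>, because n runs up to B + L N < 2 B, which must stay below
      H.\<close>
    define B where "B = nat \<lfloor>P powr \<beta> / 2\<rfloor>"
    \<comment> \<open>Fewer than ten primes of this size can divide a nonzero integer below
      p.\<close>
    define z where "z = nat \<lceil>P powr (1 / 10)\<rceil>"
    define y where "y = nat \<lceil>P powr \<gamma>'\<rceil>"
    have L: "P powr \<eta> / 2 \<le> real L" "real L \<le> P powr \<eta>"
      unfolding L_def using E(1) P0 by (intro nat_floor_bounds; simp)+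
    have M: "P powr \<alpha> / 2 \<le> real M" "real M \<le> P powr \<alpha>"
      unfolding M_def using E(2,3) P0 by (intro nat_floor_bounds; simp)+
    have N: "P powr \<theta> / 2 \<le> real N" "real N \<le> P powr \<theta>"
      unfolding N_def using E(2,3,13) P0 by (intro nat_floor_bounds; simp)+
    have B: "P powr \<beta> / 4 \<le> real B" "real B \<le> P powr \<beta> / 2"
      using nat_floor_bounds[of "P powr \<beta> / 2"] E(10,11) P0 unfolding B_def by auto
    have z: "P powr (1 / 10) \<le> real z" "real z \<le> P powr (1 / 10) + 1"
      unfolding z_def by (intro nat_ceiling_bounds; simp)+
    have y: "P powr \<gamma>' \<le> real y" "real y \<le> P powr \<gamma>' + 1"
      unfolding y_def by (intro nat_ceiling_bounds; simp)+
    have half: "P powr \<mu> \<le> P / 2" if "\<mu> \<le> 1 / 2" for \<mu>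
      using mono[OF that] E(12) P0 by simp
    have B1: "real B \<ge> 1" "real N \<ge> 1" "real M \<ge> 1" "real L \<ge> 1"
      using B(1) N(1) M(1) L(1) E(1,2,3,10,11,13) P0 by linarith+
    show ?case
    proof (intro impI allI, rule ccontr)
      fix c and H :: nat
      assume p: "prime p" "odd p" and c: "\<not> int p dvd c" and H: "real p powr (1 / 6 + \<epsilon>) \<le> real H"
        and res: "\<forall>n. 1 \<le> n \<longrightarrow> real n \<le> real p powr (1 / (6 * sqrt (exp 1)) + \<epsilon>) \<longrightarrow> Legendre (int n) (int p) = 1"
        and none: "\<not> (\<exists>a b. 1 \<le> a \<and> a < H \<and> a < p \<and> 1 \<le> b \<and> b < H \<and> b < p \<and>
          Legendre (int a * int b * (int a * int b - 4 * c)) (int p) \<noteq> -1)"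
      have res': "Legendre (int n) (int p) = 1" if "1 \<le> n" "n \<le> y" for n
      proof -
        have "real n \<le> P powr \<gamma>" using that(2) y(2) E(9,11) P0 by simp
        with res that show ?thesis by (simp add: \<gamma>_def s_def P_def)
      qed
      have H': "P powr \<beta> \<le> real H" using H by (simp add: P_def \<beta>_def)
      have k: "\<not> int p dvd 4 * c"
      proof -
        have "p > 2" using P by (simp add: P_def)
        then have "\<not> int p dvd 2" using zdvd_imp_le[of "int p" 2] by auto
        then have "\<not> int p dvd 2 * (2 * c)" using c int_prime_dvd_mult_iff[OF p(1)] by blast
        then show ?thesis by simp
      qed
      have y2: "2 \<le> y" "y \<le> B" using y E(10,11) B(1) P0 by linarith+
      have ltp: "B < p" "M < p" "N < p" "L < p"
        using B(2) M(2) N(2) L(2) half[of \<beta>] half[of \<alpha>] half[of \<theta>] half[of \<eta>] exps \<eta> P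
        unfolding P_def by linarith+
      have W: "6 * \<delta> * real B \<le> real_of_int (\<Sum>n=1..B. Legendre (int n) (int p))"
      proof (rule Legendre_sum_ge_proportion[OF p y2 ltp(1) res' y(1)[unfolded P_def] _ \<gamma>'(1) \<delta>(3)])
        show "real B \<le> real p powr \<beta>" using B(2) P by (simp add: P_def)
        have "exp (10 / (6 * \<delta> * \<gamma>')) \<le> P" using elim(16) by (simp add: nat_ceiling_le_eq P_def)
        then have "10 / (6 * \<delta> * \<gamma>') \<le> ln P" using P by (subst ln_ge_iff) auto
        moreover have "0 < 6 * \<delta> * \<gamma>'" using \<delta>(1) \<gamma>'(1) by simp
        ultimately have "10 \<le> ln P * (6 * \<delta> * \<gamma>')" by (simp only: pos_divide_le_eq)
        then have "10 \<le> 6 * \<delta> * (\<gamma>' * ln P)" by (simp only: mult_ac)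
        moreover have "0 < \<gamma>' * ln P" using \<gamma>'(1) P by simp
        ultimately have "10 / (\<gamma>' * ln P) \<le> 6 * \<delta>" by (simp only: pos_divide_le_eq)
        then show "10 / (\<gamma>' * ln (real p)) \<le> 6 * \<delta>" by (simp only: P_def)
      qed
      have LN: "2 * real L * real N \<le> \<delta> * real B"
      proof -
        have "real L * real N \<le> P powr \<eta> * P powr \<theta>" using L N by (intro mult_mono) auto
        also have "\<dots> = P powr (\<theta> + \<eta>)" by (simp add: powr_add mult.commute)
        also have "\<dots> \<le> \<delta> * (P powr \<beta> / 8)" using E(5) \<delta>(1) by (simp add: field_simps)
        finally have "2 * real L * real N \<le> \<delta> * (P powr \<beta> / 4)" by simp
        also have "\<dots> \<le> \<delta> * real B" using B(1) \<delta>(1) by (intro mult_left_mono) auto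
        finally show ?thesis .
      qed
      define A where "A = {a. prime a \<and> z < a \<and> a \<le> M}"
      define Q where "Q = {q. prime q \<and> M < q \<and> q \<le> N}"
      have cardA: "P powr (\<alpha> - \<eta>) \<le> real (card A)"
        unfolding A_def using M(1) z(2) ltp(2) elim(14) by (simp add: P_def)
      have cardQ: "P powr (\<theta> - \<eta>) \<le> real (card Q)"
        unfolding Q_def using N(1) M(2) ltp(3) elim(15) by (simp add: P_def)
      have zM: "z \<le> M" using z(2) M(1) E(2,3) P0 by simp
      have size: "2 * (M ^ 3 * B * N ^ 2) < p"
      proof -
        have "real M ^ 3 \<le> (P powr \<alpha>) ^ 3" "real N ^ 2 \<le> (P powr \<theta>) ^ 2"
          using M N by (intro power_mono; simp)+
        then have "real M ^ 3 * real B * real N ^ 2 \<le> (P powr \<alpha>) ^ 3 * (P powr \<beta> / 2) * (P powr \<theta>) ^ 2"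
          using B by (intro mult_mono) auto
        also have "\<dots> = P powr (3 * \<alpha> + \<beta> + 2 * \<theta>) / 2"
          using P by (simp add: powr_add powr_power mult.commute)
        also have "3 * \<alpha> + \<beta> + 2 * \<theta> = 1 - \<epsilon> / 2" by (simp add: \<alpha>_def \<beta>_def \<theta>_def)
        finally have "2 * (real M ^ 3 * real B * real N ^ 2) \<le> P powr (1 - \<epsilon> / 2)" by simp
        also have "\<dots> < P" using E(4) P0 P by simp
        finally have "real (2 * (M ^ 3 * B * N ^ 2)) < real p" by (simp add: P_def)
        then show ?thesis by (simp only: of_nat_less_iff)
      qed
      have hyp: "Legendre (int a * int n * (int a * int n - 4 * c)) (int p) = -1"
        if "a \<in> A" "1 \<le> n" "n \<le> B + L * N" for a n
      proof -
        have "real n \<le> real B + real L * real N" using that(3) by (metis of_nat_add of_nat_le_iff of_nat_mult)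
        moreover have "\<delta> * real B \<le> 1 * real B" using \<delta>(2) by (intro mult_right_mono) auto
        ultimately have "real n < 2 * real B" using LN B1 by linarith
        then have n: "real n < P powr \<beta>" using B(2) by linarith
        have a: "1 \<le> a" "real a < P powr \<beta>"
        proof -
          show "1 \<le> a" using that(1) by (simp add: A_def prime_ge_1_nat)
          have "real a \<le> P powr \<alpha>" using that(1) M(2) by (simp add: A_def)
          moreover have "P powr \<theta> \<le> P powr \<beta>" using exps \<eta> by (intro mono) auto
          moreover have "P powr \<alpha> > 0" using P by simp
          ultimately show "real a < P powr \<beta>" using E(13) by linarith
        qed
        have "P powr \<beta> < P" using half[of \<beta>] exps P by simp
        then have "a < H" "n < H" "a < p" "n < p" using a(2) n H' unfolding P_def by linarith+
        with none a(1) that(2) show ?thesis by blast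
      qed
      have "3 * \<delta> ^ (2 * r) * (real (card A) * real (card Q) * real B) \<le> C * sqrt (real p)"
        unfolding C_def
      proof (rule biased_sums_bound[OF p k _ _ _ _ size ltp(2,3) _ ltp(4) _ _ hyp W r(2) elim(17) \<delta>(1) _ _ LN])
        show "prime a \<and> z \<le> a \<and> a \<le> M" if "a \<in> A" for a using that by (simp add: A_def)
        show "prime q \<and> z \<le> q \<and> q \<le> N" if "q \<in> Q" for q using that zM by (simp add: Q_def)
        show "A \<inter> Q = {}" by (auto simp: A_def Q_def)
        show "1 \<le> B" "1 \<le> M" "1 \<le> L" using B1 by simp_all
        show "1 < z" using z(1) E(3) P0 by simp
        have "P = (P powr (1 / 10)) ^ 10" using P by (simp add: powr_power)
        also have "\<dots> \<le> real z ^ 10" using z(1) by (intro power_mono) auto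
        finally have "real p \<le> real (z ^ 10)" by (simp add: P_def)
        then show "p \<le> z ^ 10" by (simp only: of_nat_le_iff)
        show "20 / \<delta> \<le> real (card A)" "20 / \<delta> \<le> real (card Q)" using cardA cardQ E(6,7) P0 by simp_all
        have "sqrt P = P powr (1 / 2)" using P by (simp add: powr_half_sqrt)
        also have "\<dots> \<le> P powr (\<eta> * real r)" using r(1) by (intro mono) (simp add: mult.commute)
        also have "\<dots> = (P powr \<eta>) ^ r" using P by (simp add: powr_power mult.commute)
        also have "\<dots> \<le> (2 * real L) ^ r" using L(1) by (intro power_mono) auto
        finally show "sqrt (real p) \<le> (2 * real L) ^ r" by (simp add: P_def)
      qed
      moreover have "P powr (\<alpha> - \<eta>) * P powr (\<theta> - \<eta>) * (P powr \<beta> / 4) \<le> real (card A) * real (card Q) * real B"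
        using cardA cardQ B(1) by (intro mult_mono) auto
      then have "3 * \<delta> ^ (2 * r) * (P powr (\<alpha> - \<eta>) * P powr (\<theta> - \<eta>) * (P powr \<beta> / 4)) \<le>
          3 * \<delta> ^ (2 * r) * (real (card A) * real (card Q) * real B)"
        using \<delta>(1) by (intro mult_left_mono) auto
      \<comment> \<open>The spare 1 in C + 1 makes the two estimates contradict each other.\<close>
      moreover have "(C + 1) * P powr (1 / 2) \<le> 3 * \<delta> ^ (2 * r) * (P powr (\<alpha> - \<eta>) * P powr (\<theta> - \<eta>) * (P powr \<beta> / 4))"
      proof -
        have "4 * (C + 1) * P powr (1 / 2) \<le> 3 * \<delta> ^ (2 * r) * P powr ((\<alpha> - \<eta>) + (\<theta> - \<eta>) + \<beta>)"
          using E(8) \<delta>(1) by (simp add: pos_divide_le_eq mult_ac)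
        then show ?thesis unfolding powr_add by (simp add: algebra_simps)
      qed
      moreover have "C * sqrt (real p) = C * P powr (1 / 2)" using P by (simp add: powr_half_sqrt P_def)
      ultimately have "(C + 1) * P powr (1 / 2) \<le> C * P powr (1 / 2)" by linarith
      then have "P powr (1 / 2) \<le> 0" by (simp add: algebra_simps)
      then show False using P by simp
    qed
  qed
qed

theorem theorem3:
  shows "\<forall>\<epsilon>::real. \<epsilon> > 0 \<longrightarrow> (\<exists>C::real. C > 0 \<and>
    (\<forall>p::nat. prime p \<and> odd p \<longrightarrow>
      real (least_nonresidue p) \<le> C * real p powr (1 / (6 * sqrt (exp 1)) + \<epsilon>) \<or>
      (\<forall>(c::int) (H::nat). gcd c (int p) = 1 \<and> H > 0 \<and>
          real H \<ge> C * real p powr (1 / 6 + \<epsilon>) \<longrightarrow>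
        (\<exists>X\<in>{0..<int p}. \<exists>Y\<in>{0..<int p}.
          card (modular_hyperbola p c \<inter> modular_box p X Y H) \<ge> 2))))"
proof (intro allI impI)
  fix \<epsilon> :: real
  assume "\<epsilon> > 0"
  \<comment> \<open>The exponents above fit only for small \<epsilon>; the claim for e \<le>
    \<epsilon> implies the one for \<epsilon>, as p > 1.\<close>
  define e where "e = min \<epsilon> (1 / 100)"
  have e: "0 < e" "e \<le> 1 / 100" "e \<le> \<epsilon>" using \<open>\<epsilon> > 0\<close> by (auto simp: e_def)
  define g where "g = 1 / (6 * sqrt (exp 1 :: real))"
  have g: "0 < g" "g < 1 / 6" by (simp_all add: g_def field_simps)
  obtain p0 where p0: "\<And>p. \<lbrakk>p \<ge> p0; prime p; odd p\<rbrakk> \<Longrightarrow> \<forall>c (H::nat). \<not> int p dvd c \<longrightarrow>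
      real p powr (1 / 6 + e) \<le> real H \<longrightarrow>
      (\<forall>n. 1 \<le> n \<longrightarrow> real n \<le> real p powr (g + e) \<longrightarrow> Legendre (int n) (int p) = 1) \<longrightarrow>
      (\<exists>a b. 1 \<le> a \<and> a < H \<and> a < p \<and> 1 \<le> b \<and> b < H \<and> b < p \<and>
        Legendre (int a * int b * (int a * int b - 4 * c)) (int p) \<noteq> -1)"
    using eventually_ex_not_minus_one[OF e(1,2)] unfolding g_def[symmetric] eventually_sequentially by blast
  \<comment> \<open>For p < p0 the first alternative holds trivially, since the least nonresidue is
    at most p < C.\<close>
  define C where "C = real p0 + 1"
  have main: "real (least_nonresidue p) \<le> C * real p powr (g + \<epsilon>) \<or>
      (\<forall>(c::int) (H::nat). gcd c (int p) = 1 \<and> H > 0 \<and> real H \<ge> C * real p powr (1 / 6 + \<epsilon>) \<longrightarrow>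
        (\<exists>X\<in>{0..<int p}. \<exists>Y\<in>{0..<int p}. card (modular_hyperbola p c \<inter> modular_box p X Y H) \<ge> 2))"
    if p: "prime p" "odd p" for p
  proof (cases "real (least_nonresidue p) \<le> C * real p powr (g + \<epsilon>)")
    case False
    have p1: "real p > 1" using prime_gt_1_nat[OF p(1)] by simp
    have ge: "x powr (u + e) \<le> C * x powr (u + \<epsilon>)" if "x > 1" for x u :: real
    proof -
      have "x powr (u + e) \<le> 1 * x powr (u + \<epsilon>)" using that e(3) by (simp add: powr_mono)
      also have "\<dots> \<le> C * x powr (u + \<epsilon>)" by (intro mult_right_mono) (auto simp: C_def)
      finally show ?thesis .
    qed
    have "p0 \<le> p"
    proof (rule ccontr)
      assume "\<not> p0 \<le> p"
      then have "real (least_nonresidue p) \<le> C * 1" using least_nonresidue_le[OF p] by (simp add: C_def)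
      also have "\<dots> \<le> C * real p powr (g + \<epsilon>)"
        using p1 g \<open>\<epsilon> > 0\<close> by (intro mult_left_mono ge_one_powr_ge_zero) (auto simp: C_def)
      finally show False using False by simp
    qed
    have res: "Legendre (int n) (int p) = 1" if n: "1 \<le> n" "real n \<le> real p powr (g + e)" for n
    proof -
      have "n < least_nonresidue p" using n(2) ge[OF p1, of g] False by linarith
      then have "QuadRes (int p) (int n)"
        using not_less_Least[of n "\<lambda>n. n > 0 \<and> \<not> QuadRes (int p) (int n)"] n(1)
        unfolding least_nonresidue_def by simp
      moreover have "\<not> int p dvd int n"
      proof -
        have "real p powr (g + e) < real p powr 1" using p1 g e by (intro powr_less_mono) auto
        then have "n < p" using n(2) p1 by simp
        then show ?thesis using n(1) by (auto dest: dvd_imp_le)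
      qed
      ultimately show ?thesis by (simp add: Legendre_def cong_0_iff)
    qed
    have two: "\<exists>X\<in>{0..<int p}. \<exists>Y\<in>{0..<int p}. card (modular_hyperbola p c \<inter> modular_box p X Y H) \<ge> 2"
      if c: "gcd c (int p) = 1" and H: "real H \<ge> C * real p powr (1 / 6 + \<epsilon>)" for c and H :: nat
    proof -
      have ndvd: "\<not> int p dvd c"
      proof
        assume "int p dvd c"
        then have "int p dvd gcd c (int p)" by simp
        then show False using c p1 by simp
      qed
      moreover have "real p powr (1 / 6 + e) \<le> real H" using ge[OF p1, of "1 / 6"] H by linarith
      ultimately obtain a b where "1 \<le> a" "a < H" "a < p" "1 \<le> b" "b < H" "b < p"
        "Legendre (int a * int b * (int a * int b - 4 * c)) (int p) \<noteq> -1"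
        using p0[OF \<open>p0 \<le> p\<close> p] res by blast
      then show ?thesis using ex_box_with_two_points[OF p ndvd] by blast
    qed
    show ?thesis by (intro disjI2 allI impI) (use two in simp)
  qed blast
  show "\<exists>C::real. C > 0 \<and>
    (\<forall>p::nat. prime p \<and> odd p \<longrightarrow>
      real (least_nonresidue p) \<le> C * real p powr (1 / (6 * sqrt (exp 1)) + \<epsilon>) \<or>
      (\<forall>(c::int) (H::nat). gcd c (int p) = 1 \<and> H > 0 \<and>
          real H \<ge> C * real p powr (1 / 6 + \<epsilon>) \<longrightarrow>
        (\<exists>X\<in>{0..<int p}. \<exists>Y\<in>{0..<int p}.
          card (modular_hyperbola p c \<inter> modular_box p X Y H) \<ge> 2)))"
    unfolding g_def[symmetric]
  proof (intro exI[of _ C] conjI[of "C > 0"] allI[where P = "\<lambda>p. prime p \<and> odd p \<longrightarrow> _ p"] impI)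
    show "C > 0" by (simp add: C_def)
  qed (elim conjE, rule main)
qed

end
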